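(* Let $D,d\ge2$, let $|\Psi(\Theta)\rangle$ be the parametrized random tensor-network state with bond dimension $D$ and physical dimension $d$ on the $L\times L$ periodic lattice, let $\hat O$ be a local observable acting on the physical leg of one site, and let $\mathcal{L}_l=\langle\Psi(\Theta)|\hat O|\Psi(\Theta)\rangle$ be the local loss function. Let $\theta_k^{(i)}\in\Theta$ be any parameter of the unitary at a site $i$ different from the site on which $\hat O$ acts, let $\Delta_{\min}$ be the distance between the site hosting the observable and the site $i$ hosting the derivative parameter, and let $\partial_k^{(i)}\mathcal{L}_l=\partial\mathcal{L}_l/\partial\theta_k^{(i)}$. Then, with $\kappa_l=0.93$, for every $\epsilon>0$, $$\Pr\left[|\partial_k^{(i)}\mathcal{L}_l|>\epsilon\right]\le O\left(\frac{\kappa_l^{\Delta_{\min}}}{\epsilon^2}\right),$$ where $\mathrm{Tr}(\hat O^2)$, $d$ and $D$ are treated as constants and the implied constant is independent of $L$, $\Delta_{\min}$ and $\epsilon$.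
   Context: Parametrized random tensor-network state: the sites are the elements $v=(x,y)$ of $\mathbb{Z}_L\times\mathbb{Z}_L$ (torus). Each site carries a unitary $U_v$ on $\mathbb{C}^D\otimes\mathbb{C}^D\otimes\mathbb{C}^d$ of the form $U_v=\prod_\xi e^{i\theta^{(v)}_\xi G_\xi}$ with fixed Hermitian generators $G_\xi$ and real random parameters; $\Theta$ is the set of all parameters. Site tensor: $A^{(v)}_{\alpha,\beta,\gamma,\lambda,j}=\langle\alpha,\beta,0|U_v|\gamma,\lambda,j\rangle$, with bond indices $\alpha,\beta,\gamma,\lambda\in\{1,\dots,D\}$, physical index $j\in\{1,\dots,d\}$, and $|0\rangle$ a fixed unit vector of $\mathbb{C}^d$. The index $\gamma$ of site $(x,y)$ is identified with the index $\alpha$ of $(x,y+1)$, and $\lambda$ of $(x,y)$ with $\beta$ of $(x+1,y)$. $|\Psi(\Theta)\rangle=\sum_{(j_v)}\left(\sum_{\text{bond indices}}\prod_vA^{(v)}\right)|(j_v)_v\rangle$ (not normalized). Randomness: the unitaries at different sites are independent and each forms a unitary 2-design; at the site containing the differentiated parameter $\theta_k$ with generator $G$, write $U=U_-U_+$, splitting the product at that parameter so that $\partial_{\theta_k}U=U_-(iG)U_+$, where $U_-$ and $U_+$ are independent and each forms a unitary 2-design (first and second moments equal to those of Haar measure on $U(D^2d)$). The distance between sites is the shortest-path distance on the periodic square lattice. The implied constant may depend on $D$, $d$, $\mathrm{Tr}(\hat O^2)$ and the generator. *)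

theory Defs
  imports "HOL-Probability.Probability"
begin

section \<open>Matrices and unitary designs\<close>

definition adjoint_matrix :: "complex^'n^'m \<Rightarrow> complex^'m^'n" where
  "adjoint_matrix A = (\<chi> i j. cnj (A $ j $ i))"

definition hermitian_matrix :: "complex^'n^'n \<Rightarrow> bool" where
  "hermitian_matrix A \<longleftrightarrow> adjoint_matrix A = A"

definition unitary_matrix :: "complex^'n^'n \<Rightarrow> bool" where
  "unitary_matrix A \<longleftrightarrow> A ** adjoint_matrix A = mat 1 \<and> adjoint_matrix A ** A = mat 1"

text \<open>Square matrices are not an instance of the class for which \<^const>\<open>exp\<close> is defined.\<close>

definition matrix_exp :: "complex^'n^'n \<Rightarrow> complex^'n^'n" where
  "matrix_exp A = (\<Sum>n. ((**) A ^^ n) (mat 1) /\<^sub>R fact n)"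

definition haar_unitary :: "(complex^'n^'n) measure \<Rightarrow> bool" where
  "haar_unitary \<mu> \<longleftrightarrow> prob_space \<mu> \<and> sets \<mu> = sets borel \<and> (AE U in \<mu>. unitary_matrix U) \<and>
     (\<forall>V. unitary_matrix V \<longrightarrow>
        distr \<mu> borel (\<lambda>U. V ** U) = \<mu> \<and> distr \<mu> borel (\<lambda>U. U ** V) = \<mu>)"

text \<open>
  The entries of \<open>E[U \<otimes> U\<^sup>*]\<close> and \<open>E[U \<otimes> U \<otimes> U\<^sup>* \<otimes> U\<^sup>*]\<close> agree with the Haar averages.
  The Haar measure is unique, so the existential quantifier merely names it.
\<close>

definition unitary_two_design :: "'a measure \<Rightarrow> ('a \<Rightarrow> complex^'n^'n) \<Rightarrow> bool" where
  "unitary_two_design M X \<longleftrightarrow>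
     X \<in> borel_measurable M \<and> (\<forall>\<omega>\<in>space M. unitary_matrix (X \<omega>)) \<and>
     (\<exists>\<mu>. haar_unitary \<mu> \<and>
        (\<forall>i j k l.
           (\<integral>\<omega>. X \<omega> $ i $ j * cnj (X \<omega> $ k $ l) \<partial>M) =
           (\<integral>U. U $ i $ j * cnj (U $ k $ l) \<partial>\<mu>)) \<and>
        (\<forall>i j i' j' k l k' l'.
           (\<integral>\<omega>. X \<omega> $ i $ j * X \<omega> $ i' $ j' * cnj (X \<omega> $ k $ l) * cnj (X \<omega> $ k' $ l') \<partial>M) =
           (\<integral>U. U $ i $ j * U $ i' $ j' * cnj (U $ k $ l) * cnj (U $ k' $ l') \<partial>\<mu>)))"


section \<open>The periodic square lattice\<close>

type_synonym site = "nat \<times> nat"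

definition sites :: "nat \<Rightarrow> site set" where
  "sites L = {..<L} \<times> {..<L}"

definition next_x :: "nat \<Rightarrow> site \<Rightarrow> site" where
  "next_x L v = ((fst v + 1) mod L, snd v)"

definition next_y :: "nat \<Rightarrow> site \<Rightarrow> site" where
  "next_y L v = (fst v, (snd v + 1) mod L)"

definition torus_edges :: "nat \<Rightarrow> (site \<times> site) set" where
  "torus_edges L = {(u, v). u \<in> sites L \<and> v \<in> sites L \<and>
     (v = next_x L u \<or> v = next_y L u \<or> u = next_x L v \<or> u = next_y L v)}"

definition torus_dist :: "nat \<Rightarrow> site \<Rightarrow> site \<Rightarrow> nat" where
  "torus_dist L u v = (LEAST n. (u, v) \<in> torus_edges L ^^ n)"


section \<open>The tensor-network state and the local loss\<close>

text \<open>
  \<open>'b\<close> indexes a basis of the bond space and \<open>'d\<close> a basis of the physical space, so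
  \<open>D = CARD('b)\<close> and \<open>d = CARD('d)\<close>.  The value \<open>\<theta> (v, \<xi>)\<close> is the \<open>\<xi>\<close>-th parameter at site \<open>v\<close>.
\<close>

type_synonym ('b, 'd) site_matrix = "complex^('b \<times> 'b \<times> 'd)^('b \<times> 'b \<times> 'd)"
type_synonym params = "site \<times> nat \<Rightarrow> real"

definition gate :: "('b::finite, 'd::finite) site_matrix \<Rightarrow> real \<Rightarrow> ('b, 'd) site_matrix" where
  "gate G t = matrix_exp (map_matrix ((*) (\<i> * of_real t)) G)"

text \<open>The product of the gates \<open>m, \<dots>, n - 1\<close> at site \<open>v\<close>, gate \<open>m\<close> being leftmost.\<close>

definition partial_unitary ::
  "(nat \<Rightarrow> ('b::finite, 'd::finite) site_matrix) \<Rightarrow> nat \<Rightarrow> nat \<Rightarrow> site \<Rightarrow> params \<Rightarrow> ('b, 'd) site_matrix" where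
  "partial_unitary Gs m n v \<theta> = foldr (\<lambda>\<xi> U. gate (Gs \<xi>) (\<theta> (v, \<xi>)) ** U) [m..<n] (mat 1)"

abbreviation site_unitary ::
  "(nat \<Rightarrow> ('b::finite, 'd::finite) site_matrix) \<Rightarrow> nat \<Rightarrow> site \<Rightarrow> params \<Rightarrow> ('b, 'd) site_matrix" where
  "site_unitary Gs p \<equiv> partial_unitary Gs 0 p"

text \<open>\<open>\<langle>\<alpha>, \<beta>, z| U |\<gamma>, \<lambda>, j\<rangle>\<close> with the vector \<open>z\<close> in the role of \<open>|0\<rangle>\<close>.\<close>

definition site_tensor ::
  "complex^'d \<Rightarrow> ('b::finite, 'd::finite) site_matrix \<Rightarrow> 'b \<Rightarrow> 'b \<Rightarrow> 'b \<Rightarrow> 'b \<Rightarrow> 'd \<Rightarrow> complex" where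
  "site_tensor z U \<alpha> \<beta> \<gamma> l j = (\<Sum>q\<in>UNIV. cnj (z $ q) * U $ (\<alpha>, \<beta>, q) $ (\<gamma>, l, j))"

text \<open>
  A many-site vector is the family of its amplitudes over the physical configurations
  \<open>j \<in> sites L \<rightarrow>\<^sub>E UNIV\<close>.  The bond configurations \<open>a\<close> and \<open>b\<close> give the indices \<open>\<alpha>\<close> and \<open>\<beta>\<close> of each
  site; the indices \<open>\<gamma>\<close> and \<open>\<lambda>\<close> of \<open>v\<close> are then \<open>\<alpha>\<close> of \<open>next_y L v\<close> and \<open>\<beta>\<close> of \<open>next_x L v\<close>.
\<close>

definition tn_state ::
  "nat \<Rightarrow> complex^'d \<Rightarrow> (site \<Rightarrow> ('b::finite, 'd::finite) site_matrix) \<Rightarrow> (site \<Rightarrow> 'd) \<Rightarrow> complex" where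
  "tn_state L z U j =
     (\<Sum>a\<in>sites L \<rightarrow>\<^sub>E (UNIV :: 'b set). \<Sum>b\<in>sites L \<rightarrow>\<^sub>E (UNIV :: 'b set).
        \<Prod>v\<in>sites L. site_tensor z (U v) (a v) (b v) (a (next_y L v)) (b (next_x L v)) (j v))"

definition apply_local ::
  "complex^'d^'d \<Rightarrow> site \<Rightarrow> ((site \<Rightarrow> 'd::finite) \<Rightarrow> complex) \<Rightarrow> (site \<Rightarrow> 'd) \<Rightarrow> complex" where
  "apply_local A w \<Psi> j = (\<Sum>q\<in>UNIV. A $ (j w) $ q * \<Psi> (j(w := q)))"

definition state_inner ::
  "nat \<Rightarrow> ((site \<Rightarrow> 'd::finite) \<Rightarrow> complex) \<Rightarrow> ((site \<Rightarrow> 'd) \<Rightarrow> complex) \<Rightarrow> complex" where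
  "state_inner L \<Phi> \<Psi> = (\<Sum>j\<in>sites L \<rightarrow>\<^sub>E UNIV. cnj (\<Phi> j) * \<Psi> j)"

definition local_loss ::
  "nat \<Rightarrow> nat \<Rightarrow> (nat \<Rightarrow> ('b::finite, 'd::finite) site_matrix) \<Rightarrow> complex^'d \<Rightarrow> complex^'d^'d \<Rightarrow> site \<Rightarrow>
   params \<Rightarrow> complex" where
  "local_loss L p Gs z A w \<theta> =
     (let \<Psi> = tn_state L z (\<lambda>v. site_unitary Gs p v \<theta>) in state_inner L \<Psi> (apply_local A w \<Psi>))"

definition param_deriv :: "(params \<Rightarrow> complex) \<Rightarrow> site \<times> nat \<Rightarrow> params \<Rightarrow> complex" where
  "param_deriv f c \<theta> = vector_derivative (\<lambda>t. f (\<theta>(c := t))) (at (\<theta> c))"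


section \<open>The random parameters\<close>

text \<open>
  \<open>M\<close> is the joint law of all parameters.  At site \<open>i\<close> the product is split as \<open>U = U\<^sub>- U\<^sub>+\<close> with
  \<open>U\<^sub>-\<close> the gates before \<open>s\<close>.  Since \<open>exp (i \<theta>\<^sub>k G\<^sub>k)\<close> commutes with \<open>G\<^sub>k\<close>, the derivative has the form
  \<open>U\<^sub>- (i G\<^sub>k) U\<^sub>+\<close> for both \<open>s = k\<close> and \<open>s = k + 1\<close>, and either choice is allowed.
  Independence is joint, over the unitaries at the sites other than \<open>i\<close> together with \<open>U\<^sub>-\<close>
  and \<open>U\<^sub>+\<close>.
\<close>

definition random_tn_params ::
  "nat \<Rightarrow> nat \<Rightarrow> (nat \<Rightarrow> ('b::finite, 'd::finite) site_matrix) \<Rightarrow> site \<Rightarrow> nat \<Rightarrow> params measure \<Rightarrow> bool" where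
  "random_tn_params L p Gs i k M \<longleftrightarrow>
     prob_space M \<and> sets M = sets (Pi\<^sub>M (sites L \<times> {..<p}) (\<lambda>_. borel)) \<and>
     (\<forall>v\<in>sites L. unitary_two_design M (site_unitary Gs p v)) \<and>
     (\<exists>s\<in>{k, Suc k}.
        unitary_two_design M (partial_unitary Gs 0 s i) \<and>
        unitary_two_design M (partial_unitary Gs s p i) \<and>
        prob_space.indep_vars M (\<lambda>_. borel)
          (case_sum (site_unitary Gs p)
             (\<lambda>left. if left then partial_unitary Gs 0 s i else partial_unitary Gs s p i))
          ((sites L - {i}) <+> (UNIV :: bool set)))"

end

theory Submission
  imports Defs
begin

text \<open>
  By Markov's inequality it suffices to bound the second moment of the derivative, which is a
  network contraction of the tensors \<open>U \<otimes> U\<^sup>* \<otimes> U\<^sup>* \<otimes> U\<close>.  Averaging the independent two-designs puts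
  on every site a spin in \<open>S\<^sub>2 = {identity, swap}\<close>, and the moment becomes a partition function in which
  the weight of a site depends on its own spin and on those of its two successors.  Away from \<open>i\<close> and
  \<open>w\<close> these weights are nonnegative; a swap needs a swapped successor, and as soon as one successor is
  swapped the two weights add up to at most \<open>2/3\<close>.  At \<open>i\<close> the derivative acts as a commutator with the
  generator, which kills the identity, so some successor of \<open>i\<close> must be swapped.  Hence the
  swapped sites either form a directed path from \<open>i\<close> to \<open>w\<close>, or they meet all \<open>L\<close> diagonals
  \<open>x + y = const\<close> of the torus.  Every swapped site costs a factor \<open>2/3\<close>.  Once the spins on one
  diagonal are fixed the remaining sites can be summed out in an acyclic order.  In the first case the
  fixed diagonal is the empty one behind \<open>w\<close>; in the second it is one with the fewest swapped sites,
  and the sum over its configurations is of order \<open>L\<^sup>2 (2/3)\<^sup>L\<close>.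
\<close>

section \<open>Second moments of the Haar measure\<close>

text \<open>A weight sees only the two successors of its site, so a site that is nobody's successor
  can be summed out at a cost of at most 1. On a torus there is no such site; this cyclic dependence
  is the obstacle. Fixing the spins on an arbitrary diagonal removes it but leaves up to 2^L
  configurations, and 2^L (2/3)^L grows. On a diagonal with the smallest number n of swapped sites,
  L n \<le> card S, so its configuration carries ((2/3)^L)^n, and the nonempty configurations sum to
  (1 + (2/3)^L)^L - 1, roughly L (2/3)^L. The choice of the diagonal costs another L.

  The value 2/3 is the exact worst case, attained at D = d = 2 with one or with two swapped
  successors. Directed paths decay at this rate in the distance. The winding configurations decay
  only in L, while the distance is bounded by 2 L; there 0.93^2 = 0.8649 has to dominate 2/3
  together with the polynomial factor.

  By unitarity an identity spin with two identity successors has weight exactly 1, so the bound does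
  not grow with the volume although the state is not normalised.\<close>

text \<open>A quad \<open>((x\<^sub>1, x\<^sub>1'), (x\<^sub>2, x\<^sub>2'))\<close> collects the ket and bra indices of two copies of the network,
  the second copy being conjugated.\<close>

type_synonym 'a quad = "('a \<times> 'a) \<times> 'a \<times> 'a"

definition quad_entry :: "complex^'n^'m \<Rightarrow> 'm quad \<Rightarrow> 'n quad \<Rightarrow> complex" where
  "quad_entry U r c = U $ fst (fst r) $ fst (fst c) * cnj (U $ snd (fst r) $ snd (fst c)) *
     (cnj (U $ fst (snd r) $ fst (snd c)) * U $ snd (snd r) $ snd (snd c))"

text \<open>Permutations of two elements are Booleans: \<open>True\<close> is the swap.\<close>

definition pairing :: "bool \<Rightarrow> 'n quad \<Rightarrow> bool" where
  "pairing \<sigma> x \<longleftrightarrow> (if \<sigma> then fst (fst x) = fst (snd x) \<and> snd (fst x) = snd (snd x)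
     else fst (fst x) = snd (fst x) \<and> fst (snd x) = snd (snd x))"

text \<open>The Weingarten function of \<open>S\<^sub>2\<close>; the argument tells whether the two permutations agree.\<close>

definition weingarten :: "real \<Rightarrow> bool \<Rightarrow> real" where
  "weingarten N b = (if b then N else - 1) / (N * (N\<^sup>2 - 1))"

lemma unitary_matrix_rows:
  "unitary_matrix U \<Longrightarrow> (\<Sum>a\<in>UNIV. U $ i $ a * cnj (U $ k $ a)) = of_bool (i = k)"
  unfolding unitary_matrix_def adjoint_matrix_def matrix_matrix_mult_def mat_def vec_eq_iff
  by (auto simp: mult.commute)

lemma unitary_matrix_cols:
  assumes "unitary_matrix U"
  shows "(\<Sum>a\<in>UNIV. U $ a $ j * cnj (U $ a $ l)) = of_bool (j = l)"
proof -
  have "(adjoint_matrix U ** U) $ l $ j = (mat 1 :: complex^'a^'a) $ l $ j"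
    using assms unfolding unitary_matrix_def by simp
  then show ?thesis
    unfolding adjoint_matrix_def matrix_matrix_mult_def mat_def
    by (auto simp: mult.commute)
qed

lemma unitary_matrixI:
  assumes "\<And>i k. (\<Sum>a\<in>UNIV. U $ i $ a * cnj (U $ k $ a)) = of_bool (i = k)"
  shows "unitary_matrix (U :: complex^'n^'n)"
proof -
  have 1: "U ** adjoint_matrix U = mat 1"
    unfolding adjoint_matrix_def matrix_matrix_mult_def mat_def vec_eq_iff
    using assms by auto
  then have "adjoint_matrix U ** U = mat 1"
    by (simp add: matrix_left_right_inverse)
  with 1 show ?thesis
    unfolding unitary_matrix_def by blast
qed

lemma norm_unitary_entry_le_1:
  assumes "unitary_matrix U"
  shows "norm (U $ i $ j) \<le> 1"
proof -
  have "(\<Sum>a\<in>UNIV. (norm (U $ i $ a))\<^sup>2) = Re (\<Sum>a\<in>UNIV. U $ i $ a * cnj (U $ i $ a))"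
    by (simp only: complex_mult_cnj Re_sum Re_complex_of_real cmod_power2)
  also have "\<dots> = 1"
    using unitary_matrix_rows[OF assms] by simp
  finally have "(norm (U $ i $ j))\<^sup>2 \<le> 1"
    by (metis UNIV_I finite_code member_le_sum zero_le_power2)
  then show ?thesis
    by (simp add: power2_le_iff_abs_le abs_le_square_iff power_le_one_iff)
qed

text \<open>Read as an operator with row (i, i') and column (k, k'), \<open>X\<close> commutes with
  V (x) V for every unitary V. What follows up to \<open>invariant_tensor_decomp\<close> is
  Schur-Weyl duality for two copies, from three kinds of test unitaries: phases, permutations and
  one rotation.\<close>

definition invariant_tensor :: "('n::finite \<Rightarrow> 'n \<Rightarrow> 'n \<Rightarrow> 'n \<Rightarrow> complex) \<Rightarrow> bool" where
  "invariant_tensor X \<longleftrightarrow> (\<forall>V :: complex^'n^'n. unitary_matrix V \<longrightarrow> (\<forall>i i' k k'.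
     X i i' k k' = (\<Sum>a\<in>UNIV. \<Sum>b\<in>UNIV. \<Sum>c\<in>UNIV. \<Sum>e\<in>UNIV.
       V $ i $ a * V $ i' $ b * cnj (V $ k $ c) * cnj (V $ k' $ e) * X a b c e)))"

text \<open>A generalised permutation matrix has one nonzero entry per row, so the fourfold sum
  keeps a single term. Phases give selection rules, permutations make the entries independent of the
  labels.\<close>

lemma invariant_tensor_monomial:
  fixes X :: "'n::finite \<Rightarrow> 'n \<Rightarrow> 'n \<Rightarrow> 'n \<Rightarrow> complex"
  assumes X: "invariant_tensor X" and f: "bij f" and \<phi>: "\<And>i. norm (\<phi> i) = 1"
  shows "X i i' k k' = \<phi> i * \<phi> i' * cnj (\<phi> k) * cnj (\<phi> k') * X (f i) (f i') (f k) (f k')"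
proof -
  define V :: "complex^'n^'n" where "V = (\<chi> i a. if a = f i then \<phi> i else 0)"
  have "unitary_matrix V"
  proof (rule unitary_matrixI)
    fix i k
    have "(\<Sum>a\<in>UNIV. V $ i $ a * cnj (V $ k $ a)) = (\<Sum>a\<in>UNIV. if a = f i then \<phi> i * cnj (if f i = f k then \<phi> k else 0) else 0)"
      unfolding V_def by (intro sum.cong) auto
    also have "\<dots> = of_bool (i = k)"
      using f \<phi> by (auto simp: bij_def inj_eq complex_mult_cnj cmod_power2[symmetric])
    finally show "(\<Sum>a\<in>UNIV. V $ i $ a * cnj (V $ k $ a)) = of_bool (i = k)" .
  qed
  with X have "X i i' k k' = (\<Sum>a\<in>UNIV. \<Sum>b\<in>UNIV. \<Sum>c\<in>UNIV. \<Sum>e\<in>UNIV.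
       V $ i $ a * V $ i' $ b * cnj (V $ k $ c) * cnj (V $ k' $ e) * X a b c e)"
    unfolding invariant_tensor_def by blast
  also have "\<dots> = \<phi> i * \<phi> i' * cnj (\<phi> k) * cnj (\<phi> k') * X (f i) (f i') (f k) (f k')"
  proof -
    have 1: "(\<Sum>a\<in>UNIV. g a) = g z" if "\<And>a. a \<noteq> z \<Longrightarrow> g a = 0" for g :: "'n \<Rightarrow> complex" and z
      using sum.mono_neutral_right[of UNIV "{z}" g] that by auto
    show ?thesis
      by (subst 1[of "f i"], simp add: V_def, subst 1[of "f i'"], simp add: V_def,
        subst 1[of "f k"], simp add: V_def, subst 1[of "f k'"], simp_all add: V_def)
  qed
  finally show ?thesis .
qed

text \<open>Tested with the diagonal unitary that multiplies a single coordinate by \<open>\<i>\<close>.\<close>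

lemma invariant_tensor_eq_0:
  fixes X :: "'n::finite \<Rightarrow> 'n \<Rightarrow> 'n \<Rightarrow> 'n \<Rightarrow> complex"
  assumes X: "invariant_tensor X" and "\<not> (i = k \<and> i' = k')" "\<not> (i = k' \<and> i' = k)"
  shows "X i i' k k' = 0"
proof -
  \<comment> \<open>\<open>x\<close> occurs more often among i, i' than among k, k'. The excess is 1
    or 2, and neither \<i> nor \<i>^2 is 1; the phase -1 would miss an excess of 2.\<close>
  define x where "x = (if i = k \<or> i = k' then i' else i)"
  define \<phi> where "\<phi> j = (if j = x then \<i> else 1)" for j
  have "X i i' k k' = \<phi> i * \<phi> i' * cnj (\<phi> k) * cnj (\<phi> k') * X i i' k k'"
    by (rule invariant_tensor_monomial[OF X, of "\<lambda>x. x"]) (auto simp: \<phi>_def bij_betw_def)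
  then have "X i i' k k' * (1 - \<phi> i * \<phi> i' * cnj (\<phi> k) * cnj (\<phi> k')) = 0"
    by (simp add: algebra_simps)
  moreover have "\<phi> i * \<phi> i' * cnj (\<phi> k) * cnj (\<phi> k') \<noteq> 1"
    using assms(2,3) unfolding \<phi>_def x_def by (auto simp: complex_eq_iff)
  ultimately show ?thesis by auto
qed

lemma ex_bij_two_points:
  assumes "x \<noteq> y" "i \<noteq> i'"
  obtains f :: "'a \<Rightarrow> 'a" where "bij f" "f i = x" "f i' = y"
proof
  let ?t = "Transposition.transpose i x"
  show "bij (Transposition.transpose (?t i') y \<circ> ?t)"
    by (intro bij_comp) auto
  show "(Transposition.transpose (?t i') y \<circ> ?t) i = x" "(Transposition.transpose (?t i') y \<circ> ?t) i' = y"
    using assms by (auto simp: Transposition.transpose_def)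
qed

text \<open>Tested with a Hadamard rotation in the coordinates \<open>x\<close> and \<open>y\<close>.\<close>

lemma invariant_tensor_diagonal:
  fixes X :: "'n::finite \<Rightarrow> 'n \<Rightarrow> 'n \<Rightarrow> 'n \<Rightarrow> complex"
  assumes X: "invariant_tensor X" and xy: "x \<noteq> y"
  shows "X x x x x = X x y x y + X x y y x"
proof -
  define h :: complex where "h = of_real (1 / sqrt 2)"
  have hh: "h * h = 1 / 2" "cnj h = h"
    unfolding h_def of_real_mult[symmetric] by simp_all
  then have hh': "2 * (h * h) = 1"
    by (simp only: hh) simp
  define V :: "complex^'n^'n" where
    "V = (\<chi> i a. if i = x then (if a = x \<or> a = y then h else 0)
       else if i = y then (if a = x then h else if a = y then - h else 0) else of_bool (i = a))"
  have 1: "(\<Sum>a\<in>UNIV. g a) = (\<Sum>a\<in>{x,y}. g a)" if "\<And>a. a \<notin> {x,y} \<Longrightarrow> g a = 0" for g :: "'n \<Rightarrow> complex"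
    using that by (intro sum.mono_neutral_right) auto
  have "unitary_matrix V"
  proof (rule unitary_matrixI)
    fix i k
    show "(\<Sum>a\<in>UNIV. V $ i $ a * cnj (V $ k $ a)) = of_bool (i = k)"
    proof (cases "i = x \<or> i = y")
      case True
      then have "(\<Sum>a\<in>UNIV. V $ i $ a * cnj (V $ k $ a)) = (\<Sum>a\<in>{x,y}. V $ i $ a * cnj (V $ k $ a))"
        by (intro 1) (auto simp: V_def)
      also have "\<dots> = of_bool (i = k)"
        using True xy hh hh' by (auto simp: V_def)
      finally show ?thesis .
    next
      case False
      then have "(\<Sum>a\<in>UNIV. V $ i $ a * cnj (V $ k $ a)) = (\<Sum>a\<in>UNIV. if i = a then cnj (V $ k $ i) else 0)"
        by (intro sum.cong) (auto simp: V_def)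
      also have "\<dots> = of_bool (i = k)"
        using False by (auto simp: V_def)
      finally show ?thesis .
    qed
  qed
  note V = this
  define Y where "Y a b c e = V $ x $ a * V $ x $ b * cnj (V $ x $ c) * cnj (V $ x $ e) * X a b c e" for a b c e
  have Y0: "Y a b c e = 0" if "a \<notin> {x,y} \<or> b \<notin> {x,y} \<or> c \<notin> {x,y} \<or> e \<notin> {x,y}" for a b c e
    using that unfolding Y_def by (auto simp: V_def)
  from X V have "X x x x x = (\<Sum>a\<in>UNIV. \<Sum>b\<in>UNIV. \<Sum>c\<in>UNIV. \<Sum>e\<in>UNIV. Y a b c e)"
    unfolding invariant_tensor_def Y_def by blast
  also have "\<dots> = (\<Sum>a\<in>UNIV. \<Sum>b\<in>UNIV. \<Sum>c\<in>UNIV. \<Sum>e\<in>{x,y}. Y a b c e)"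
    by (rule sum.cong[OF refl], rule sum.cong[OF refl], rule sum.cong[OF refl], rule 1) (simp add: Y0)
  also have "\<dots> = (\<Sum>a\<in>UNIV. \<Sum>b\<in>UNIV. \<Sum>c\<in>{x,y}. \<Sum>e\<in>{x,y}. Y a b c e)"
    by (rule sum.cong[OF refl], rule sum.cong[OF refl], rule 1) (simp add: Y0)
  also have "\<dots> = (\<Sum>a\<in>UNIV. \<Sum>b\<in>{x,y}. \<Sum>c\<in>{x,y}. \<Sum>e\<in>{x,y}. Y a b c e)"
    by (rule sum.cong[OF refl], rule 1) (simp add: Y0)
  also have "\<dots> = (\<Sum>a\<in>{x,y}. \<Sum>b\<in>{x,y}. \<Sum>c\<in>{x,y}. \<Sum>e\<in>{x,y}. Y a b c e)"
    by (rule 1) (simp add: Y0)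
  also have "\<dots> = (\<Sum>a\<in>{x,y}. \<Sum>b\<in>{x,y}. \<Sum>c\<in>{x,y}. \<Sum>e\<in>{x,y}. (h * h) * (h * h) * X a b c e)"
    unfolding Y_def by (intro sum.cong refl) (auto simp: V_def hh)
  \<comment> \<open>Of the sixteen terms the selection rule leaves six; exchanging x and y
    identifies them in pairs.\<close>
  also have "\<dots> = (X x x x x + X y y y y + X x y x y + X y x y x + X x y y x + X y x x y) / 4"
    using xy unfolding hh by (simp add: invariant_tensor_eq_0[OF X])
  finally have eq: "4 * X x x x x = X x x x x + X y y y y + X x y x y + X y x y x + X x y y x + X y x x y"
    by simp
  have sw: "X a b c e = X (Transposition.transpose x y a) (Transposition.transpose x y b) (Transposition.transpose x y c) (Transposition.transpose x y e)" for a b c e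
    using invariant_tensor_monomial[OF X, of "Transposition.transpose x y" "\<lambda>_. 1" a b c e] by simp
  have "X y y y y = X x x x x" "X y x y x = X x y x y" "X y x x y = X x y y x"
    by (subst sw, simp)+
  with eq have "2 * X x x x x = 2 * (X x y x y + X x y y x)" by simp
  then show ?thesis by (simp only: mult_cancel_left) simp
qed

text \<open>A permutation moves any two distinct labels to \<open>x\<close> and \<open>y\<close>, so
  the off-diagonal entries are two constants. The rotation identity makes a diagonal entry their
  sum, which is what the two indicators give together.\<close>

lemma invariant_tensor_decomp:
  fixes X :: "'n::finite \<Rightarrow> 'n \<Rightarrow> 'n \<Rightarrow> 'n \<Rightarrow> complex"
  assumes X: "invariant_tensor X" and card: "CARD('n) \<ge> 2"
  obtains p q where "\<And>i i' k k'. X i i' k k' = p * of_bool (i = k \<and> i' = k') + q * of_bool (i = k' \<and> i' = k)"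
proof -
  from card obtain x y :: 'n where xy: "x \<noteq> y"
    using card_le_Suc0_iff_eq[of "UNIV :: 'n set"] by auto
  have off: "X i i' i i' = X x y x y" "X i i' i' i = X x y y x" if ne: "i \<noteq> i'" for i i'
  proof -
    obtain f where f: "bij f" "f i = x" "f i' = y"
      using ex_bij_two_points[OF xy ne] by blast
    show "X i i' i i' = X x y x y" "X i i' i' i = X x y y x"
      using invariant_tensor_monomial[OF X f(1), of "\<lambda>_. 1"] f by auto
  qed
  have diag: "X i i i i = X x y x y + X x y y x" for i
  proof -
    obtain i' where "i \<noteq> i'" using xy by (cases "i = x") auto
    then show ?thesis by (metis invariant_tensor_diagonal[OF X] off)
  qed
  show ?thesis
  proof (rule that[of "X x y x y" "X x y y x"])
    fix i i' k k'
    show "X i i' k k' = X x y x y * of_bool (i = k \<and> i' = k') + X x y y x * of_bool (i = k' \<and> i' = k)"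
    proof (cases "(i = k \<and> i' = k') \<or> (i = k' \<and> i' = k)")
      case True
      then consider "i = i'" "k = i" "k' = i" | "i \<noteq> i'" "k = i" "k' = i'" | "i \<noteq> i'" "k = i'" "k' = i"
        by blast
      then show ?thesis
        by cases (simp_all add: diag[of i] diag[of i'] off[of i i'])
    next
      case False
      then have "X i i' k k' = 0" "\<not> (i = k \<and> i' = k')" "\<not> (i = k' \<and> i' = k)"
        by (blast intro: invariant_tensor_eq_0[OF X])+
      then show ?thesis by (simp only: of_bool_eq mult_zero_right add_0)
    qed
  qed
qed

section \<open>From invariant tensors to the moments of Haar measure and of two-designs\<close>

lemma continuous_on_matrix_mult_left: "continuous_on S (\<lambda>U :: complex^'n^'n. V ** U)"
  unfolding matrix_matrix_mult_def by (intro continuous_intros)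

lemma haar_integral_left:
  fixes f :: "complex^'n^'n \<Rightarrow> complex"
  assumes H: "haar_unitary \<mu>" and V: "unitary_matrix V" and f: "f \<in> borel_measurable borel"
  shows "(\<integral>U. f (V ** U) \<partial>\<mu>) = (\<integral>U. f U \<partial>\<mu>)"
proof -
  have s: "sets \<mu> = sets borel" and d: "distr \<mu> borel (\<lambda>U. V ** U) = \<mu>"
    using H V unfolding haar_unitary_def by auto
  have m: "(\<lambda>U. V ** U) \<in> \<mu> \<rightarrow>\<^sub>M borel"
    unfolding measurable_cong_sets[OF s refl]
    by (intro borel_measurable_continuous_onI continuous_on_matrix_mult_left)
  have "(\<integral>U. f U \<partial>\<mu>) = (\<integral>U. f U \<partial>(distr \<mu> borel (\<lambda>U. V ** U)))"
    by (simp only: d)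
  also have "\<dots> = (\<integral>U. f (V ** U) \<partial>\<mu>)"
    by (rule integral_distr[OF m f])
  finally show ?thesis by simp
qed

text \<open>The column indices come first, so that a partial application is a tensor in the row
  indices, on which left translation acts.\<close>

definition haar_moment :: "(complex^'n^'n) measure \<Rightarrow> 'n::finite \<Rightarrow> 'n \<Rightarrow> 'n \<Rightarrow> 'n \<Rightarrow> 'n \<Rightarrow> 'n \<Rightarrow> 'n \<Rightarrow> 'n \<Rightarrow> complex" where
  "haar_moment \<mu> j j' l l' i i' k k' =
     (\<integral>U. U $ i $ j * U $ i' $ j' * cnj (U $ k $ l) * cnj (U $ k' $ l') \<partial>\<mu>)"

lemma measurable_matrix_entry [measurable]:
  "(\<lambda>U :: complex^'n^'m. U $ i $ j) \<in> borel_measurable borel"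
  by (intro borel_measurable_continuous_onI continuous_intros)

lemma measurable_cnj [measurable]: "cnj \<in> borel_measurable borel"
  by (intro borel_measurable_continuous_onI continuous_intros)

lemma haar_moment_integrable:
  assumes H: "haar_unitary \<mu>"
  shows "integrable \<mu> (\<lambda>U. U $ i $ j * U $ i' $ j' * cnj (U $ k $ l) * cnj (U $ k' $ l'))"
proof -
  interpret prob_space \<mu> using H unfolding haar_unitary_def by blast
  have s [measurable_cong]: "sets \<mu> = sets borel" using H unfolding haar_unitary_def by blast
  show ?thesis
  proof (rule integrable_const_bound)
    show "(\<lambda>U. U $ i $ j * U $ i' $ j' * cnj (U $ k $ l) * cnj (U $ k' $ l')) \<in> borel_measurable \<mu>"
      by measurable
    have "AE U in \<mu>. unitary_matrix U" using H unfolding haar_unitary_def by blast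
    then show "AE U in \<mu>. norm (U $ i $ j * U $ i' $ j' * cnj (U $ k $ l) * cnj (U $ k' $ l')) \<le> 1"
    proof eventually_elim
      case (elim U)
      then show ?case
        unfolding norm_mult complex_mod_cnj
        by (intro mult_le_one norm_unitary_entry_le_1 mult_nonneg_nonneg norm_ge_zero)
    qed
  qed
qed

text \<open>Left translation replaces U by V U; expanding the rows pulls the entries of V out of the
  integral and leaves the column indices untouched.\<close>

lemma haar_moment_invariant:
  fixes \<mu> :: "(complex^'n^'n) measure"
  assumes H: "haar_unitary \<mu>"
  shows "invariant_tensor (haar_moment \<mu> j j' l l')"
  unfolding invariant_tensor_def
proof (intro allI impI)
  fix V :: "complex^'n^'n" and i i' k k'
  assume V: "unitary_matrix V"
  have four: "(\<Sum>a\<in>UNIV. f a) * (\<Sum>b\<in>UNIV. g b) * cnj (\<Sum>c\<in>UNIV. h c) * cnj (\<Sum>e\<in>UNIV. t e) =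
      (\<Sum>a\<in>UNIV. \<Sum>b\<in>UNIV. \<Sum>c\<in>UNIV. \<Sum>e\<in>UNIV. f a * g b * cnj (h c) * cnj (t e))"
    for f g h t :: "'n \<Rightarrow> complex"
    unfolding cnj_sum mult.assoc unfolding sum_distrib_right unfolding sum_distrib_left ..
  have "haar_moment \<mu> j j' l l' i i' k k' =
      (\<integral>U. (V ** U) $ i $ j * (V ** U) $ i' $ j' * cnj ((V ** U) $ k $ l) * cnj ((V ** U) $ k' $ l') \<partial>\<mu>)"
    unfolding haar_moment_def
    by (rule haar_integral_left[OF H V, of "\<lambda>U. U $ i $ j * U $ i' $ j' * cnj (U $ k $ l) * cnj (U $ k' $ l')", symmetric]) measurable
  also have "\<dots> = (\<integral>U. (\<Sum>a\<in>UNIV. \<Sum>b\<in>UNIV. \<Sum>c\<in>UNIV. \<Sum>e\<in>UNIV.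
      V $ i $ a * V $ i' $ b * cnj (V $ k $ c) * cnj (V $ k' $ e) *
      (U $ a $ j * U $ b $ j' * cnj (U $ c $ l) * cnj (U $ e $ l'))) \<partial>\<mu>)"
    unfolding matrix_matrix_mult_def vec_lambda_beta four
    by (simp only: complex_cnj_mult mult_ac)
  also have "\<dots> = (\<Sum>a\<in>UNIV. \<Sum>b\<in>UNIV. \<Sum>c\<in>UNIV. \<Sum>e\<in>UNIV.
      V $ i $ a * V $ i' $ b * cnj (V $ k $ c) * cnj (V $ k' $ e) * haar_moment \<mu> j j' l l' a b c e)"
    unfolding haar_moment_def
    by (subst Bochner_Integration.integral_sum Bochner_Integration.integral_mult_right_zero
      | intro Bochner_Integration.integrable_sum integrable_mult_right haar_moment_integrable[OF H] sum.cong refl)+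
  finally show "haar_moment \<mu> j j' l l' i i' k k' = (\<Sum>a\<in>UNIV. \<Sum>b\<in>UNIV. \<Sum>c\<in>UNIV. \<Sum>e\<in>UNIV.
      V $ i $ a * V $ i' $ b * cnj (V $ k $ c) * cnj (V $ k' $ e) * haar_moment \<mu> j j' l l' a b c e)" .
qed

text \<open>Orthonormality of the columns of U makes both contractions deterministic. They are the
  two linear equations that determine the two unknown coefficients.\<close>

lemma haar_moment_contract:
  fixes \<mu> :: "(complex^'n^'n) measure"
  assumes H: "haar_unitary \<mu>"
  shows "(\<Sum>i\<in>UNIV. \<Sum>i'\<in>UNIV. haar_moment \<mu> j j' l l' i i' i i') = of_bool (j = l \<and> j' = l')"
    and "(\<Sum>i\<in>UNIV. \<Sum>i'\<in>UNIV. haar_moment \<mu> j j' l l' i i' i' i) = of_bool (j = l' \<and> j' = l)"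
proof -
  interpret prob_space \<mu> using H unfolding haar_unitary_def by blast
  have s [measurable_cong]: "sets \<mu> = sets borel" using H unfolding haar_unitary_def by blast
  have U: "AE U in \<mu>. unitary_matrix U" using H unfolding haar_unitary_def by blast
  have "(\<Sum>i\<in>UNIV. \<Sum>i'\<in>UNIV. haar_moment \<mu> j j' l l' i i' i i') =
    (\<integral>U. (\<Sum>i\<in>UNIV. \<Sum>i'\<in>UNIV. U $ i $ j * U $ i' $ j' * cnj (U $ i $ l) * cnj (U $ i' $ l')) \<partial>\<mu>)"
    unfolding haar_moment_def by (simp add: haar_moment_integrable[OF H])
  also have "\<dots> = (\<integral>U. of_bool (j = l \<and> j' = l') \<partial>\<mu>)"
  proof (rule integral_cong_AE)
    show "AE U in \<mu>. (\<Sum>i\<in>UNIV. \<Sum>i'\<in>UNIV. U $ i $ j * U $ i' $ j' * cnj (U $ i $ l) * cnj (U $ i' $ l')) = of_bool (j = l \<and> j' = l')"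
      using U
    proof eventually_elim
      case (elim U)
      have "(\<Sum>i\<in>UNIV. \<Sum>i'\<in>UNIV. U $ i $ j * U $ i' $ j' * cnj (U $ i $ l) * cnj (U $ i' $ l')) =
        (\<Sum>i\<in>UNIV. U $ i $ j * cnj (U $ i $ l)) * (\<Sum>i\<in>UNIV. U $ i $ j' * cnj (U $ i $ l'))"
        unfolding sum_product by (simp add: mult_ac)
      then show ?case unfolding unitary_matrix_cols[OF elim] by simp
    qed
  qed simp_all
  finally show "(\<Sum>i\<in>UNIV. \<Sum>i'\<in>UNIV. haar_moment \<mu> j j' l l' i i' i i') = of_bool (j = l \<and> j' = l')"
    by (simp add: prob_space)
  have "(\<Sum>i\<in>UNIV. \<Sum>i'\<in>UNIV. haar_moment \<mu> j j' l l' i i' i' i) =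
    (\<integral>U. (\<Sum>i\<in>UNIV. \<Sum>i'\<in>UNIV. U $ i $ j * U $ i' $ j' * cnj (U $ i' $ l) * cnj (U $ i $ l')) \<partial>\<mu>)"
    unfolding haar_moment_def by (simp add: haar_moment_integrable[OF H])
  also have "\<dots> = (\<integral>U. of_bool (j = l' \<and> j' = l) \<partial>\<mu>)"
  proof (rule integral_cong_AE)
    show "AE U in \<mu>. (\<Sum>i\<in>UNIV. \<Sum>i'\<in>UNIV. U $ i $ j * U $ i' $ j' * cnj (U $ i' $ l) * cnj (U $ i $ l')) = of_bool (j = l' \<and> j' = l)"
      using U
    proof eventually_elim
      case (elim U)
      have "(\<Sum>i\<in>UNIV. \<Sum>i'\<in>UNIV. U $ i $ j * U $ i' $ j' * cnj (U $ i' $ l) * cnj (U $ i $ l')) =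
        (\<Sum>i\<in>UNIV. U $ i $ j * cnj (U $ i $ l')) * (\<Sum>i\<in>UNIV. U $ i $ j' * cnj (U $ i $ l))"
        unfolding sum_product by (simp add: mult_ac)
      then show ?case unfolding unitary_matrix_cols[OF elim] by simp
    qed
  qed simp_all
  finally show "(\<Sum>i\<in>UNIV. \<Sum>i'\<in>UNIV. haar_moment \<mu> j j' l l' i i' i' i) = of_bool (j = l' \<and> j' = l)"
    by (simp add: prob_space)
qed

lemma haar_moment_eq:
  fixes \<mu> :: "(complex^'n^'n) measure"
  assumes H: "haar_unitary \<mu>" and card: "CARD('n) \<ge> 2"
  defines "w \<equiv> \<lambda>b. complex_of_real (weingarten (real CARD('n)) b)"
  shows "haar_moment \<mu> j j' l l' i i' k k' =
    (w True * of_bool (j = l \<and> j' = l') + w False * of_bool (j = l' \<and> j' = l)) * of_bool (i = k \<and> i' = k') +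
    (w False * of_bool (j = l \<and> j' = l') + w True * of_bool (j = l' \<and> j' = l)) * of_bool (i = k' \<and> i' = k)"
proof -
  obtain p q where pq: "\<And>i i' k k'. haar_moment \<mu> j j' l l' i i' k k' = p * of_bool (i = k \<and> i' = k') + q * of_bool (i = k' \<and> i' = k)"
    using invariant_tensor_decomp[OF haar_moment_invariant[OF H] card] by blast
  define N where "N = real CARD('n)"
  have N: "N \<ge> 2" unfolding N_def using card by linarith
  then have "N\<^sup>2 > 1"
    by (simp add: power2_eq_square less_1_mult)
  then have nz: "N * (N\<^sup>2 - 1) \<noteq> 0"
    using N by (metis diff_gt_0_iff_gt less_numeral_extra(3) mult_eq_0_iff not_numeral_le_zero)
  define A where "A = (of_bool (j = l \<and> j' = l') :: complex)"
  define B where "B = (of_bool (j = l' \<and> j' = l) :: complex)"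
  have qd: "q * of_bool (i = i' \<and> i' = i) = (if i = i' then q else 0)" for i i' :: 'n by simp
  have pd: "p * of_bool (i = i' \<and> i' = i) = (if i = i' then p else 0)" for i i' :: 'n by simp
  \<comment> \<open>The Gram matrix of the two permutations has entries N^2 and N; the Weingarten
    function is its inverse.\<close>
  have e1: "of_real N * of_real N * p + of_real N * q = A"
    using haar_moment_contract(1)[OF H, of j j' l l'] unfolding pq A_def N_def
    by (simp add: qd sum.distrib algebra_simps)
  have e2: "of_real N * p + of_real N * of_real N * q = B"
    using haar_moment_contract(2)[OF H, of j j' l l'] unfolding pq B_def N_def
    by (simp add: pd qd sum.distrib algebra_simps)
  have nz': "complex_of_real N * (of_real N ^ 2 - 1) \<noteq> 0"
  proof -
    have "complex_of_real N * (of_real N ^ 2 - 1) = of_real (N * (N\<^sup>2 - 1))" by simp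
    then show ?thesis using nz by (simp only: of_real_eq_0_iff not_False_eq_True)
  qed
  have "complex_of_real N * (of_real N ^ 2 - 1) * p = of_real N * A - B"
    unfolding e1[symmetric] e2[symmetric] by (simp add: power2_eq_square algebra_simps)
  then have p: "p = (of_real N * A - B) / (of_real N * (of_real N ^ 2 - 1))"
    using nz' by (simp add: field_simps)
  have "complex_of_real N * (of_real N ^ 2 - 1) * q = of_real N * B - A"
    unfolding e1[symmetric] e2[symmetric] by (simp add: power2_eq_square algebra_simps)
  then have q: "q = (of_real N * B - A) / (of_real N * (of_real N ^ 2 - 1))"
    using nz' by (simp add: field_simps)
  have w: "w True = of_real N / (of_real N * (of_real N ^ 2 - 1))" "w False = - 1 / (of_real N * (of_real N ^ 2 - 1))"
    unfolding w_def weingarten_def N_def by simp_all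
  show ?thesis
    unfolding pq p q w A_def[symmetric] B_def[symmetric] by (simp add: diff_divide_distrib)
qed

lemma two_design_moment:
  fixes X :: "'a \<Rightarrow> complex^'n^'n"
  assumes X: "unitary_two_design M X" and card: "CARD('n) \<ge> 2"
  shows "(\<integral>\<omega>. quad_entry (X \<omega>) r c \<partial>M) =
    (\<Sum>\<sigma>\<in>UNIV. \<Sum>\<rho>\<in>UNIV. of_real (weingarten (real CARD('n)) (\<sigma> = \<rho>)) *
       of_bool (pairing \<sigma> r) * of_bool (pairing \<rho> c))"
proof -
  obtain \<mu> where H: "haar_unitary \<mu>" and eq: "\<And>i j i' j' k l k' l'.
      (\<integral>\<omega>. X \<omega> $ i $ j * X \<omega> $ i' $ j' * cnj (X \<omega> $ k $ l) * cnj (X \<omega> $ k' $ l') \<partial>M) =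
      haar_moment \<mu> j j' l l' i i' k k'"
    using X unfolding unitary_two_design_def haar_moment_def by blast
  \<comment> \<open>The second copy is conjugated: its first slot belongs to a conjugated factor and
    its second to a plain one, hence the order k', i'.\<close>
  obtain i k k' i' where r: "r = ((i, k), (k', i'))" by (metis prod.exhaust)
  obtain j l l' j' where c: "c = ((j, l), (l', j'))" by (metis prod.exhaust)
  have "(\<integral>\<omega>. quad_entry (X \<omega>) r c \<partial>M) = haar_moment \<mu> j j' l l' i i' k k'"
    unfolding eq[symmetric] quad_entry_def r c by (simp add: mult_ac)
  also have "\<dots> = (\<Sum>\<sigma>\<in>UNIV. \<Sum>\<rho>\<in>UNIV. of_real (weingarten (real CARD('n)) (\<sigma> = \<rho>)) *
       of_bool (pairing \<sigma> r) * of_bool (pairing \<rho> c))"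
  proof -
    have "pairing False r \<longleftrightarrow> i = k \<and> i' = k'" "pairing True r \<longleftrightarrow> i = k' \<and> i' = k"
      "pairing False c \<longleftrightarrow> j = l \<and> j' = l'" "pairing True c \<longleftrightarrow> j = l' \<and> j' = l"
      unfolding pairing_def r c by auto
    then show ?thesis
      unfolding haar_moment_eq[OF H card] UNIV_bool
      by (simp only: sum.insert finite.intros finite_insert insert_iff empty_iff simp_thms sum.empty add_0_right)
        (simp only: algebra_simps)
  qed
  finally show ?thesis .
qed

section \<open>Contractions of the network\<close>

lemma finite_sites [simp]: "finite (sites L)"
  unfolding sites_def by simp

lemma next_sites [simp]:
  assumes "v \<in> sites L"
  shows "next_x L v \<in> sites L" "next_y L v \<in> sites L"
  using assms unfolding sites_def next_x_def next_y_def by auto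

lemma inj_on_Suc_mod: "inj_on (\<lambda>x::nat. (x + 1) mod L) {..<L}"
proof (rule inj_onI)
  fix x y assume xy: "x \<in> {..<L}" "y \<in> {..<L}" and "(x + 1) mod L = (y + 1) mod L"
  then have "Suc x mod L = Suc y mod L" by simp
  with xy show "x = y" by (auto simp: mod_Suc split: if_splits)
qed

lemma bij_betw_next:
  "bij_betw (next_x L) (sites L) (sites L)" "bij_betw (next_y L) (sites L) (sites L)"
proof -
  have *: "inj_on (next_x L) (sites L)" "inj_on (next_y L) (sites L)"
    unfolding next_x_def next_y_def sites_def
    by (auto intro!: inj_onI prod_eqI dest: inj_onD[OF inj_on_Suc_mod[of L]] simp del: One_nat_def add_Suc_right)
  show "bij_betw (next_x L) (sites L) (sites L)" "bij_betw (next_y L) (sites L) (sites L)"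
    unfolding bij_betw_def using * endo_inj_surj[OF finite_sites _ *(1)] endo_inj_surj[OF finite_sites _ *(2)]
    by (simp_all add: image_subset_iff)
qed

text \<open>Outside \<open>V\<close> the maps \<open>fst \<circ> c\<close> and
  \<open>snd \<circ> c\<close> need not be \<open>undefined\<close>, so the two sides are matched
  for an \<open>F\<close> that reads its arguments on \<open>V\<close> only.\<close>

lemma sum_PiE_pair:
  fixes F :: "('a \<Rightarrow> 'x) \<Rightarrow> ('a \<Rightarrow> 'y) \<Rightarrow> complex"
  assumes F: "\<And>a a' b b'. (\<And>v. v \<in> V \<Longrightarrow> a v = a' v \<and> b v = b' v) \<Longrightarrow> F a b = F a' b'"
  shows "(\<Sum>a\<in>V \<rightarrow>\<^sub>E UNIV. \<Sum>b\<in>V \<rightarrow>\<^sub>E UNIV. F a b) = (\<Sum>c\<in>V \<rightarrow>\<^sub>E UNIV. F (fst \<circ> c) (snd \<circ> c))"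
  unfolding sum.cartesian_product
  by (rule sum.reindex_bij_witness[where
        i = "\<lambda>c. (restrict (fst \<circ> c) V, restrict (snd \<circ> c) V)" and
        j = "\<lambda>ab. restrict (\<lambda>v. (fst ab v, snd ab v)) V"])
    (auto simp: fun_eq_iff PiE_iff extensional_def intro!: F)

lemma sum_PiE_bool:
  fixes F :: "('a \<Rightarrow> bool) \<Rightarrow> complex"
  assumes F: "\<And>a a'. (\<And>v. v \<in> V \<Longrightarrow> a v = a' v) \<Longrightarrow> F a = F a'"
  shows "(\<Sum>\<sigma>\<in>V \<rightarrow>\<^sub>E UNIV. F \<sigma>) = (\<Sum>S\<in>Pow V. F (\<lambda>v. v \<in> S))"
  by (rule sum.reindex_bij_witness[where
        i = "\<lambda>S. restrict (\<lambda>v. v \<in> S) V" and j = "\<lambda>\<sigma>. {v \<in> V. \<sigma> v}"])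
    (auto simp: fun_eq_iff PiE_iff extensional_def intro!: F)

text \<open>One form for all contractions: the conjugates, products (over paired bonds), derivatives
  and expectations met below are again of this form.\<close>

definition tn_net :: "nat \<Rightarrow> (site \<Rightarrow> 'x \<Rightarrow> 'x \<Rightarrow> 'x \<Rightarrow> 'x \<Rightarrow> complex) \<Rightarrow> complex" where
  "tn_net L X = (\<Sum>a\<in>sites L \<rightarrow>\<^sub>E UNIV. \<Sum>b\<in>sites L \<rightarrow>\<^sub>E UNIV.
     \<Prod>v\<in>sites L. X v (a v) (b v) (a (next_y L v)) (b (next_x L v)))"

lemma tn_net_cong:
  "(\<And>v a b c l. v \<in> sites L \<Longrightarrow> X v a b c l = Y v a b c l) \<Longrightarrow> tn_net L X = tn_net L Y"
  unfolding tn_net_def by (intro sum.cong prod.cong refl) auto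

lemma cnj_tn_net: "cnj (tn_net L X) = tn_net L (\<lambda>v a b c l. cnj (X v a b c l))"
  unfolding tn_net_def by simp

lemma tn_net_mult:
  "tn_net L X * tn_net L Y = tn_net L (\<lambda>v a b c l.
     X v (fst a) (fst b) (fst c) (fst l) * Y v (snd a) (snd b) (snd c) (snd l))"
proof -
  define F where "F a a' b b' = (\<Prod>v\<in>sites L. X v (a v) (b v) (a (next_y L v)) (b (next_x L v)) *
    Y v (a' v) (b' v) (a' (next_y L v)) (b' (next_x L v)))" for a a' b b'
  have F: "F a1 a1' b1 b1' = F a2 a2' b2 b2'"
    if "\<And>v. v \<in> sites L \<Longrightarrow> a1 v = a2 v \<and> a1' v = a2' v"
       "\<And>v. v \<in> sites L \<Longrightarrow> b1 v = b2 v \<and> b1' v = b2' v" for a1 a1' b1 b1' a2 a2' b2 b2'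
    unfolding F_def using that by (intro prod.cong) simp_all
  let ?P = "sites L \<rightarrow>\<^sub>E (UNIV :: 'a set)" and ?Q = "sites L \<rightarrow>\<^sub>E (UNIV :: 'b set)"
  have "tn_net L X * tn_net L Y = (\<Sum>a\<in>?P. \<Sum>a'\<in>?Q. \<Sum>b\<in>?P. \<Sum>b'\<in>?Q. F a a' b b')"
    unfolding tn_net_def sum_product F_def prod.distrib by (rule sum.cong[OF refl], rule sum.cong[OF refl]) (simp add: sum_product)
  also have "\<dots> = (\<Sum>a\<in>?P. \<Sum>a'\<in>?Q. \<Sum>b\<in>sites L \<rightarrow>\<^sub>E UNIV. F a a' (fst \<circ> b) (snd \<circ> b))"
    by (rule sum.cong[OF refl], rule sum.cong[OF refl], rule sum_PiE_pair, rule F) auto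
  also have "\<dots> = (\<Sum>a\<in>sites L \<rightarrow>\<^sub>E UNIV. \<Sum>b\<in>sites L \<rightarrow>\<^sub>E UNIV. F (fst \<circ> a) (snd \<circ> a) (fst \<circ> b) (snd \<circ> b))"
    by (rule sum_PiE_pair[of _ "\<lambda>a a'. \<Sum>b\<in>sites L \<rightarrow>\<^sub>E UNIV. F a a' (fst \<circ> b) (snd \<circ> b)"]) (rule sum.cong[OF refl], rule F, auto)
  finally show ?thesis
    unfolding tn_net_def F_def by simp
qed

lemma sum_PiE_prod:
  fixes f :: "'a \<Rightarrow> 'x::finite \<Rightarrow> complex"
  assumes "finite V"
  shows "(\<Sum>j\<in>V \<rightarrow>\<^sub>E UNIV. \<Prod>v\<in>V. f v (j v)) = (\<Prod>v\<in>V. \<Sum>x\<in>UNIV. f v x)"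
  using prod_sum_PiE[of V "\<lambda>_. UNIV" f] assms by simp

lemma sum_PiE_prod2:
  fixes f :: "'a \<Rightarrow> 'x::finite \<Rightarrow> 'y::finite \<Rightarrow> complex"
  assumes "finite V"
  shows "(\<Sum>j\<in>V \<rightarrow>\<^sub>E UNIV. \<Sum>j'\<in>V \<rightarrow>\<^sub>E UNIV. \<Prod>v\<in>V. f v (j v) (j' v)) =
    (\<Prod>v\<in>V. \<Sum>x\<in>UNIV. \<Sum>y\<in>UNIV. f v x y)"
proof -
  have "(\<Sum>j'\<in>V \<rightarrow>\<^sub>E UNIV. \<Prod>v\<in>V. f v (j v) (j' v)) = (\<Prod>v\<in>V. \<Sum>y\<in>UNIV. f v (j v) y)" for j
    using sum_PiE_prod[OF assms, of "\<lambda>v y. f v (j v) y"] .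
  then show ?thesis
    using sum_PiE_prod[OF assms, of "\<lambda>v x. \<Sum>y\<in>UNIV. f v x y"] by simp
qed

lemma sum_swap_pairs:
  "(\<Sum>a\<in>A. \<Sum>b\<in>B. \<Sum>c\<in>C. \<Sum>e\<in>E. f a b c e) = (\<Sum>c\<in>C. \<Sum>e\<in>E. \<Sum>a\<in>A. \<Sum>b\<in>B. f a b c e)"
proof -
  have "(\<Sum>a\<in>A. \<Sum>b\<in>B. \<Sum>c\<in>C. \<Sum>e\<in>E. f a b c e) = (\<Sum>a\<in>A. \<Sum>c\<in>C. \<Sum>b\<in>B. \<Sum>e\<in>E. f a b c e)"
    by (rule sum.cong[OF refl], rule sum.swap)
  also have "\<dots> = (\<Sum>c\<in>C. \<Sum>a\<in>A. \<Sum>b\<in>B. \<Sum>e\<in>E. f a b c e)"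
    by (rule sum.swap)
  also have "\<dots> = (\<Sum>c\<in>C. \<Sum>a\<in>A. \<Sum>e\<in>E. \<Sum>b\<in>B. f a b c e)"
    by (rule sum.cong[OF refl], rule sum.cong[OF refl], rule sum.swap)
  also have "\<dots> = (\<Sum>c\<in>C. \<Sum>e\<in>E. \<Sum>a\<in>A. \<Sum>b\<in>B. f a b c e)"
    by (rule sum.cong[OF refl], rule sum.swap)
  finally show ?thesis .
qed

text \<open>Overlaying two pairings closes the four indices into loops, two if the pairings agree
  and one if they differ; each loop contributes a factor D.\<close>

lemma card_pairing:
  fixes D :: nat
  defines "D \<equiv> CARD('x::finite)"
  shows "(\<Sum>a\<in>(UNIV :: 'x quad set). of_bool (pairing \<sigma> a) * of_bool (pairing \<rho> a)) =
    (if \<sigma> = \<rho> then of_nat (D * D) else of_nat D :: complex)"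
proof -
  have eq: "(\<Sum>a\<in>(UNIV :: 'x quad set). of_bool (pairing \<sigma> a) * of_bool (pairing \<rho> a)) =
    (of_nat (card {a :: 'x quad. pairing \<sigma> a \<and> pairing \<rho> a}) :: complex)"
    by (simp flip: of_bool_conj)
  have 1: "{a :: 'x quad. pairing True a} = (\<lambda>(x, y). ((x, y), (x, y))) ` UNIV"
    "{a :: 'x quad. pairing False a} = (\<lambda>(x, y). ((x, x), (y, y))) ` UNIV"
    "{a :: 'x quad. pairing True a \<and> pairing False a} = (\<lambda>x. ((x, x), (x, x))) ` UNIV"
    unfolding pairing_def by (auto simp: image_iff)
  have 2: "card (range (\<lambda>(x :: 'x, y :: 'x). ((x, y), (x, y)))) = D * D"
    "card (range (\<lambda>(x :: 'x, y :: 'x). ((x, x), (y, y)))) = D * D"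
    "card (range (\<lambda>x :: 'x. ((x, x), (x, x)))) = D"
    unfolding D_def by (simp_all add: card_image inj_on_def card_cartesian_product flip: UNIV_Times_UNIV)
  show ?thesis
    unfolding eq using 1 2 by (cases \<sigma>; cases \<rho>) (simp_all add: conj_commute)
qed

text \<open>Every bond joins the column spin \<rho> of a site to the row spin \<sigma> of a
  successor, and summing the bond index gives their Gram entry. The column spin then occurs at one
  site only and is summed there. What remains is a model in the row spins, encoded by the set of
  swapped sites.\<close>

lemma tn_net_spin_sum:
  fixes \<kappa> :: "site \<Rightarrow> bool \<Rightarrow> bool \<Rightarrow> complex"
  defines "g \<equiv> \<lambda>\<sigma> \<rho>. if \<sigma> = \<rho> then of_nat (CARD('x) * CARD('x)) else of_nat CARD('x) :: complex"
  shows "tn_net L (\<lambda>v (a :: 'x::finite quad) b c l. \<Sum>\<sigma>\<in>UNIV. \<Sum>\<rho>\<in>UNIV. \<kappa> v \<sigma> \<rho> *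
      (of_bool (pairing \<sigma> a) * of_bool (pairing \<sigma> b)) * (of_bool (pairing \<rho> c) * of_bool (pairing \<rho> l))) =
    (\<Sum>S\<in>Pow (sites L). \<Prod>v\<in>sites L. \<Sum>\<rho>\<in>UNIV. \<kappa> v (v \<in> S) \<rho> * g \<rho> (next_y L v \<in> S) * g \<rho> (next_x L v \<in> S))"
    (is "?lhs = ?rhs")
proof -
  let ?V = "sites L"
  let ?P = "?V \<rightarrow>\<^sub>E (UNIV :: 'x quad set)" and ?B = "?V \<rightarrow>\<^sub>E (UNIV :: bool set)"
  let ?p = "\<lambda>\<sigma> (a :: 'x quad). of_bool (pairing \<sigma> a) :: complex"
  \<comment> \<open>Reindexing along \<open>s\<close> brings together the two factors that meet on
    the same bond variable, so the sum over bond configurations becomes a product.\<close>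
  have gram: "(\<Sum>a\<in>?P. \<Prod>v\<in>?V. ?p (\<sigma> v) (a v) * ?p (\<rho> v) (a (s v))) = (\<Prod>v\<in>?V. g (\<rho> v) (\<sigma> (s v)))"
    if s: "bij_betw s ?V ?V" for \<sigma> \<rho> s
  proof -
    have "(\<Prod>v\<in>?V. ?p (\<sigma> v) (a v) * ?p (\<rho> v) (a (s v))) =
        (\<Prod>v\<in>?V. ?p (\<rho> (inv_into ?V s v)) (a v) * ?p (\<sigma> v) (a v))" for a :: "site \<Rightarrow> 'x quad"
    proof -
      have "(\<Prod>v\<in>?V. ?p (\<rho> v) (a (s v))) = (\<Prod>v\<in>?V. ?p (\<rho> (inv_into ?V s (s v))) (a (s v)))"
        using s by (intro prod.cong) (auto simp: bij_betw_def)
      also have "\<dots> = (\<Prod>v\<in>?V. ?p (\<rho> (inv_into ?V s v)) (a v))"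
        by (rule prod.reindex_bij_betw[OF s])
      finally show ?thesis unfolding prod.distrib by (simp only: mult.commute)
    qed
    then have "(\<Sum>a\<in>?P. \<Prod>v\<in>?V. ?p (\<sigma> v) (a v) * ?p (\<rho> v) (a (s v))) =
        (\<Sum>a\<in>?P. \<Prod>v\<in>?V. (\<lambda>v x. ?p (\<rho> (inv_into ?V s v)) x * ?p (\<sigma> v) x) v (a v))" by simp
    also have "\<dots> = (\<Prod>v\<in>?V. \<Sum>x\<in>UNIV. ?p (\<rho> (inv_into ?V s v)) x * ?p (\<sigma> v) x)"
      by (rule sum_PiE_prod[OF finite_sites, where f = "\<lambda>v x. ?p (\<rho> (inv_into ?V s v)) x * ?p (\<sigma> v) x"])
    also have "\<dots> = (\<Prod>v\<in>?V. g (\<rho> (inv_into ?V s v)) (\<sigma> v))"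
      unfolding g_def card_pairing ..
    also have "\<dots> = (\<Prod>v\<in>?V. g (\<rho> (inv_into ?V s (s v))) (\<sigma> (s v)))"
      by (rule prod.reindex_bij_betw[OF s, symmetric])
    also have "\<dots> = (\<Prod>v\<in>?V. g (\<rho> v) (\<sigma> (s v)))"
      using s by (intro prod.cong) (auto simp: bij_betw_def)
    finally show ?thesis .
  qed
  have "?lhs = (\<Sum>a\<in>?P. \<Sum>b\<in>?P. \<Sum>\<sigma>\<in>?B. \<Sum>\<rho>\<in>?B. \<Prod>v\<in>?V. \<kappa> v (\<sigma> v) (\<rho> v) *
      (?p (\<sigma> v) (a v) * ?p (\<sigma> v) (b v)) * (?p (\<rho> v) (a (next_y L v)) * ?p (\<rho> v) (b (next_x L v))))"
    unfolding tn_net_def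
  proof (rule sum.cong[OF refl], rule sum.cong[OF refl])
    fix a b
    show "(\<Prod>v\<in>?V. \<Sum>\<sigma>\<in>UNIV. \<Sum>\<rho>\<in>UNIV. \<kappa> v \<sigma> \<rho> *
        (?p \<sigma> (a v) * ?p \<sigma> (b v)) * (?p \<rho> (a (next_y L v)) * ?p \<rho> (b (next_x L v)))) =
      (\<Sum>\<sigma>\<in>?B. \<Sum>\<rho>\<in>?B. \<Prod>v\<in>?V. \<kappa> v (\<sigma> v) (\<rho> v) *
        (?p (\<sigma> v) (a v) * ?p (\<sigma> v) (b v)) * (?p (\<rho> v) (a (next_y L v)) * ?p (\<rho> v) (b (next_x L v))))"
      using sum_PiE_prod2[of ?V "\<lambda>v \<sigma> \<rho>. \<kappa> v \<sigma> \<rho> *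
        (?p \<sigma> (a v) * ?p \<sigma> (b v)) * (?p \<rho> (a (next_y L v)) * ?p \<rho> (b (next_x L v)))", symmetric] by simp
  qed
  also have "\<dots> = (\<Sum>\<sigma>\<in>?B. \<Sum>\<rho>\<in>?B. \<Sum>a\<in>?P. \<Sum>b\<in>?P. \<Prod>v\<in>?V. \<kappa> v (\<sigma> v) (\<rho> v) *
      (?p (\<sigma> v) (a v) * ?p (\<sigma> v) (b v)) * (?p (\<rho> v) (a (next_y L v)) * ?p (\<rho> v) (b (next_x L v))))"
    by (rule sum_swap_pairs)
  also have "\<dots> = (\<Sum>\<sigma>\<in>?B. \<Sum>\<rho>\<in>?B. (\<Prod>v\<in>?V. \<kappa> v (\<sigma> v) (\<rho> v)) *
      ((\<Sum>a\<in>?P. \<Prod>v\<in>?V. ?p (\<sigma> v) (a v) * ?p (\<rho> v) (a (next_y L v))) *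
       (\<Sum>b\<in>?P. \<Prod>v\<in>?V. ?p (\<sigma> v) (b v) * ?p (\<rho> v) (b (next_x L v)))))"
    unfolding sum_product unfolding sum_distrib_left prod.distrib by (simp only: mult_ac)
  also have "\<dots> = (\<Sum>\<sigma>\<in>?B. \<Sum>\<rho>\<in>?B. \<Prod>v\<in>?V. (\<lambda>v \<rho>. \<kappa> v (\<sigma> v) \<rho> * g \<rho> (\<sigma> (next_y L v)) * g \<rho> (\<sigma> (next_x L v))) v (\<rho> v))"
    unfolding gram[OF bij_betw_next(1)] gram[OF bij_betw_next(2)] unfolding prod.distrib by (simp only: mult_ac)
  also have "\<dots> = (\<Sum>\<sigma>\<in>?B. \<Prod>v\<in>?V. \<Sum>\<rho>\<in>UNIV. \<kappa> v (\<sigma> v) \<rho> * g \<rho> (\<sigma> (next_y L v)) * g \<rho> (\<sigma> (next_x L v)))"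
  proof (rule sum.cong[OF refl])
    fix \<sigma>
    show "(\<Sum>\<rho>\<in>?B. \<Prod>v\<in>?V. (\<lambda>v \<rho>. \<kappa> v (\<sigma> v) \<rho> * g \<rho> (\<sigma> (next_y L v)) * g \<rho> (\<sigma> (next_x L v))) v (\<rho> v)) =
      (\<Prod>v\<in>?V. \<Sum>\<rho>\<in>UNIV. \<kappa> v (\<sigma> v) \<rho> * g \<rho> (\<sigma> (next_y L v)) * g \<rho> (\<sigma> (next_x L v)))"
      using sum_PiE_prod[of ?V "\<lambda>v \<rho>. \<kappa> v (\<sigma> v) \<rho> * g \<rho> (\<sigma> (next_y L v)) * g \<rho> (\<sigma> (next_x L v))"] by simp
  qed
  also have "\<dots> = ?rhs"
    by (rule sum_PiE_bool) (auto intro!: prod.cong sum.cong)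
  finally show ?thesis .
qed

text \<open>Ket and bra carry separate matrices \<open>U\<close> and \<open>V\<close>, so that the
  product rule can differentiate one of them at a time.\<close>

definition loss_tensor :: "complex^'d \<Rightarrow> complex^'d^'d \<Rightarrow> ('b::finite, 'd::finite) site_matrix \<Rightarrow> ('b, 'd) site_matrix \<Rightarrow>
    'b \<times> 'b \<Rightarrow> 'b \<times> 'b \<Rightarrow> 'b \<times> 'b \<Rightarrow> 'b \<times> 'b \<Rightarrow> complex" where
  "loss_tensor z A U V a b c l = (\<Sum>j\<in>UNIV. \<Sum>q\<in>UNIV. A $ j $ q *
     (site_tensor z U (fst a) (fst b) (fst c) (fst l) q * cnj (site_tensor z V (snd a) (snd b) (snd c) (snd l) j)))"

text \<open>Written as a product over all sites, with the identity away from \<open>w\<close>, the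
  observable lets the sum over physical configurations factorise.\<close>

lemma apply_local_eq_sum:
  fixes A :: "complex^'d::finite^'d"
  assumes w: "w \<in> sites L" and j: "j \<in> sites L \<rightarrow>\<^sub>E UNIV"
  shows "apply_local A w \<Psi> j =
    (\<Sum>j'\<in>sites L \<rightarrow>\<^sub>E UNIV. (\<Prod>v\<in>sites L. (if v = w then A else mat 1) $ j v $ j' v) * \<Psi> j')"
proof -
  let ?I = "(\<lambda>q. j(w := q)) ` UNIV"
  have inj: "inj (\<lambda>q. j(w := q))"
    by (rule injI) (metis fun_upd_same)
  have sub: "?I \<subseteq> sites L \<rightarrow>\<^sub>E UNIV"
    using w j by (auto simp: PiE_iff extensional_def)
  have "(\<Sum>j'\<in>sites L \<rightarrow>\<^sub>E UNIV. (\<Prod>v\<in>sites L. (if v = w then A else mat 1) $ j v $ j' v) * \<Psi> j') =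
      (\<Sum>j'\<in>?I. (\<Prod>v\<in>sites L. (if v = w then A else mat 1) $ j v $ j' v) * \<Psi> j')"
  proof (rule sum.mono_neutral_right[OF _ sub])
    show "\<forall>j'\<in>(sites L \<rightarrow>\<^sub>E UNIV) - ?I. (\<Prod>v\<in>sites L. (if v = w then A else mat 1) $ j v $ j' v) * \<Psi> j' = 0"
    proof
      fix j' assume j': "j' \<in> (sites L \<rightarrow>\<^sub>E UNIV) - ?I"
      then have "j' \<noteq> j(w := j' w)" by blast
      then obtain v where v: "v \<noteq> w" "j' v \<noteq> j v" by (auto simp: fun_eq_iff split: if_splits)
      have "v \<in> sites L"
      proof (rule ccontr)
        assume "v \<notin> sites L"
        then have "j v = undefined" "j' v = undefined" using PiE_arb[OF j] PiE_arb[of j'] j' by blast+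
        then show False using v by simp
      qed
      then have "(\<Prod>v\<in>sites L. (if v = w then A else mat 1) $ j v $ j' v) = 0"
        using v by (intro prod_zero) (auto simp: mat_def intro!: bexI[of _ v])
      then show "(\<Prod>v\<in>sites L. (if v = w then A else mat 1) $ j v $ j' v) * \<Psi> j' = 0" by simp
    qed
  qed (simp add: finite_PiE)
  also have "\<dots> = (\<Sum>q\<in>UNIV. (\<Prod>v\<in>sites L. (if v = w then A else mat 1) $ j v $ (j(w := q)) v) * \<Psi> (j(w := q)))"
    by (simp only: sum.reindex[OF inj] o_def)
  also have "\<dots> = (\<Sum>q\<in>UNIV. A $ j w $ q * \<Psi> (j(w := q)))"
  proof (rule sum.cong[OF refl])
    fix q
    have "(\<Prod>v\<in>sites L. (if v = w then A else mat 1) $ j v $ (j(w := q)) v) = (\<Prod>v\<in>sites L. if v = w then A $ j w $ q else 1)"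
      by (intro prod.cong) (auto simp: mat_def)
    then show "(\<Prod>v\<in>sites L. (if v = w then A else mat 1) $ j v $ (j(w := q)) v) * \<Psi> (j(w := q)) = A $ j w $ q * \<Psi> (j(w := q))"
      using w by simp
  qed
  finally show ?thesis unfolding apply_local_def by simp
qed

lemma tn_state_eq_net: "tn_state L z U j = tn_net L (\<lambda>v a b c l. site_tensor z (U v) a b c l (j v))"
  unfolding tn_state_def tn_net_def ..

lemma state_inner_eq_net:
  assumes w: "w \<in> sites L"
  shows "state_inner L (tn_state L z U) (apply_local A w (tn_state L z U)) =
    tn_net L (\<lambda>v. loss_tensor z (if v = w then A else mat 1) (U v) (U v))"
proof -
  let ?V = "sites L"
  let ?O = "\<lambda>v. if v = w then A else mat 1"
  let ?P = "?V \<rightarrow>\<^sub>E (UNIV :: ('b \<times> 'b) set)" and ?J = "?V \<rightarrow>\<^sub>E (UNIV :: 'a set)"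
  define T where "T v a b c l q j = site_tensor z (U v) (fst a) (fst b) (fst c) (fst l) q *
    cnj (site_tensor z (U v) (snd a) (snd b) (snd c) (snd l) j)" for v and a b c l :: "'b \<times> 'b" and q j
  have "state_inner L (tn_state L z U) (apply_local A w (tn_state L z U)) =
    (\<Sum>j\<in>?J. \<Sum>j'\<in>?J. (\<Prod>v\<in>?V. ?O v $ j v $ j' v) * (tn_state L z U j' * cnj (tn_state L z U j)))"
    unfolding state_inner_def
    by (rule sum.cong[OF refl]) (simp only: apply_local_eq_sum[OF w] sum_distrib_left mult_ac)
  also have "\<dots> = (\<Sum>j\<in>?J. \<Sum>j'\<in>?J. \<Sum>a\<in>?P. \<Sum>b\<in>?P. \<Prod>v\<in>?V. ?O v $ j v $ j' v *
      T v (a v) (b v) (a (next_y L v)) (b (next_x L v)) (j' v) (j v))"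
    unfolding tn_state_eq_net cnj_tn_net tn_net_mult T_def
    unfolding tn_net_def sum_distrib_left prod.distrib ..
  also have "\<dots> = (\<Sum>a\<in>?P. \<Sum>b\<in>?P. \<Sum>j\<in>?J. \<Sum>j'\<in>?J. \<Prod>v\<in>?V. ?O v $ j v $ j' v *
      T v (a v) (b v) (a (next_y L v)) (b (next_x L v)) (j' v) (j v))"
    by (rule sum_swap_pairs)
  also have "\<dots> = (\<Sum>a\<in>?P. \<Sum>b\<in>?P. \<Prod>v\<in>?V. \<Sum>j\<in>UNIV. \<Sum>j'\<in>UNIV. ?O v $ j $ j' *
      T v (a v) (b v) (a (next_y L v)) (b (next_x L v)) j' j)"
  proof (rule sum.cong[OF refl], rule sum.cong[OF refl])
    fix a b
    show "(\<Sum>j\<in>?J. \<Sum>j'\<in>?J. \<Prod>v\<in>?V. ?O v $ j v $ j' v *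
        T v (a v) (b v) (a (next_y L v)) (b (next_x L v)) (j' v) (j v)) =
      (\<Prod>v\<in>?V. \<Sum>j\<in>UNIV. \<Sum>j'\<in>UNIV. ?O v $ j $ j' *
        T v (a v) (b v) (a (next_y L v)) (b (next_x L v)) j' j)"
      using sum_PiE_prod2[of ?V "\<lambda>v j j'. ?O v $ j $ j' *
        T v (a v) (b v) (a (next_y L v)) (b (next_x L v)) j' j"] by simp
  qed
  finally show ?thesis
    unfolding tn_net_def loss_tensor_def T_def .
qed

section \<open>The derivative of the loss\<close>

abbreviation mpow :: "complex^'n^'n \<Rightarrow> nat \<Rightarrow> complex^'n^'n" where
  "mpow G n \<equiv> ((**) G ^^ n) (mat 1)"

lemma mpow_smult: "mpow (map_matrix ((*) x) G) n $ a $ b = x ^ n * mpow G n $ a $ b"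
proof (induction n arbitrary: a b)
  case (Suc n)
  then show ?case
    by (simp add: matrix_matrix_mult_def map_matrix_def sum_distrib_left mult_ac)
qed simp

lemma mpow_commute: "G ** mpow G n = mpow G n ** G"
proof (induction n)
  case (Suc n)
  then show ?case by (simp add: matrix_mul_assoc)
qed simp

lemma matrix_mult_entry: "(A ** B) $ a $ b = (\<Sum>c\<in>UNIV. A $ a $ c * B $ c $ b)"
  unfolding matrix_matrix_mult_def by simp

lemma norm_mpow_le: "norm (mpow G n $ a $ b) \<le> (\<Sum>i\<in>UNIV. \<Sum>j\<in>UNIV. norm (G $ i $ j)) ^ n"
proof (induction n arbitrary: a b)
  case 0
  then show ?case by (simp add: mat_def)
next
  case (Suc n)
  let ?R = "\<Sum>i\<in>UNIV. \<Sum>j\<in>UNIV. norm (G $ i $ j)"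
  have "norm (mpow G (Suc n) $ a $ b) \<le> (\<Sum>c\<in>UNIV. norm (G $ a $ c) * norm (mpow G n $ c $ b))"
    by (simp add: matrix_matrix_mult_def norm_mult[symmetric] norm_sum)
  also have "\<dots> \<le> (\<Sum>c\<in>UNIV. norm (G $ a $ c) * ?R ^ n)"
    by (intro sum_mono mult_left_mono Suc) auto
  also have "\<dots> = (\<Sum>c\<in>UNIV. norm (G $ a $ c)) * ?R ^ n"
    by (rule sum_distrib_right[symmetric])
  also have "\<dots> \<le> ?R * ?R ^ n"
  proof (intro mult_right_mono zero_le_power sum_nonneg)
    show "(\<Sum>c\<in>UNIV. norm (G $ a $ c)) \<le> ?R"
      by (rule member_le_sum) (auto intro!: sum_nonneg)
  qed auto
  finally show ?case by simp
qed

lemma summable_mpow: "summable (\<lambda>n. (mpow G n $ a $ b / fact n) * x ^ n)"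
proof (rule summable_comparison_test'[OF summable_exp])
  fix n
  let ?R = "\<Sum>i\<in>UNIV. \<Sum>j\<in>UNIV. norm (G $ i $ j)"
  have "norm ((mpow G n $ a $ b / fact n) * x ^ n) = norm (mpow G n $ a $ b) * norm x ^ n / fact n"
    by (simp add: norm_mult norm_divide norm_power)
  also have "\<dots> \<le> ?R ^ n * norm x ^ n / fact n"
    by (intro divide_right_mono mult_right_mono norm_mpow_le) auto
  finally show "norm ((mpow G n $ a $ b / fact n) * x ^ n) \<le> inverse (fact n) * (?R * norm x) ^ n"
    by (simp add: power_mult_distrib field_simps)
qed

text \<open>Each entry is a power series in one scalar variable, so that termwise differentiation of
  scalar series applies.\<close>

definition matrix_exp_series :: "complex^'n^'n \<Rightarrow> complex \<Rightarrow> complex^'n^'n" where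
  "matrix_exp_series G x = (\<chi> a b. \<Sum>n. (mpow G n $ a $ b / fact n) * x ^ n)"

lemma matrix_exp_eq_series: "matrix_exp (map_matrix ((*) x) G) = matrix_exp_series G x"
proof -
  have "(\<lambda>n. mpow (map_matrix ((*) x) G) n /\<^sub>R fact n) sums matrix_exp_series G x"
    unfolding sums_def
  proof (intro vec_tendstoI)
    fix a b
    have "(\<lambda>N. \<Sum>n<N. (mpow G n $ a $ b / fact n) * x ^ n) \<longlonglongrightarrow> (\<Sum>n. (mpow G n $ a $ b / fact n) * x ^ n)"
      by (rule summable_LIMSEQ[OF summable_mpow])
    moreover have "(\<Sum>n<N. mpow (map_matrix ((*) x) G) n /\<^sub>R fact n) $ a $ b = (\<Sum>n<N. (mpow G n $ a $ b / fact n) * x ^ n)" for N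
      unfolding sum_component vector_scaleR_component mpow_smult
      by (intro sum.cong) (simp_all add: scaleR_conv_of_real field_simps)
    ultimately show "(\<lambda>N. (\<Sum>n<N. mpow (map_matrix ((*) x) G) n /\<^sub>R fact n) $ a $ b) \<longlonglongrightarrow> matrix_exp_series G x $ a $ b"
      unfolding matrix_exp_series_def by simp
  qed
  then show ?thesis
    unfolding matrix_exp_def by (rule sums_unique[symmetric])
qed

text \<open>Both products are the series with shifted powers, which is also the derivative series.
  This yields the derivative of a gate as well as its commuting with its generator.\<close>

lemma matrix_exp_series_mult:
  "(G ** matrix_exp_series G x) $ a $ b = (\<Sum>n. (mpow G (Suc n) $ a $ b / fact n) * x ^ n)"
  "(matrix_exp_series G x ** G) $ a $ b = (\<Sum>n. (mpow G (Suc n) $ a $ b / fact n) * x ^ n)"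
proof -
  have "(G ** matrix_exp_series G x) $ a $ b = (\<Sum>c\<in>UNIV. \<Sum>n. G $ a $ c * ((mpow G n $ c $ b / fact n) * x ^ n))"
    unfolding matrix_exp_series_def matrix_mult_entry
    by (simp only: vec_lambda_beta suminf_mult[OF summable_mpow])
  also have "\<dots> = (\<Sum>n. \<Sum>c\<in>UNIV. G $ a $ c * ((mpow G n $ c $ b / fact n) * x ^ n))"
    by (intro suminf_sum[symmetric] summable_mult summable_mpow)
  also have "\<dots> = (\<Sum>n. (mpow G (Suc n) $ a $ b / fact n) * x ^ n)"
    by (simp add: matrix_mult_entry sum_distrib_right sum_divide_distrib mult.assoc)
  finally show "(G ** matrix_exp_series G x) $ a $ b = (\<Sum>n. (mpow G (Suc n) $ a $ b / fact n) * x ^ n)" .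
  have "(matrix_exp_series G x ** G) $ a $ b = (\<Sum>c\<in>UNIV. \<Sum>n. ((mpow G n $ a $ c / fact n) * x ^ n) * G $ c $ b)"
    unfolding matrix_exp_series_def matrix_mult_entry
    by (simp only: vec_lambda_beta suminf_mult2[OF summable_mpow])
  also have "\<dots> = (\<Sum>n. \<Sum>c\<in>UNIV. ((mpow G n $ a $ c / fact n) * x ^ n) * G $ c $ b)"
    by (intro suminf_sum[symmetric] summable_mult2 summable_mpow)
  also have "\<dots> = (\<Sum>n. ((mpow G n ** G) $ a $ b / fact n) * x ^ n)"
    by (simp add: matrix_mult_entry sum_distrib_left sum_divide_distrib mult_ac)
  finally show "(matrix_exp_series G x ** G) $ a $ b = (\<Sum>n. (mpow G (Suc n) $ a $ b / fact n) * x ^ n)"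
    by (simp only: mpow_commute[symmetric] funpow.simps o_apply)
qed

lemma matrix_exp_series_deriv:
  "((\<lambda>x. matrix_exp_series G x $ a $ b) has_field_derivative (G ** matrix_exp_series G x) $ a $ b) (at x)"
proof -
  define c where "c n = mpow G n $ a $ b / fact n" for n
  have "((\<lambda>x. \<Sum>n. c n * x ^ n) has_field_derivative (\<Sum>n. diffs c n * x ^ n)) (at x)"
    unfolding c_def by (rule termdiffs_strong_converges_everywhere[OF summable_mpow])
  moreover have "diffs c n = mpow G (Suc n) $ a $ b / fact n" for n
    unfolding diffs_def c_def fact_Suc by (simp del: of_nat_Suc funpow.simps)
  ultimately show ?thesis
    unfolding matrix_exp_series_mult unfolding matrix_exp_series_def c_def by simp
qed

lemma gate_commute: "G ** gate G t = gate G t ** G"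
  unfolding gate_def matrix_exp_eq_series vec_eq_iff matrix_exp_series_mult by simp

lemma gate_deriv:
  "((\<lambda>t. gate G t $ a $ b) has_vector_derivative (map_matrix ((*) \<i>) G ** gate G t) $ a $ b) (at t)"
proof -
  have "((\<lambda>t. \<i> * complex_of_real t) has_vector_derivative \<i> * of_real 1) (at t)"
    by (intro has_vector_derivative_mult_right has_vector_derivative_of_real) (rule DERIV_ident)
  then have "((\<lambda>x. matrix_exp_series G x $ a $ b) \<circ> (\<lambda>t. \<i> * of_real t) has_vector_derivative
      (\<i> * of_real 1) * (G ** matrix_exp_series G (\<i> * of_real t)) $ a $ b) (at t)"
    by (rule field_vector_diff_chain_at) (rule matrix_exp_series_deriv)
  moreover have "(map_matrix ((*) \<i>) G ** M) $ a $ b = \<i> * (G ** M) $ a $ b" for M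
    by (simp add: matrix_matrix_mult_def map_matrix_def sum_distrib_left mult_ac)
  ultimately show ?thesis
    unfolding gate_def matrix_exp_eq_series by (simp add: o_def)
qed

section \<open>Derivatives of a site unitary and of the whole network\<close>

lemma foldr_matrix_mult:
  "foldr (\<lambda>\<xi> U. g \<xi> ** U) xs (M :: complex^'n^'n) = foldr (\<lambda>\<xi> U. g \<xi> ** U) xs (mat 1) ** M"
  by (induction xs) (simp_all add: matrix_mul_assoc)

lemma partial_unitary_split:
  assumes "m \<le> s" "s \<le> n"
  shows "partial_unitary Gs m n v \<theta> = partial_unitary Gs m s v \<theta> ** partial_unitary Gs s n v \<theta>"
proof -
  have "[m..<n] = [m..<s] @ [s..<n]"
    using assms upt_add_eq_append[of m s "n - s"] by simp
  then show ?thesis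
    unfolding partial_unitary_def by (simp add: foldr_matrix_mult[symmetric])
qed

lemma partial_unitary_Suc: "partial_unitary Gs k (Suc k) v \<theta> = gate (Gs k) (\<theta> (v, k))"
  unfolding partial_unitary_def by simp

lemma partial_unitary_upd:
  "v \<noteq> i \<or> k < m \<or> n \<le> k \<Longrightarrow> partial_unitary Gs m n v (\<theta>((i, k) := t)) = partial_unitary Gs m n v \<theta>"
  unfolding partial_unitary_def by (rule foldr_cong) auto

lemma matrix_mult_deriv:
  fixes F :: "real \<Rightarrow> complex^'n^'n"
  assumes "\<And>a b. ((\<lambda>t. F t $ a $ b) has_vector_derivative F' $ a $ b) (at t)"
  shows "((\<lambda>t. (A ** F t ** B) $ a $ b) has_vector_derivative (A ** F' ** B) $ a $ b) (at t)"
  unfolding matrix_matrix_mult_def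
  by (auto intro!: has_vector_derivative_sum has_vector_derivative_mult_left has_vector_derivative_mult_right assms)

lemma site_unitary_deriv:
  assumes k: "k < p" and s: "s \<in> {k, Suc k}"
  shows "((\<lambda>t. site_unitary Gs p i (\<theta>((i, k) := t)) $ a $ b) has_vector_derivative
    (partial_unitary Gs 0 s i \<theta> ** map_matrix ((*) \<i>) (Gs k) ** partial_unitary Gs s p i \<theta>) $ a $ b) (at (\<theta> (i, k)))"
proof -
  let ?P = "partial_unitary Gs 0 k i \<theta>" and ?Q = "partial_unitary Gs (Suc k) p i \<theta>"
  let ?g = "gate (Gs k) (\<theta> (i, k))" and ?H = "map_matrix ((*) \<i>) (Gs k)"
  have split: "site_unitary Gs p i \<theta>' = partial_unitary Gs 0 k i \<theta>' ** gate (Gs k) (\<theta>' (i, k)) ** partial_unitary Gs (Suc k) p i \<theta>'" for \<theta>'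
    using k by (simp add: partial_unitary_split[of 0 k p] partial_unitary_split[of k "Suc k" p] partial_unitary_Suc matrix_mul_assoc)
  have comm: "?H ** ?g = ?g ** ?H"
  proof -
    have "?H ** M = map_matrix ((*) \<i>) (Gs k ** M)" "M ** ?H = map_matrix ((*) \<i>) (M ** Gs k)" for M
      by (simp_all add: vec_eq_iff matrix_matrix_mult_def map_matrix_def sum_distrib_left mult_ac)
    then show ?thesis by (simp only: gate_commute)
  qed
  have "?P ** (?H ** ?g) ** ?Q = partial_unitary Gs 0 s i \<theta> ** ?H ** partial_unitary Gs s p i \<theta>"
  proof (cases "s = k")
    case True
    then show ?thesis
      using k by (simp add: partial_unitary_split[of k "Suc k" p] partial_unitary_Suc matrix_mul_assoc)
  next
    case False
    then have "s = Suc k" using s by auto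
    then show ?thesis
      unfolding comm using k by (simp add: partial_unitary_split[of 0 k "Suc k"] partial_unitary_Suc matrix_mul_assoc)
  qed
  moreover have "((\<lambda>t. (?P ** gate (Gs k) t ** ?Q) $ a $ b) has_vector_derivative (?P ** (?H ** ?g) ** ?Q) $ a $ b) (at (\<theta> (i, k)))"
    by (rule matrix_mult_deriv) (rule gate_deriv)
  ultimately show ?thesis
    unfolding split by (simp add: partial_unitary_upd)
qed

lemma tn_net_deriv:
  assumes i: "i \<in> sites L"
    and Y: "\<And>a b c l. ((\<lambda>t. Y t a b c l) has_vector_derivative Y' a b c l) (at t)"
  shows "((\<lambda>t. tn_net L (X(i := Y t))) has_vector_derivative tn_net L (X(i := Y'))) (at t)"
proof -
  have eq: "tn_net L (X(i := Z)) = (\<Sum>a\<in>sites L \<rightarrow>\<^sub>E UNIV. \<Sum>b\<in>sites L \<rightarrow>\<^sub>E UNIV.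
      Z (a i) (b i) (a (next_y L i)) (b (next_x L i)) *
      (\<Prod>v\<in>sites L - {i}. X v (a v) (b v) (a (next_y L v)) (b (next_x L v))))" for Z
    unfolding tn_net_def by (intro sum.cong refl) (subst prod.remove[OF finite_sites i], simp)
  show ?thesis
    unfolding eq by (auto intro!: has_vector_derivative_sum has_vector_derivative_mult_left Y)
qed

lemma site_tensor_deriv:
  assumes "\<And>r c. ((\<lambda>t. F t $ r $ c) has_vector_derivative F' $ r $ c) (at t)"
  shows "((\<lambda>t. site_tensor z (F t) a b c l j) has_vector_derivative site_tensor z F' a b c l j) (at t)"
  unfolding site_tensor_def by (intro has_vector_derivative_sum has_vector_derivative_mult_right assms)

lemma loss_tensor_deriv:
  fixes F :: "real \<Rightarrow> ('b::finite, 'd::finite) site_matrix"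
  assumes F: "\<And>r c. ((\<lambda>t. F t $ r $ c) has_vector_derivative F' $ r $ c) (at t)"
  shows "((\<lambda>t. loss_tensor z A (F t) (F t) a b c l) has_vector_derivative
    loss_tensor z A F' (F t) a b c l + loss_tensor z A (F t) F' a b c l) (at t)"
proof -
  note d = site_tensor_deriv[OF F]
  have "((\<lambda>t. loss_tensor z A (F t) (F t) a b c l) has_vector_derivative
    (\<Sum>j\<in>UNIV. \<Sum>q\<in>UNIV. A $ j $ q *
     (site_tensor z (F t) (fst a) (fst b) (fst c) (fst l) q * cnj (site_tensor z F' (snd a) (snd b) (snd c) (snd l) j) +
      site_tensor z F' (fst a) (fst b) (fst c) (fst l) q * cnj (site_tensor z (F t) (snd a) (snd b) (snd c) (snd l) j)))) (at t)"
    unfolding loss_tensor_def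
    by (intro has_vector_derivative_sum has_vector_derivative_mult_right has_vector_derivative_mult d has_vector_derivative_cnj)
  then show ?thesis
    unfolding loss_tensor_def by (simp add: sum.distrib[symmetric] algebra_simps)
qed

text \<open>Only the tensor at \<open>i\<close> depends on the parameter, and its ket and bra
  factors contribute one term each. Because \<open>i \<noteq> w\<close>, the observable at that site
  is the identity.\<close>

lemma param_deriv_local_loss:
  fixes Gs :: "nat \<Rightarrow> ('b::finite, 'd::finite) site_matrix"
  assumes iw: "i \<in> sites L" "w \<in> sites L" "i \<noteq> w" and k: "k < p" and s: "s \<in> {k, Suc k}"
  defines "U \<equiv> \<lambda>\<theta> v. site_unitary Gs p v \<theta>"
    and "U' \<equiv> \<lambda>\<theta>. partial_unitary Gs 0 s i \<theta> ** map_matrix ((*) \<i>) (Gs k) ** partial_unitary Gs s p i \<theta>"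
  shows "param_deriv (local_loss L p Gs z A w) (i, k) \<theta> =
    tn_net L (\<lambda>v a b c l. if v = i then loss_tensor z (mat 1) (U' \<theta>) (U \<theta> i) a b c l + loss_tensor z (mat 1) (U \<theta> i) (U' \<theta>) a b c l
      else loss_tensor z (if v = w then A else mat 1) (U \<theta> v) (U \<theta> v) a b c l)"
proof -
  let ?X = "\<lambda>v. loss_tensor z (if v = w then A else mat 1) (U \<theta> v) (U \<theta> v)"
  let ?F = "\<lambda>t. U (\<theta>((i, k) := t)) i"
  let ?Y = "\<lambda>t. loss_tensor z (mat 1) (?F t) (?F t)"
  let ?Y' = "\<lambda>a b c l. loss_tensor z (mat 1) (U' \<theta>) (U \<theta> i) a b c l + loss_tensor z (mat 1) (U \<theta> i) (U' \<theta>) a b c l"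
  have "local_loss L p Gs z A w (\<theta>((i, k) := t)) = tn_net L (?X(i := ?Y t))" for t
    unfolding local_loss_def Let_def state_inner_eq_net[OF iw(2)]
    by (rule tn_net_cong) (use iw(3) in \<open>auto simp: U_def partial_unitary_upd\<close>)
  moreover have "((\<lambda>t. tn_net L (?X(i := ?Y t))) has_vector_derivative tn_net L (?X(i := ?Y'))) (at (\<theta> (i, k)))"
  proof (rule tn_net_deriv[OF iw(1)])
    fix a b c l
    show "((\<lambda>t. ?Y t a b c l) has_vector_derivative ?Y' a b c l) (at (\<theta> (i, k)))"
      using loss_tensor_deriv[of ?F "U' \<theta>" "\<theta> (i, k)" z "mat 1" a b c l] site_unitary_deriv[OF k s, of Gs i \<theta>]
      unfolding U_def U'_def by (simp add: fun_upd_triv)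
  qed
  ultimately have "param_deriv (local_loss L p Gs z A w) (i, k) \<theta> = tn_net L (?X(i := ?Y'))"
    unfolding param_deriv_def by (simp add: vector_derivative_at)
  also have "\<dots> = tn_net L (\<lambda>v a b c l. if v = i then ?Y' a b c l else ?X v a b c l)"
    by (rule tn_net_cong) auto
  finally show ?thesis .
qed

section \<open>Two copies of the network and their average\<close>

lemma sum_UNIV_pair: "(\<Sum>x\<in>(UNIV :: ('x::finite \<times> 'y::finite) set). f x) = (\<Sum>a\<in>UNIV. \<Sum>b\<in>UNIV. f (a, b))"
  by (simp add: sum.cartesian_product flip: UNIV_Times_UNIV)

lemma sum_mult_sum_pair:
  fixes f :: "'x::finite \<Rightarrow> complex" and g :: "'y::finite \<Rightarrow> complex"
  shows "(\<Sum>x\<in>UNIV. f x) * (\<Sum>y\<in>UNIV. g y) = (\<Sum>z\<in>UNIV. f (fst z) * g (snd z))"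
  by (simp add: sum_UNIV_pair sum_product)

definition join_quad :: "'a quad \<Rightarrow> 'b quad \<Rightarrow> 'c quad \<Rightarrow> ('a \<times> 'b \<times> 'c) quad" where
  "join_quad a b c =
     (((fst (fst a), fst (fst b), fst (fst c)), (snd (fst a), snd (fst b), snd (fst c))),
      ((fst (snd a), fst (snd b), fst (snd c)), (snd (snd a), snd (snd b), snd (snd c))))"

lemma pairing_join_quad: "pairing \<sigma> (join_quad a b c) \<longleftrightarrow> pairing \<sigma> a \<and> pairing \<sigma> b \<and> pairing \<sigma> c"
  unfolding pairing_def join_quad_def by auto

text \<open>Entries of the projector |0><0| on the row physical leg, in both copies.\<close>

definition state_weight :: "complex^'d \<Rightarrow> 'd quad \<Rightarrow> complex" where
  "state_weight z r = cnj (z $ fst (fst r)) * z $ snd (fst r) * cnj (cnj (z $ fst (snd r)) * z $ snd (snd r))"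

definition obs_weight :: "complex^'d^'d \<Rightarrow> 'd quad \<Rightarrow> complex" where
  "obs_weight A p = A $ snd (fst p) $ fst (fst p) * cnj (A $ snd (snd p) $ fst (snd p))"

lemma sum_pairing:
  "(\<Sum>x\<in>(UNIV :: 'x::finite quad set). f x * of_bool (pairing True x)) = (\<Sum>a\<in>UNIV. \<Sum>b\<in>UNIV. f ((a, b), (a, b)) :: complex)"
  "(\<Sum>x\<in>(UNIV :: 'x::finite quad set). f x * of_bool (pairing False x)) = (\<Sum>a\<in>UNIV. \<Sum>b\<in>UNIV. f ((a, a), (b, b)) :: complex)"
proof -
  have "(\<Sum>x\<in>(UNIV :: 'x::finite quad set). f x * of_bool (pairing True x)) = (\<Sum>x\<in>range (\<lambda>(a, b). ((a, b), (a, b))). f x)"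
    by (rule sum.mono_neutral_cong_right) (auto simp: pairing_def image_iff)
  also have "\<dots> = (\<Sum>x\<in>UNIV. f ((\<lambda>(a, b). ((a, b), (a, b))) x))"
    by (intro sum.reindex[unfolded o_def]) (auto simp: inj_on_def)
  finally show "(\<Sum>x\<in>(UNIV :: 'x::finite quad set). f x * of_bool (pairing True x)) = (\<Sum>a\<in>UNIV. \<Sum>b\<in>UNIV. f ((a, b), (a, b)))"
    unfolding sum_UNIV_pair by simp
  have "(\<Sum>x\<in>(UNIV :: 'x::finite quad set). f x * of_bool (pairing False x)) = (\<Sum>x\<in>range (\<lambda>(a, b). ((a, a), (b, b))). f x)"
    by (rule sum.mono_neutral_cong_right) (auto simp: pairing_def image_iff)
  also have "\<dots> = (\<Sum>x\<in>UNIV. f ((\<lambda>(a, b). ((a, a), (b, b))) x))"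
    by (intro sum.reindex[unfolded o_def]) (auto simp: inj_on_def)
  finally show "(\<Sum>x\<in>(UNIV :: 'x::finite quad set). f x * of_bool (pairing False x)) = (\<Sum>a\<in>UNIV. \<Sum>b\<in>UNIV. f ((a, a), (b, b)))"
    unfolding sum_UNIV_pair by simp
qed

text \<open>With P the rank-one projector onto \<open>z\<close>, the two pairings give (tr P)^2 and
  tr (P^2), both equal to 1. The row physical leg therefore leaves no trace in the spin
  model.\<close>

lemma state_weight_pairing:
  assumes "norm z = 1"
  shows "(\<Sum>r\<in>UNIV. state_weight z r * of_bool (pairing \<sigma> r)) = 1"
proof -
  have "(\<Sum>q\<in>UNIV. cnj (z $ q) * z $ q) = of_real (\<Sum>q\<in>UNIV. (norm (z $ q))\<^sup>2)"
    by (simp only: of_real_sum complex_norm_square mult.commute)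
  also have "(\<Sum>q\<in>UNIV. (norm (z $ q))\<^sup>2) = (norm z)\<^sup>2"
    unfolding norm_vec_def L2_set_def by (simp add: sum_nonneg)
  finally have 1: "(\<Sum>q\<in>UNIV. cnj (z $ q) * z $ q) = 1" using assms by simp
  have "(\<Sum>r\<in>UNIV. state_weight z r * of_bool (pairing \<sigma> r)) =
      (\<Sum>q\<in>UNIV. cnj (z $ q) * z $ q) * (\<Sum>q\<in>UNIV. cnj (z $ q) * z $ q)"
    unfolding sum_product
    by (rule bool.exhaust[of \<sigma>]; simp only: sum_pairing;
      simp only: state_weight_def fst_conv snd_conv complex_cnj_mult complex_cnj_cnj mult_ac)
  then show ?thesis by (simp add: 1)
qed

definition site_quad :: "complex^'d \<Rightarrow> complex^'d^'d \<Rightarrow> ('b::finite, 'd::finite) site_matrix \<Rightarrow>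
    'b quad \<Rightarrow> 'b quad \<Rightarrow> 'b quad \<Rightarrow> 'b quad \<Rightarrow> complex" where
  "site_quad z A U a b c l = (\<Sum>r\<in>UNIV. \<Sum>p\<in>UNIV. state_weight z r * obs_weight A p *
     quad_entry U (join_quad a b r) (join_quad c l p))"

lemma loss_tensor_alt:
  "loss_tensor z A U V a b c l = (\<Sum>r\<in>UNIV. \<Sum>p\<in>UNIV. (cnj (z $ fst r) * z $ snd r) * A $ snd p $ fst p *
     (U $ (fst a, fst b, fst r) $ (fst c, fst l, fst p) * cnj (V $ (snd a, snd b, snd r) $ (snd c, snd l, snd p))))"
proof -
  have "loss_tensor z A U V a b c l = (\<Sum>j\<in>UNIV. \<Sum>q\<in>UNIV. \<Sum>r\<in>UNIV. (cnj (z $ fst r) * z $ snd r) * A $ j $ q *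
     (U $ (fst a, fst b, fst r) $ (fst c, fst l, q) * cnj (V $ (snd a, snd b, snd r) $ (snd c, snd l, j))))"
    unfolding loss_tensor_def site_tensor_def cnj_sum sum_mult_sum_pair unfolding sum_distrib_left
    by (intro sum.cong refl) (simp add: mult_ac)
  also have "\<dots> = (\<Sum>q\<in>UNIV. \<Sum>j\<in>UNIV. \<Sum>r\<in>UNIV. (cnj (z $ fst r) * z $ snd r) * A $ j $ q *
     (U $ (fst a, fst b, fst r) $ (fst c, fst l, q) * cnj (V $ (snd a, snd b, snd r) $ (snd c, snd l, j))))"
    by (rule sum.swap)
  also have "\<dots> = (\<Sum>p\<in>UNIV. \<Sum>r\<in>UNIV. (cnj (z $ fst r) * z $ snd r) * A $ snd p $ fst p *
     (U $ (fst a, fst b, fst r) $ (fst c, fst l, fst p) * cnj (V $ (snd a, snd b, snd r) $ (snd c, snd l, snd p))))"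
    unfolding sum_UNIV_pair[where f = "\<lambda>p. \<Sum>r\<in>UNIV. (cnj (z $ fst r) * z $ snd r) * A $ snd p $ fst p *
     (U $ (fst a, fst b, fst r) $ (fst c, fst l, fst p) * cnj (V $ (snd a, snd b, snd r) $ (snd c, snd l, snd p)))"] by simp
  also have "\<dots> = (\<Sum>r\<in>UNIV. \<Sum>p\<in>UNIV. (cnj (z $ fst r) * z $ snd r) * A $ snd p $ fst p *
     (U $ (fst a, fst b, fst r) $ (fst c, fst l, fst p) * cnj (V $ (snd a, snd b, snd r) $ (snd c, snd l, snd p))))"
    by (rule sum.swap)
  finally show ?thesis .
qed

lemma loss_tensor_quad:
  "loss_tensor z A U U (fst a) (fst b) (fst c) (fst l) * cnj (loss_tensor z A U U (snd a) (snd b) (snd c) (snd l)) =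
    site_quad z A U a b c l"
  unfolding loss_tensor_alt site_quad_def cnj_sum sum_mult_sum_pair
  by (intro sum.cong refl) (simp add: state_weight_def obs_weight_def quad_entry_def join_quad_def mult_ac)

text \<open>Kernel of the map taking X to H X + X H^dagger; for H = \<i> G with G hermitian this is
  \<i> [G, X].\<close>

definition deriv_weight1 :: "complex^'n^'n \<Rightarrow> 'n \<times> 'n \<Rightarrow> 'n \<times> 'n \<Rightarrow> complex" where
  "deriv_weight1 H m n = H $ fst m $ fst n * cnj (mat 1 $ snd m $ snd n) + mat 1 $ fst m $ fst n * cnj (H $ snd m $ snd n)"

definition deriv_weight :: "complex^'n^'n \<Rightarrow> 'n quad \<Rightarrow> 'n quad \<Rightarrow> complex" where
  "deriv_weight H m n = deriv_weight1 H (fst m) (fst n) * cnj (deriv_weight1 H (snd m) (snd n))"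

text \<open>All scalar weights are grouped with \<open>Um\<close>, so that each summand is a
  function of \<open>Um\<close> times a function of \<open>Up\<close>, the form in which
  independence applies.\<close>

definition deriv_quad :: "complex^'d \<Rightarrow> ('b::finite, 'd::finite) site_matrix \<Rightarrow> ('b, 'd) site_matrix \<Rightarrow> ('b, 'd) site_matrix \<Rightarrow>
    'b quad \<Rightarrow> 'b quad \<Rightarrow> 'b quad \<Rightarrow> 'b quad \<Rightarrow> complex" where
  "deriv_quad z H Um Up a b c l = (\<Sum>r\<in>UNIV. \<Sum>p\<in>UNIV. \<Sum>m\<in>UNIV. \<Sum>n\<in>UNIV.
     (state_weight z r * obs_weight (mat 1) p * deriv_weight H m n * quad_entry Um (join_quad a b r) m) *
     quad_entry Up n (join_quad c l p))"

lemma matrix_triple_entry: "(A ** H ** B) $ x $ y = (\<Sum>m\<in>UNIV. \<Sum>n\<in>UNIV. A $ x $ m * H $ m $ n * B $ n $ y)"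
  unfolding matrix_mult_entry sum_distrib_right by (rule sum.swap)

lemma deriv_tensor_alt:
  fixes Um Up H :: "('b::finite, 'd::finite) site_matrix"
  shows "loss_tensor z (mat 1) (Um ** H ** Up) (Um ** Up) a b c l + loss_tensor z (mat 1) (Um ** Up) (Um ** H ** Up) a b c l =
    (\<Sum>r\<in>UNIV. \<Sum>p\<in>UNIV. \<Sum>m\<in>UNIV. \<Sum>n\<in>UNIV. (cnj (z $ fst r) * z $ snd r) * mat 1 $ snd p $ fst p * deriv_weight1 H m n *
     (Um $ (fst a, fst b, fst r) $ fst m * cnj (Um $ (snd a, snd b, snd r) $ snd m)) *
     (Up $ fst n $ (fst c, fst l, fst p) * cnj (Up $ snd n $ (snd c, snd l, snd p))))"
proof -
  \<comment> \<open>The undifferentiated product becomes a triple product as well, so that ket and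
    bra have the same kind of inner indices m and n.\<close>
  have one: "Um ** Up = Um ** mat 1 ** Up" by simp
  show ?thesis
    unfolding one loss_tensor_alt matrix_triple_entry cnj_sum sum_mult_sum_pair
    unfolding sum_distrib_left sum.distrib[symmetric]
    by (intro sum.cong refl) (simp add: deriv_weight1_def algebra_simps)
qed

lemma deriv_tensor_quad:
  fixes Um Up H :: "('b::finite, 'd::finite) site_matrix" and z
  defines "Y \<equiv> \<lambda>a b c l. loss_tensor z (mat 1) (Um ** H ** Up) (Um ** Up) a b c l + loss_tensor z (mat 1) (Um ** Up) (Um ** H ** Up) a b c l"
  shows "Y (fst a) (fst b) (fst c) (fst l) * cnj (Y (snd a) (snd b) (snd c) (snd l)) = deriv_quad z H Um Up a b c l"
  unfolding Y_def deriv_tensor_alt deriv_quad_def cnj_sum sum_mult_sum_pair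
  by (intro sum.cong refl)
    (simp add: state_weight_def obs_weight_def deriv_weight_def quad_entry_def join_quad_def mult_ac)

text \<open>The identity pairing contracts \<open>deriv_weight1\<close> to a trace of a commutator or to a commutator with
  the identity.\<close>

lemma deriv_weight_pairing_False:
  assumes G: "hermitian_matrix G"
  shows "(\<Sum>m\<in>UNIV. deriv_weight (map_matrix ((*) \<i>) G) m n * of_bool (pairing False m)) = 0"
    and "(\<Sum>n\<in>UNIV. deriv_weight (map_matrix ((*) \<i>) G) m n * of_bool (pairing False n)) = 0"
proof -
  let ?k = "deriv_weight1 (map_matrix ((*) \<i>) G)"
  have herm: "cnj (G $ a $ b) = G $ b $ a" for a b
    using G unfolding hermitian_matrix_def adjoint_matrix_def vec_eq_iff by simp
  have mat: "mat 1 $ a $ b = (of_bool (a = b) :: complex)" "cnj (of_bool P) = of_bool P" for a b :: 'a and P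
    by (simp_all add: mat_def)
  have 1: "(\<Sum>a\<in>UNIV. ?k (a, a) n) = 0" for n
    unfolding deriv_weight1_def by (simp add: sum.distrib sum_subtractf mat map_matrix_def herm)
  have 2: "(\<Sum>a\<in>UNIV. ?k m (a, a)) = 0" for m
    unfolding deriv_weight1_def by (simp add: sum.distrib sum_subtractf mat map_matrix_def herm)
  show "(\<Sum>m\<in>UNIV. deriv_weight (map_matrix ((*) \<i>) G) m n * of_bool (pairing False m)) = 0"
    unfolding sum_pairing deriv_weight_def by (simp add: sum_distrib_right[symmetric] sum_distrib_left[symmetric] 1)
  show "(\<Sum>n\<in>UNIV. deriv_weight (map_matrix ((*) \<i>) G) m n * of_bool (pairing False n)) = 0"
    unfolding sum_pairing deriv_weight_def by (simp add: sum_distrib_right[symmetric] sum_distrib_left[symmetric] 2)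
qed

text \<open>The swap pairing turns the summands into squared moduli of \<open>deriv_weight1\<close>:
  for hermitian \<open>G\<close> this is the squared Hilbert-Schmidt norm of the map taking X to
  \<i> [G, X].\<close>

definition commutator_weight :: "complex^'n^'n \<Rightarrow> complex" where
  "commutator_weight G = (\<Sum>m\<in>UNIV. \<Sum>n\<in>UNIV. deriv_weight (map_matrix ((*) \<i>) G) m n *
     of_bool (pairing True m) * of_bool (pairing True n))"

lemma deriv_weight_contract:
  assumes G: "hermitian_matrix G"
  shows "(\<Sum>m\<in>UNIV. \<Sum>n\<in>UNIV. deriv_weight (map_matrix ((*) \<i>) G) m n * of_bool (pairing \<rho> m) * of_bool (pairing \<sigma> n)) =
    of_bool (\<rho> \<and> \<sigma>) * commutator_weight G"
proof (cases "\<rho> \<and> \<sigma>")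
  case True
  then show ?thesis unfolding commutator_weight_def by simp
next
  case False
  then consider "\<sigma> = False" | "\<rho> = False" by auto
  then show ?thesis
  proof cases
    case 1
    have "(\<Sum>n\<in>UNIV. deriv_weight (map_matrix ((*) \<i>) G) m n * of_bool (pairing \<rho> m) * of_bool (pairing \<sigma> n)) =
      of_bool (pairing \<rho> m) * (\<Sum>n\<in>UNIV. deriv_weight (map_matrix ((*) \<i>) G) m n * of_bool (pairing False n))" for m
      unfolding 1 sum_distrib_left by (simp only: mult_ac)
    then show ?thesis unfolding deriv_weight_pairing_False[OF G] using 1 by simp
  next
    case 2
    have "(\<Sum>m\<in>UNIV. \<Sum>n\<in>UNIV. deriv_weight (map_matrix ((*) \<i>) G) m n * of_bool (pairing \<rho> m) * of_bool (pairing \<sigma> n)) =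
      (\<Sum>n\<in>UNIV. of_bool (pairing \<sigma> n) * (\<Sum>m\<in>UNIV. deriv_weight (map_matrix ((*) \<i>) G) m n * of_bool (pairing False m)))"
      unfolding 2 sum_distrib_left by (subst sum.swap) (simp only: mult_ac)
    then show ?thesis unfolding deriv_weight_pairing_False[OF G] using 2 by simp
  qed
qed

section \<open>Integrability, and expectations of networks by independence\<close>

lemma quad_entry_integrable:
  fixes X :: "'a \<Rightarrow> complex^'n^'n"
  assumes M: "prob_space M" and X: "unitary_two_design M X"
  shows "integrable M (\<lambda>\<omega>. quad_entry (X \<omega>) r c)"
proof -
  interpret prob_space M by (rule M)
  have [measurable]: "X \<in> borel_measurable M" using X unfolding unitary_two_design_def by blast
  show ?thesis
  proof (rule integrable_const_bound)
    show "(\<lambda>\<omega>. quad_entry (X \<omega>) r c) \<in> borel_measurable M"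
      unfolding quad_entry_def by measurable
    show "AE \<omega> in M. norm (quad_entry (X \<omega>) r c) \<le> 1"
    proof (rule AE_I2)
      fix \<omega> assume "\<omega> \<in> space M"
      then have U: "unitary_matrix (X \<omega>)" using X unfolding unitary_two_design_def by blast
      show "norm (quad_entry (X \<omega>) r c) \<le> 1"
        unfolding quad_entry_def norm_mult complex_mod_cnj
        by (intro mult_le_one norm_unitary_entry_le_1[OF U] mult_nonneg_nonneg norm_ge_zero)
    qed
  qed
qed

lemma measurable_quad_entry [measurable]:
  "(\<lambda>U :: complex^'n^'m. quad_entry U r c) \<in> borel_measurable borel"
  unfolding quad_entry_def by measurable

text \<open>Site \<open>i\<close> holds two independent matrices, \<open>Inr True\<close> for U_-
  and \<open>Inr False\<close> for U_+, coupled by a finite index. Expanding the sum over that index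
  first turns every summand into a product over the independent family, whose expectation
  factorises.\<close>

lemma (in prob_space) tn_net_expectation:
  fixes N :: "site + bool \<Rightarrow> 'a \<Rightarrow> 'm::topological_space" and f g :: "'k::finite \<Rightarrow> 'x::finite \<Rightarrow> 'x \<Rightarrow> 'x \<Rightarrow> 'x \<Rightarrow> 'm \<Rightarrow> complex"
  assumes ind: "indep_vars (\<lambda>_. borel) N ((sites L - {i}) <+> UNIV)" and i: "i \<in> sites L"
    and h: "\<And>v a b c l. v \<in> sites L - {i} \<Longrightarrow> h v a b c l \<in> borel_measurable borel"
      "\<And>v a b c l. v \<in> sites L - {i} \<Longrightarrow> integrable M (\<lambda>\<omega>. h v a b c l (N (Inl v) \<omega>))"
    and f: "\<And>k a b c l. f k a b c l \<in> borel_measurable borel"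
      "\<And>k a b c l. integrable M (\<lambda>\<omega>. f k a b c l (N (Inr True) \<omega>))"
    and g: "\<And>k a b c l. g k a b c l \<in> borel_measurable borel"
      "\<And>k a b c l. integrable M (\<lambda>\<omega>. g k a b c l (N (Inr False) \<omega>))"
  shows "has_bochner_integral M
    (\<lambda>\<omega>. tn_net L (\<lambda>v a b c l. if v = i then \<Sum>k\<in>UNIV. f k a b c l (N (Inr True) \<omega>) * g k a b c l (N (Inr False) \<omega>)
       else h v a b c l (N (Inl v) \<omega>)))
    (tn_net L (\<lambda>v a b c l. if v = i then \<Sum>k\<in>UNIV. (\<integral>\<omega>. f k a b c l (N (Inr True) \<omega>) \<partial>M) * (\<integral>\<omega>. g k a b c l (N (Inr False) \<omega>) \<partial>M)
       else (\<integral>\<omega>. h v a b c l (N (Inl v) \<omega>) \<partial>M)))"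
  unfolding tn_net_def
proof (intro has_bochner_integral_sum)
  fix a b :: "site \<Rightarrow> 'x"
  let ?V = "sites L" and ?I = "(sites L - {i}) <+> (UNIV :: bool set)"
  let ?a = "\<lambda>F v. F (a v) (b v) (a (next_y L v)) (b (next_x L v))"
  define \<Phi> where "\<Phi> k = case_sum (\<lambda>v. ?a (h v) v) (\<lambda>left. if left then ?a (f k) i else ?a (g k) i)" for k
  have split: "(\<Prod>v\<in>?V. ?a (\<lambda>a b c l. if v = i then \<Sum>k\<in>UNIV. F k a b c l * G k a b c l else H v a b c l) v) =
      (\<Sum>k\<in>UNIV. \<Prod>\<iota>\<in>?I. case_sum (\<lambda>v. ?a (H v) v) (\<lambda>left. if left then ?a (F k) i else ?a (G k) i) \<iota>)"
    for F G :: "'k \<Rightarrow> 'x \<Rightarrow> 'x \<Rightarrow> 'x \<Rightarrow> 'x \<Rightarrow> complex" and H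
  proof -
    have "(\<Prod>v\<in>?V. ?a (\<lambda>a b c l. if v = i then \<Sum>k\<in>UNIV. F k a b c l * G k a b c l else H v a b c l) v) =
        (\<Sum>k\<in>UNIV. ?a (F k) i * ?a (G k) i) * (\<Prod>v\<in>?V - {i}. ?a (H v) v)"
      by (subst prod.remove[OF finite_sites i]) (auto intro!: arg_cong2[where f = "(*)"] prod.cong)
    then show ?thesis
      by (simp add: prod.Plus UNIV_bool sum_distrib_right sum_distrib_left mult_ac)
  qed
  have int: "has_bochner_integral M (\<lambda>\<omega>. \<Prod>\<iota>\<in>?I. \<Phi> k \<iota> (N \<iota> \<omega>)) (\<Prod>\<iota>\<in>?I. \<integral>\<omega>. \<Phi> k \<iota> (N \<iota> \<omega>) \<partial>M)" for k
  proof -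
    have m: "\<Phi> k \<iota> \<in> borel_measurable borel" if "\<iota> \<in> ?I" for \<iota>
      using that h(1) f(1) g(1) unfolding \<Phi>_def by (cases \<iota>) (simp_all add: Plus_def image_iff)
    have it: "integrable M (\<lambda>\<omega>. \<Phi> k \<iota> (N \<iota> \<omega>))" if "\<iota> \<in> ?I" for \<iota>
      using that h(2) f(2) g(2) unfolding \<Phi>_def by (cases \<iota>) (simp_all add: Plus_def image_iff)
    have "indep_vars (\<lambda>_. borel) (\<lambda>\<iota> \<omega>. \<Phi> k \<iota> (N \<iota> \<omega>)) ?I"
      by (rule indep_vars_compose2[OF ind]) (use m in auto)
    then show ?thesis
      unfolding has_bochner_integral_iff using it
      by (auto intro!: indep_vars_integrable indep_vars_lebesgue_integral)
  qed
  have "has_bochner_integral M (\<lambda>\<omega>. \<Sum>k\<in>UNIV. \<Prod>\<iota>\<in>?I. \<Phi> k \<iota> (N \<iota> \<omega>)) (\<Sum>k\<in>UNIV. \<Prod>\<iota>\<in>?I. \<integral>\<omega>. \<Phi> k \<iota> (N \<iota> \<omega>) \<partial>M)"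
    by (intro has_bochner_integral_sum int)
  moreover have "(\<Sum>k\<in>UNIV. \<Prod>\<iota>\<in>?I. \<Phi> k \<iota> (N \<iota> \<omega>)) =
      (\<Prod>v\<in>?V. ?a (\<lambda>a b c l. if v = i then \<Sum>k\<in>UNIV. f k a b c l (N (Inr True) \<omega>) * g k a b c l (N (Inr False) \<omega>)
       else h v a b c l (N (Inl v) \<omega>)) v)" for \<omega>
    unfolding \<Phi>_def
    by (rule trans[OF _ split[of "\<lambda>k a b c l. f k a b c l (N (Inr True) \<omega>)" "\<lambda>k a b c l. g k a b c l (N (Inr False) \<omega>)"
          "\<lambda>v a b c l. h v a b c l (N (Inl v) \<omega>)", symmetric]])
      (intro sum.cong prod.cong refl, auto split: sum.split)
  moreover have "(\<Sum>k\<in>UNIV. \<Prod>\<iota>\<in>?I. \<integral>\<omega>. \<Phi> k \<iota> (N \<iota> \<omega>) \<partial>M) =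
      (\<Prod>v\<in>?V. ?a (\<lambda>a b c l. if v = i then \<Sum>k\<in>UNIV. (\<integral>\<omega>. f k a b c l (N (Inr True) \<omega>) \<partial>M) * (\<integral>\<omega>. g k a b c l (N (Inr False) \<omega>) \<partial>M)
       else (\<integral>\<omega>. h v a b c l (N (Inl v) \<omega>) \<partial>M)) v)"
    unfolding \<Phi>_def
    by (rule trans[OF _ split[of "\<lambda>k a b c l. \<integral>\<omega>. f k a b c l (N (Inr True) \<omega>) \<partial>M" "\<lambda>k a b c l. \<integral>\<omega>. g k a b c l (N (Inr False) \<omega>) \<partial>M"
          "\<lambda>v a b c l. \<integral>\<omega>. h v a b c l (N (Inl v) \<omega>) \<partial>M", symmetric]])
      (intro sum.cong prod.cong refl, auto split: sum.split)
  ultimately show "has_bochner_integral M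
    (\<lambda>\<omega>. \<Prod>v\<in>?V. if v = i then \<Sum>k\<in>UNIV. ?a (f k) v (N (Inr True) \<omega>) * ?a (g k) v (N (Inr False) \<omega>)
       else ?a (h v) v (N (Inl v) \<omega>))
    (\<Prod>v\<in>?V. if v = i then \<Sum>k\<in>UNIV. (\<integral>\<omega>. ?a (f k) v (N (Inr True) \<omega>) \<partial>M) * (\<integral>\<omega>. ?a (g k) v (N (Inr False) \<omega>) \<partial>M)
       else (\<integral>\<omega>. ?a (h v) v (N (Inl v) \<omega>) \<partial>M))"
    by simp
qed

section \<open>Spin sums on the torus\<close>

text \<open>A site of largest rank is nobody's successor, itself included. Its two spin values are
  added up first, at a cost of at most 1, and induction removes the others. \<open>B\<close> is
  meant for the swapped sites outside \<open>U\<close>, whose spins are fixed.\<close>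

lemma acyclic_sum_le_1:
  fixes P :: "'a \<Rightarrow> bool \<Rightarrow> bool \<Rightarrow> bool \<Rightarrow> real" and r :: "'a \<Rightarrow> nat"
  assumes "finite U"
    and nonneg: "\<And>v s t u. v \<in> U \<Longrightarrow> P v s t u \<ge> 0"
    and sub: "\<And>v t u. v \<in> U \<Longrightarrow> P v True t u + P v False t u \<le> 1"
    and rank: "\<And>v. v \<in> U \<Longrightarrow> f v \<in> U \<Longrightarrow> r (f v) < r v" "\<And>v. v \<in> U \<Longrightarrow> g v \<in> U \<Longrightarrow> r (g v) < r v"
  shows "(\<Sum>S\<in>Pow U. \<Prod>v\<in>U. P v (v \<in> S) (f v \<in> S \<union> B) (g v \<in> S \<union> B)) \<le> 1"
  using assms
proof (induction U rule: finite_ranking_induct[where f = r])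
  case empty
  then show ?case by simp
next
  case (insert x U)
  show ?case
  proof (cases "x \<in> U")
    case True
    then show ?thesis using insert by (simp add: insert_absorb)
  next
    case False
    let ?T = "\<lambda>V S. \<Prod>v\<in>V. P v (v \<in> S) (f v \<in> S \<union> B) (g v \<in> S \<union> B)"
    have IH: "(\<Sum>S\<in>Pow U. ?T U S) \<le> 1"
      using insert.prems by (intro insert.IH) auto
    have ne: "f v \<noteq> x \<and> g v \<noteq> x" if "v \<in> insert x U" for v
    proof -
      have "r v \<le> r x" using that insert.hyps(2) by blast
      then show ?thesis using insert.prems(3,4)[OF that] by auto
    qed
    have eq: "?T U (insert x S) = ?T U S" if "S \<subseteq> U" for S
    proof (rule prod.cong[OF refl])
      fix v assume "v \<in> U"
      then have "v \<noteq> x" "f v \<noteq> x" "g v \<noteq> x" using ne[of v] False by auto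
      then show "P v (v \<in> insert x S) (f v \<in> insert x S \<union> B) (g v \<in> insert x S \<union> B) =
          P v (v \<in> S) (f v \<in> S \<union> B) (g v \<in> S \<union> B)"
        by simp
    qed
    have pos: "?T U S \<ge> 0" for S
      using insert.prems(1) by (intro prod_nonneg) auto
    have "(\<Sum>S\<in>Pow (insert x U). ?T (insert x U) S) =
        (\<Sum>S\<in>Pow U. ?T (insert x U) S) + (\<Sum>S\<in>insert x ` Pow U. ?T (insert x U) S)"
      unfolding Pow_insert using insert.hyps(1) False by (intro sum.union_disjoint) auto
    also have "(\<Sum>S\<in>insert x ` Pow U. ?T (insert x U) S) = (\<Sum>S\<in>Pow U. ?T (insert x U) (insert x S))"
      using False by (intro sum.reindex[unfolded o_def]) (auto simp: inj_on_def)
    also have "(\<Sum>S\<in>Pow U. ?T (insert x U) S) + \<dots> =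
        (\<Sum>S\<in>Pow U. (P x False (f x \<in> S \<union> B) (g x \<in> S \<union> B) + P x True (f x \<in> S \<union> B) (g x \<in> S \<union> B)) * ?T U S)"
      unfolding sum.distrib[symmetric]
    proof (rule sum.cong[OF refl])
      fix S assume "S \<in> Pow U"
      then have S: "S \<subseteq> U" "x \<notin> S" using False by auto
      have "?T (insert x U) S = P x False (f x \<in> S \<union> B) (g x \<in> S \<union> B) * ?T U S"
        using insert.hyps(1) False S(2) by simp
      moreover have "?T (insert x U) (insert x S) = P x True (f x \<in> S \<union> B) (g x \<in> S \<union> B) * ?T U (insert x S)"
        using insert.hyps(1) False ne[of x] by simp
      ultimately show "?T (insert x U) S + ?T (insert x U) (insert x S) =
          (P x False (f x \<in> S \<union> B) (g x \<in> S \<union> B) + P x True (f x \<in> S \<union> B) (g x \<in> S \<union> B)) * ?T U S"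
        unfolding eq[OF S(1)] by (simp only: distrib_right)
    qed
    also have "\<dots> \<le> (\<Sum>S\<in>Pow U. 1 * ?T U S)"
      using insert.prems(2)[of x] by (intro sum_mono mult_right_mono pos) (simp add: add.commute)
    finally show ?thesis using IH by simp
  qed
qed

text \<open>Number of forward steps from \<open>v\<close> to the diagonal x + y = c modulo L. A step
  to either successor lowers it by one, wrapping from 0 to L - 1.\<close>

definition layer_rank :: "nat \<Rightarrow> int \<Rightarrow> site \<Rightarrow> nat" where
  "layer_rank L c v = nat ((c - int (fst v) - int (snd v)) mod int L)"

lemma layer_rank_less: "L > 0 \<Longrightarrow> layer_rank L c v < L"
  unfolding layer_rank_def by (simp add: nat_less_iff)

lemma layer_rank_next:
  assumes "L > 0"
  shows "layer_rank L c (next_x L v) = (if layer_rank L c v = 0 then L - 1 else layer_rank L c v - 1)"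
    and "layer_rank L c (next_y L v) = (if layer_rank L c v = 0 then L - 1 else layer_rank L c v - 1)"
proof -
  define k where "k = (c - int (fst v) - int (snd v)) mod int L"
  have k: "0 \<le> k" "k < int L" unfolding k_def using assms by simp_all
  have km: "(k - 1) mod int L = (if k = 0 then int L - 1 else k - 1)"
  proof (cases "k = 0")
    case True
    have "(- 1) mod int L = (int L - 1) mod int L"
      using mod_add_self2[of "- 1" "int L"] by (simp only: uminus_add_conv_diff)
    also have "\<dots> = int L - 1" using assms by (intro mod_pos_pos_trivial) auto
    finally show ?thesis using True by simp
  next
    case False
    then show ?thesis using k by (simp add: mod_pos_pos_trivial)
  qed
  have k1: "(k - 1) mod int L = (c - int (fst v) - int (snd v) - 1) mod int L"
    unfolding k_def by (rule mod_diff_left_eq)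
  have "(c - int ((fst v + 1) mod L) - int (snd v)) mod int L = ((c - int (snd v)) - (int (fst v) + 1) mod int L) mod int L"
    by (simp add: zmod_int algebra_simps)
  also have "\<dots> = ((c - int (snd v)) - (int (fst v) + 1)) mod int L"
    by (rule mod_diff_right_eq)
  also have "\<dots> = (k - 1) mod int L"
    unfolding k1 by (simp add: algebra_simps)
  finally have 1: "(c - int ((fst v + 1) mod L) - int (snd v)) mod int L = (k - 1) mod int L" .
  have "(c - int (fst v) - int ((snd v + 1) mod L)) mod int L = ((c - int (fst v)) - (int (snd v) + 1) mod int L) mod int L"
    by (simp add: zmod_int algebra_simps)
  also have "\<dots> = ((c - int (fst v)) - (int (snd v) + 1)) mod int L"
    by (rule mod_diff_right_eq)
  also have "\<dots> = (k - 1) mod int L"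
    unfolding k1 by (simp add: algebra_simps)
  finally have "(c - int (fst v) - int ((snd v + 1) mod L)) mod int L = (k - 1) mod int L" .
  note 1 this
  then show "layer_rank L c (next_x L v) = (if layer_rank L c v = 0 then L - 1 else layer_rank L c v - 1)"
    "layer_rank L c (next_y L v) = (if layer_rank L c v = 0 then L - 1 else layer_rank L c v - 1)"
    unfolding layer_rank_def next_x_def next_y_def k_def[symmetric] fst_conv snd_conv km using k by auto
qed

text \<open>The sites of rank \<open>r\<close> for the offset \<open>c\<close> form the base layer
  of the offset \<open>c - r\<close>, so shifting the offset reaches all L diagonals.\<close>

lemma layer_rank_shift:
  assumes "L > 0" "r < L"
  shows "layer_rank L (c - int r) v = 0 \<longleftrightarrow> layer_rank L c v = r"
proof -
  define k where "k = c - int (fst v) - int (snd v)"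
  have "layer_rank L (c - int r) v = 0 \<longleftrightarrow> (k - int r) mod int L = 0"
    unfolding layer_rank_def k_def using assms by (simp add: algebra_simps order_antisym_conv)
  also have "\<dots> \<longleftrightarrow> k mod int L = int r"
    using assms by (simp add: mod_eq_0_iff_dvd flip: mod_eq_dvd_iff)
  also have "\<dots> \<longleftrightarrow> layer_rank L c v = r"
    unfolding layer_rank_def k_def using assms by auto
  finally show ?thesis .
qed

definition base_layer :: "nat \<Rightarrow> int \<Rightarrow> site set" where
  "base_layer L c = {v \<in> sites L. layer_rank L c v = 0}"

lemma card_base_layer: "card (base_layer L c) \<le> L"
proof -
  have "inj_on fst (base_layer L c)"
  proof (rule inj_onI)
    fix u v assume uv: "u \<in> base_layer L c" "v \<in> base_layer L c" "fst u = fst v"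
    then have s: "snd u < L" "snd v < L" and L: "L > 0" by (auto simp: base_layer_def sites_def)
    from uv L have "(c - int (fst u) - int (snd u)) mod int L = 0" "(c - int (fst u) - int (snd v)) mod int L = 0"
      by (auto simp: base_layer_def layer_rank_def order_antisym_conv)
    then have "(int (snd v) - int (snd u)) mod int L = 0"
      by (metis (no_types, opaque_lifting) diff_diff_eq2 diff_zero mod_0 mod_diff_eq add.commute add_diff_cancel_left' diff_add_cancel)
    then have "int (snd v) mod int L = int (snd u) mod int L"
      by (simp add: mod_eq_0_iff_dvd mod_eq_dvd_iff)
    then have "snd u = snd v" using s by simp
    with uv show "u = v" by (simp add: prod_eq_iff)
  qed
  then have "card (base_layer L c) = card (fst ` base_layer L c)" by (simp add: card_image)
  also have "\<dots> \<le> card {..<L}"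
    by (intro card_mono) (auto simp: base_layer_def sites_def)
  finally show ?thesis by simp
qed

text \<open>Once the spins on one diagonal layer are fixed, the remaining dependencies are acyclic.\<close>

lemma torus_slice_sum_le:
  fixes P :: "site \<Rightarrow> bool \<Rightarrow> bool \<Rightarrow> bool \<Rightarrow> real"
  assumes L: "L > 0"
    and nonneg: "\<And>v s t u. v \<in> sites L \<Longrightarrow> P v s t u \<ge> 0"
    and sub: "\<And>v t u. v \<in> sites L \<Longrightarrow> P v True t u + P v False t u \<le> 1"
    and h: "\<And>B. h B \<ge> 0"
  shows "(\<Sum>S\<in>Pow (sites L). h (S \<inter> base_layer L c) * (\<Prod>v\<in>sites L. P v (v \<in> S) (next_y L v \<in> S) (next_x L v \<in> S)))
    \<le> (\<Sum>B\<in>Pow (base_layer L c). h B)"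
proof -
  let ?K = "base_layer L c" and ?V = "sites L"
  let ?U = "?V - ?K"
  let ?T = "\<lambda>V S. \<Prod>v\<in>V. P v (v \<in> S) (next_y L v \<in> S) (next_x L v \<in> S)"
  have K: "?K \<subseteq> ?V" "finite ?K" unfolding base_layer_def by auto
  have le1: "P v s t u \<le> 1" if "v \<in> ?V" for v s t u
    using sub[OF that, of t u] nonneg[OF that, of True t u] nonneg[OF that, of False t u] by (cases s) auto
  have slice: "(\<Sum>S\<in>{S \<in> Pow ?V. S \<inter> ?K = B}. ?T ?V S) \<le> 1" if B: "B \<subseteq> ?K" for B
  proof -
    have "(\<Sum>S\<in>{S \<in> Pow ?V. S \<inter> ?K = B}. ?T ?V S) \<le> (\<Sum>S\<in>{S \<in> Pow ?V. S \<inter> ?K = B}. ?T ?U S)"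
    proof (rule sum_mono)
      fix S
      have "?T ?V S = ?T ?U S * ?T ?K S"
        by (rule prod.subset_diff[OF K(1)]) simp
      also have "\<dots> \<le> ?T ?U S * 1"
        using K(1) nonneg le1 by (intro mult_left_mono prod_le_1 prod_nonneg) auto
      finally show "?T ?V S \<le> ?T ?U S" by simp
    qed
    also have "\<dots> = (\<Sum>S\<in>Pow ?U. \<Prod>v\<in>?U. P v (v \<in> S) (next_y L v \<in> S \<union> B) (next_x L v \<in> S \<union> B))"
      by (rule sum.reindex_bij_witness[where i = "\<lambda>S. S \<union> B" and j = "\<lambda>S. S - ?K"])
        (use B K in \<open>auto intro!: prod.cong arg_cong2[where f = "P _ _"] arg_cong3[where f = "P _"]\<close>)
    also have "\<dots> \<le> 1"
    proof (rule acyclic_sum_le_1[where r = "layer_rank L c"])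
      fix v assume v: "v \<in> ?U"
      then have "layer_rank L c v \<noteq> 0" by (auto simp: base_layer_def)
      then show "layer_rank L c (next_y L v) < layer_rank L c v" "layer_rank L c (next_x L v) < layer_rank L c v"
        unfolding layer_rank_next[OF L] by auto
    qed (use nonneg sub in auto)
    finally show ?thesis .
  qed
  have "(\<Sum>S\<in>Pow ?V. h (S \<inter> ?K) * ?T ?V S) = (\<Sum>B\<in>Pow ?K. \<Sum>S\<in>{S \<in> Pow ?V. S \<inter> ?K = B}. h (S \<inter> ?K) * ?T ?V S)"
    by (rule sum.group[symmetric]) (use K in auto)
  also have "\<dots> = (\<Sum>B\<in>Pow ?K. h B * (\<Sum>S\<in>{S \<in> Pow ?V. S \<inter> ?K = B}. ?T ?V S))"
    by (intro sum.cong refl) (simp add: sum_distrib_left)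
  also have "\<dots> \<le> (\<Sum>B\<in>Pow ?K. h B * 1)"
    using slice h by (intro sum_mono mult_left_mono) auto
  finally show ?thesis by simp
qed

section \<open>Distances on the torus and the numerical bound for winding configurations\<close>

lemma next_edge:
  assumes "v \<in> sites L"
  shows "(next_x L v, v) \<in> torus_edges L" "(next_y L v, v) \<in> torus_edges L"
    "(v, next_x L v) \<in> torus_edges L" "(v, next_y L v) \<in> torus_edges L"
  using assms unfolding torus_edges_def by auto

lemma torus_dist_le: "(u, v) \<in> torus_edges L ^^ n \<Longrightarrow> torus_dist L u v \<le> n"
  unfolding torus_dist_def by (rule Least_le)

text \<open>A forward walk with fewer than L steps in each direction. The crude factor 2 is
  affordable because 0.93^2 exceeds 2/3.\<close>

lemma torus_dist_le_2L:
  assumes "u \<in> sites L" "v \<in> sites L"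
  shows "torus_dist L u v \<le> 2 * L"
proof -
  have x: "(a, (next_x L ^^ n) a) \<in> torus_edges L ^^ n \<and> (next_x L ^^ n) a = ((fst a + n) mod L, snd a)"
    and y: "(a, (next_y L ^^ n) a) \<in> torus_edges L ^^ n \<and> (next_y L ^^ n) a = (fst a, (snd a + n) mod L)"
    if a: "a \<in> sites L" for a n
  proof (induction n)
    case 0
    { case 1 show ?case using a by (auto simp: sites_def) }
    { case 2 show ?case using a by (auto simp: sites_def) }
  next
    case (Suc n)
    { case 1
      let ?b = "(next_x L ^^ n) a"
      have "?b \<in> sites L" using Suc(1) a by (auto simp: sites_def)
      then have "(a, next_x L ?b) \<in> torus_edges L ^^ Suc n"
        using Suc(1) next_edge(3)[of ?b L] by (blast intro: relpow_Suc_I)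
      moreover have "next_x L ?b = ((fst a + Suc n) mod L, snd a)"
      proof -
        have b: "?b = ((fst a + n) mod L, snd a)" using Suc(1) by blast
        show ?thesis unfolding b next_x_def by (simp add: mod_Suc_eq)
      qed
      ultimately show ?case by simp }
    { case 2
      let ?b = "(next_y L ^^ n) a"
      have "?b \<in> sites L" using Suc(2) a by (auto simp: sites_def)
      then have "(a, next_y L ?b) \<in> torus_edges L ^^ Suc n"
        using Suc(2) next_edge(4)[of ?b L] by (blast intro: relpow_Suc_I)
      moreover have "next_y L ?b = (fst a, (snd a + Suc n) mod L)"
      proof -
        have b: "?b = (fst a, (snd a + n) mod L)" using Suc(2) by blast
        show ?thesis unfolding b next_y_def by (simp add: mod_Suc_eq)
      qed
      ultimately show ?case by simp }
  qed
  define m where "m = (fst v + (L - fst u)) mod L"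
  define n where "n = (snd v + (L - snd u)) mod L"
  have L: "L > 0" "fst u < L" "snd u < L" "fst v < L" "snd v < L" using assms by (auto simp: sites_def)
  have "(fst u + m) mod L = fst v" "(snd u + n) mod L = snd v"
    unfolding m_def n_def mod_simps using L by simp_all
  then have "(next_x L ^^ m) u = (fst v, snd u)" "(next_y L ^^ n) (fst v, snd u) = v"
    using x[OF assms(1), of m] y[of "(fst v, snd u)" n] L by (auto simp: sites_def)
  then have "(u, v) \<in> torus_edges L ^^ (m + n)"
    unfolding relpow_add using x[OF assms(1), of m] y[of "(fst v, snd u)" n] L by (auto simp: sites_def)
  then have "torus_dist L u v \<le> m + n" by (rule torus_dist_le)
  moreover have "m < L" "n < L" using L unfolding m_def n_def by simp_all
  ultimately show ?thesis by linarith
qed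

lemma sum_Pow_power_card:
  fixes x :: real
  assumes "finite K"
  shows "(\<Sum>B\<in>Pow K. x ^ card B) = (1 + x) ^ card K"
  using assms
proof (induction K)
  case (insert a K)
  have "(\<Sum>B\<in>Pow (insert a K). x ^ card B) = (\<Sum>B\<in>Pow K. x ^ card B) + (\<Sum>B\<in>insert a ` Pow K. x ^ card B)"
    unfolding Pow_insert using insert.hyps by (intro sum.union_disjoint) auto
  also have "(\<Sum>B\<in>insert a ` Pow K. x ^ card B) = (\<Sum>B\<in>Pow K. x ^ card (insert a B))"
    using insert.hyps by (intro sum.reindex[unfolded o_def]) (auto simp: inj_on_def)
  also have "\<dots> = (\<Sum>B\<in>Pow K. x * x ^ card B)"
    using insert.hyps by (intro sum.cong refl) (auto simp: card_insert_if finite_subset)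
  finally show ?case using insert by (simp add: sum_distrib_left[symmetric] algebra_simps)
qed simp

text \<open>L diagonals times the weight of all nonempty configurations on one of them, each swapped
  site there counting (2/3)^L; this behaves like L^2 (2/3)^L. The exponent \<open>2 * L\<close>
  matches the bound on the distance.\<close>

lemma nonempty_slices_le:
  "real L * ((1 + (2/3) ^ L) ^ L - 1) \<le> 200 * 0.93 ^ (2 * L)"
proof -
  \<comment> \<open>\<open>y\<close> is the exponent produced by 1 + x \<le> exp x, and
    \<open>exp_bound\<close> asks for y \<le> 1. Its maximum is 8/9, at L = 2 and L = 3.\<close>
  define y where "y = real L * (2/3) ^ L"
  have "y \<le> 1"
    unfolding y_def
  proof (induction L)
    case (Suc n)
    show ?case
    proof (cases "n \<ge> 2")
      case True
      then have "real (Suc n) * (2/3) \<le> real n" by simp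
      then have "real (Suc n) * (2/3) * (2/3) ^ n \<le> real n * (2/3) ^ n" by (intro mult_right_mono) auto
      also have "\<dots> \<le> 1" by (rule Suc)
      finally show ?thesis by (simp only: power_Suc mult.assoc)
    next
      case False
      then have "n = 0 \<or> n = 1" by auto
      then show ?thesis by (auto simp: power2_eq_square)
    qed
  qed simp
  have y0: "y \<ge> 0" unfolding y_def by simp
  have "(1 + (2/3 :: real) ^ L) ^ L \<le> exp ((2/3) ^ L) ^ L"
    by (intro power_mono) (simp_all add: exp_ge_add_one_self)
  also have "\<dots> = exp y" unfolding y_def by (simp add: exp_of_nat_mult)
  also have "exp y \<le> 1 + y + y\<^sup>2" using y0 \<open>y \<le> 1\<close> by (rule exp_bound)
  also have "\<dots> \<le> 1 + 2 * y" using y0 \<open>y \<le> 1\<close> by (simp add: power2_eq_square mult_left_le)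
  finally have 1: "(1 + (2/3 :: real) ^ L) ^ L - 1 \<le> 2 * y" by simp
  \<comment> \<open>The rate 1.1 absorbs the factor L^2: 1.1^2 * 2/3 is about 0.807, still below
    0.93^2 = 0.8649.\<close>
  have "1 + real L * 0.1 \<le> (1 + 0.1 :: real) ^ L"
    by (rule Bernoulli_inequality) simp
  then have L: "real L \<le> 10 * 1.1 ^ L" by simp
  have "real L * ((1 + (2/3) ^ L) ^ L - 1) \<le> real L * (2 * y)"
    by (rule mult_left_mono[OF 1]) simp
  also have "\<dots> = 2 * (real L * real L) * (2/3) ^ L" unfolding y_def by simp
  also have "\<dots> \<le> 2 * ((10 * 1.1 ^ L) * (10 * 1.1 ^ L)) * (2/3) ^ L"
    by (intro mult_right_mono mult_left_mono mult_mono L) auto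
  also have "\<dots> = 200 * (1.1 * 1.1 * (2/3)) ^ L"
    unfolding power_mult_distrib by simp
  also have "\<dots> \<le> 200 * (0.93\<^sup>2) ^ L"
    by (intro mult_left_mono power_mono) (simp_all add: power2_eq_square)
  finally show ?thesis by (simp add: power_mult)
qed


text \<open>The sites \<open>i\<close> and \<open>w\<close> enter through the crude bound
  \<open>K\<close>. The constant is 1809 = 9 * (1 + 200): the factor 9 from these two sites, 1 from
  directed paths, 200 from winding configurations.\<close>

lemma torus_spin_sum_le:
  fixes W :: "site \<Rightarrow> bool \<Rightarrow> bool \<Rightarrow> bool \<Rightarrow> real"
  assumes iw: "i \<in> sites L" "w \<in> sites L" "i \<noteq> w"
    and nonneg: "\<And>v s t u. v \<in> sites L \<Longrightarrow> W v s t u \<ge> 0"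
    and bulk: "\<And>v. v \<in> sites L \<Longrightarrow> v \<noteq> i \<Longrightarrow> v \<noteq> w \<Longrightarrow> W v True False False = 0"
      "\<And>v. v \<in> sites L \<Longrightarrow> v \<noteq> i \<Longrightarrow> v \<noteq> w \<Longrightarrow> W v False False False \<le> 1"
      "\<And>v t u. v \<in> sites L \<Longrightarrow> v \<noteq> i \<Longrightarrow> v \<noteq> w \<Longrightarrow> t \<or> u \<Longrightarrow> W v True t u + W v False t u \<le> 2 / 3"
    and i0: "\<And>s. W i s False False = 0"
    and K: "K \<ge> 1" "\<And>v s t u. v \<in> {i, w} \<Longrightarrow> W v s t u \<le> K"
  shows "(\<Sum>S\<in>Pow (sites L). \<Prod>v\<in>sites L. W v (v \<in> S) (next_y L v \<in> S) (next_x L v \<in> S))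
    \<le> 1809 * K\<^sup>2 * 0.93 ^ torus_dist L w i"
proof -
  let ?V = "sites L"
  let ?T = "\<lambda>W S. \<Prod>v\<in>?V. W v (v \<in> S) (next_y L v \<in> S) (next_x L v \<in> S)"
  \<comment> \<open>At \<open>i\<close> and \<open>w\<close> the two spin values sum to at most 2 K
    = 3 K * (2/3). With 3 K as normalisation they obey the same bound as the bulk, so in
    \<open>P\<close> the two values always sum to at most 1, and the extracted factors 2/3 supply
    the decay.\<close>
  define cf where "cf v = (if v = i \<or> v = w then 3 * K else 1)" for v
  define P where "P v s t u = W v s t u / (cf v * (2/3) ^ of_bool (t \<or> u))" for v s t u
  have L2: "L \<ge> 2"
  proof (rule ccontr)
    assume "\<not> L \<ge> 2"
    then have "L = 0 \<or> L = 1" by auto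
    with iw show False by (auto simp: sites_def)
  qed
  then have L: "L > 0" by simp
  have cf: "cf v > 0" for v unfolding cf_def using K(1) by auto
  have P0: "P v s t u \<ge> 0" if "v \<in> ?V" for v s t u
    unfolding P_def using nonneg[OF that] cf[of v] by (simp add: less_imp_le)
  have P1: "P v True t u + P v False t u \<le> 1" if v: "v \<in> ?V" for v t u
  proof -
    have "W v True t u + W v False t u \<le> cf v * (2/3) ^ of_bool (t \<or> u)"
    proof (cases "v = i \<or> v = w")
      case True
      then have "W v True t u + W v False t u \<le> K + K"
        using K(2) by (intro add_mono) auto
      also have "\<dots> \<le> cf v * (2/3) ^ of_bool (t \<or> u)"
        unfolding cf_def using True K(1) by auto
      finally show ?thesis .
    next
      case False
      then show ?thesis
        unfolding cf_def using bulk[OF v] by (cases t; cases u) auto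
    qed
    then show ?thesis
      unfolding P_def add_divide_distrib[symmetric] using cf[of v] by (simp add: pos_divide_le_eq)
  qed
  have T0: "?T P S \<ge> 0" for S by (intro prod_nonneg P0) auto
  have cfprod: "(\<Prod>v\<in>?V. cf v) = 9 * K\<^sup>2"
  proof -
    have "(\<Prod>v\<in>?V. cf v) = (\<Prod>v\<in>{i, w}. 3 * K)"
      unfolding cf_def using iw by (intro prod.mono_neutral_cong_right) auto
    then show ?thesis using iw(3) by (simp add: power2_eq_square)
  qed
  have WT: "?T W S \<le> 9 * K\<^sup>2 * (2/3) ^ card S * ?T P S" if S: "S \<subseteq> ?V" for S
  proof -
    have "?T W S = (\<Prod>v\<in>?V. cf v * (2/3) ^ of_bool (next_y L v \<in> S \<or> next_x L v \<in> S) *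
        P v (v \<in> S) (next_y L v \<in> S) (next_x L v \<in> S))"
      unfolding P_def using cf by (intro prod.cong refl) (simp add: less_imp_neq[symmetric])
    also have "\<dots> = 9 * K\<^sup>2 * (2/3) ^ (\<Sum>v\<in>?V. of_bool (next_y L v \<in> S \<or> next_x L v \<in> S)) * ?T P S"
      unfolding prod.distrib cfprod power_sum ..
    also have "\<dots> \<le> 9 * K\<^sup>2 * (2/3) ^ card S * ?T P S"
    proof (intro mult_right_mono mult_left_mono power_decreasing T0)
      \<comment> \<open>The factors 2/3 sit at predecessors of swapped sites. Since
        \<open>next_y\<close> permutes the sites, distinct swapped sites have distinct predecessors,
        which gives at least \<open>card S\<close> factors.\<close>
      have "card S = (\<Sum>v\<in>?V. of_bool (v \<in> S))"
        using S by (simp add: sum.If_cases of_bool_def Int_absorb1)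
      also have "\<dots> = (\<Sum>v\<in>?V. of_bool (next_y L v \<in> S))"
        by (rule sum.reindex_bij_betw[OF bij_betw_next(2), symmetric])
      also have "\<dots> \<le> (\<Sum>v\<in>?V. of_bool (next_y L v \<in> S \<or> next_x L v \<in> S))"
        by (intro sum_mono) auto
      finally show "card S \<le> (\<Sum>v\<in>?V. of_bool (next_y L v \<in> S \<or> next_x L v \<in> S))" .
    qed auto
    finally show ?thesis .
  qed
  \<comment> \<open>\<open>base_layer L c\<close> consists of the possible successors of sites on the diagonal of \<open>w\<close>.\<close>
  define c where "c = int (fst w) + int (snd w) + 1"
  let ?r = "layer_rank L c"
  \<comment> \<open>Rank 1 rather than 0: a chain of swaps may end at \<open>w\<close>, just before
    it would enter the base layer. Here \<open>L2\<close> gives 1 mod L = 1.\<close>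
  have rw: "?r w = 1"
    unfolding layer_rank_def c_def using L2 by simp
  have succ: "?r (next_x L v) = ?r v - 1" "?r (next_y L v) = ?r v - 1" if "?r v \<noteq> 0" for v
    using layer_rank_next[OF L, of c v] that by simp_all
  have succ0: "?r (next_x L v) = L - 1" "?r (next_y L v) = L - 1" if "?r v = 0" for v
    using layer_rank_next[OF L, of c v] that by simp_all
  \<comment> \<open>In a nonvanishing term every swapped site other than \<open>w\<close>, and also
    \<open>i\<close> whatever its own spin, has a swapped successor.\<close>
  have support: "(\<forall>v\<in>insert i (S - {w}). next_y L v \<in> S \<or> next_x L v \<in> S)" if "?T W S \<noteq> 0" "S \<subseteq> ?V" for S
  proof
    fix v assume v: "v \<in> insert i (S - {w})"
    then have vV: "v \<in> ?V" using that iw by auto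
    have "W v (v \<in> S) (next_y L v \<in> S) (next_x L v \<in> S) \<noteq> 0"
      using that(1) vV by (auto simp: prod_zero_iff)
    moreover have "W v (v \<in> S) False False = 0"
      using v bulk(1)[OF vV] i0 by (cases "v = i") auto
    ultimately show "next_y L v \<in> S \<or> next_x L v \<in> S"
      by (cases "next_y L v \<in> S"; cases "next_x L v \<in> S") simp_all
  qed
  let ?\<Delta> = "torus_dist L w i"
  \<comment> \<open>With an empty base layer the rank cannot wrap: following swapped successors from
    \<open>i\<close> lowers it by one per step until \<open>w\<close> at rank 1. Different ranks
    give different swapped sites, and the reversed chain bounds the distance.\<close>
  have caseA: "card S \<ge> ?\<Delta>" if S: "S \<subseteq> ?V" and ne: "?T W S \<noteq> 0" and empty: "S \<inter> base_layer L c = {}" for S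
  proof -
    have base: "?r v \<noteq> 0" if "v \<in> S" for v
      using empty S that unfolding base_layer_def by auto
    have chain: "(w, v) \<in> torus_edges L ^^ (?r v - 1) \<and> {1..?r v} \<subseteq> ?r ` S" if "v \<in> S" "?r v = n" for v n
      using that
    proof (induction n arbitrary: v)
      case 0
      then show ?case using base by auto
    next
      case (Suc n)
      show ?case
      proof (cases "v = w")
        case True
        then show ?thesis using Suc.prems rw by (auto intro!: rev_image_eqI[of w])
      next
        case False
        then obtain u where u: "u \<in> S" "u = next_y L v \<or> u = next_x L v"
          using support[OF ne S] Suc.prems(1) by blast
        then have ru: "?r u = n" using succ[of v] Suc.prems(2) by auto
        then have n: "n \<noteq> 0" using base[OF u(1)] by simp
        have "(u, v) \<in> torus_edges L" using u(2) next_edge S Suc.prems(1) by blast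
        moreover have "(w, u) \<in> torus_edges L ^^ (n - 1)" "{1..n} \<subseteq> ?r ` S" using Suc.IH[OF u(1) ru] ru by auto
        moreover have "Suc n \<in> ?r ` S" using Suc.prems by (metis image_eqI)
        ultimately have "(w, v) \<in> torus_edges L ^^ Suc (n - 1)" "{1..Suc n} \<subseteq> ?r ` S"
          by (auto intro: relpow_Suc_I simp: atLeastAtMostSuc_conv)
        then show ?thesis using n Suc.prems(2) by simp
      qed
    qed
    obtain u where u: "u \<in> S" "u = next_y L i \<or> u = next_x L i"
      using support[OF ne S] by blast
    have "(w, i) \<in> torus_edges L ^^ Suc (?r u - 1)"
      using chain[OF u(1) refl] u(2) next_edge(1,2)[OF iw(1)] by (auto intro: relpow_Suc_I)
    then have "?\<Delta> \<le> ?r u" using torus_dist_le base[OF u(1)] by fastforce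
    also have "?r u = card {1..?r u}" by simp
    also have "\<dots> \<le> card (?r ` S)"
      using chain[OF u(1) refl] S by (intro card_mono finite_imageI) (auto intro: finite_subset)
    also have "\<dots> \<le> card S" using S by (intro card_image_le) (auto intro: finite_subset)
    finally show ?thesis .
  qed
  \<comment> \<open>A swapped site of rank 0 is not \<open>w\<close>, so swapped successors run down
    through the ranks L - 1, ..., 1. The chain may stop only at \<open>w\<close>, whose rank 1 is
    the last one to be visited.\<close>
  have caseB: "S \<inter> base_layer L (c - int \<rho>) \<noteq> {}"
    if S: "S \<subseteq> ?V" and ne: "?T W S \<noteq> 0" and nonempty: "S \<inter> base_layer L c \<noteq> {}" and \<rho>: "\<rho> < L" for S \<rho>
  proof -
    obtain u where u: "u \<in> S" "?r u = 0"
      using nonempty unfolding base_layer_def by auto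
    have "u \<noteq> w" using u rw by auto
    have ex: "\<exists>v\<in>S. ?r v = L - Suc n" if "Suc n < L" for n
      using that
    proof (induction n)
      case 0
      then show ?case using support[OF ne S] u succ0[OF u(2)] \<open>u \<noteq> w\<close> by (metis DiffI One_nat_def insertCI singletonD)
    next
      case (Suc n)
      then obtain v where v: "v \<in> S" "?r v = L - Suc n" by auto
      then have "v \<noteq> w" "?r v \<noteq> 0" using rw Suc.prems by auto
      then obtain y where y: "y \<in> S" "y = next_y L v \<or> y = next_x L v"
        using support[OF ne S] v by blast
      then have "?r y = ?r v - 1" using succ[OF \<open>?r v \<noteq> 0\<close>] by auto
      then show ?case using v y(1) Suc.prems by (intro bexI[of _ y]) auto
    qed
    have "\<exists>v\<in>S. ?r v = \<rho>"
    proof (cases "\<rho> = 0")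
      case False
      then have "Suc (L - Suc \<rho>) < L" "L - Suc (L - Suc \<rho>) = \<rho>" using \<rho> by auto
      then show ?thesis using ex by metis
    qed (use u in auto)
    then show ?thesis
      using S layer_rank_shift[OF L \<rho>] unfolding base_layer_def by blast
  qed
  \<comment> \<open>Prices for the spins on the fixed diagonal. \<open>h0\<close> admits only the
    empty configuration; \<open>h1\<close> excludes it, as it would contribute 1 per diagonal
    without any decay.\<close>
  define h0 :: "site set \<Rightarrow> real" where "h0 B = of_bool (B = {}) * (2/3) ^ ?\<Delta>" for B
  define h1 :: "site set \<Rightarrow> real" where "h1 B = of_bool (B \<noteq> {}) * ((2/3) ^ L) ^ card B" for B
  have h: "h0 B \<ge> 0" "h1 B \<ge> 0" for B unfolding h0_def h1_def by auto
  \<comment> \<open>The minimising diagonal depends on \<open>S\<close>; the sum over all L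
    diagonals bounds its term uniformly.\<close>
  have WS: "?T W S \<le> 9 * K\<^sup>2 * (h0 (S \<inter> base_layer L c) * ?T P S +
      (\<Sum>\<rho><L. h1 (S \<inter> base_layer L (c - int \<rho>)) * ?T P S))" if S: "S \<subseteq> ?V" for S
  proof (cases "?T W S = 0")
    case True
    have "0 \<le> 9 * K\<^sup>2 * (h0 (S \<inter> base_layer L c) * ?T P S +
      (\<Sum>\<rho><L. h1 (S \<inter> base_layer L (c - int \<rho>)) * ?T P S))"
      using h T0[of S] by (intro mult_nonneg_nonneg add_nonneg_nonneg sum_nonneg) auto
    then show ?thesis unfolding True .
  next
    case ne: False
    have fin: "finite S" using finite_subset[OF S] by simp
    let ?\<Sigma> = "\<Sum>\<rho><L. h1 (S \<inter> base_layer L (c - int \<rho>)) * ?T P S"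
    have \<Sigma>0: "?\<Sigma> \<ge> 0" using h T0[of S] by (intro sum_nonneg mult_nonneg_nonneg) auto
    have "(2/3) ^ card S * ?T P S \<le> h0 (S \<inter> base_layer L c) * ?T P S + ?\<Sigma>"
    proof (cases "S \<inter> base_layer L c = {}")
      case True
      have "(2/3 :: real) ^ card S \<le> h0 (S \<inter> base_layer L c)"
        unfolding h0_def True using caseA[OF S ne True] by (simp add: power_decreasing)
      then have "(2/3) ^ card S * ?T P S \<le> h0 (S \<inter> base_layer L c) * ?T P S"
        by (rule mult_right_mono[OF _ T0])
      then show ?thesis using \<Sigma>0 by linarith
    next
      case False
      let ?n = "\<lambda>\<rho>. card (S \<inter> base_layer L (c - int \<rho>))"
      obtain \<rho> where \<rho>: "\<rho> < L" "\<And>\<rho>'. \<rho>' < L \<Longrightarrow> ?n \<rho> \<le> ?n \<rho>'"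
        using ex_has_least_nat[of "\<lambda>\<rho>. \<rho> < L" 0 ?n] L by blast
      have "card S = card (\<Union>\<rho>'<L. S \<inter> base_layer L (c - int \<rho>'))"
      proof (rule arg_cong[where f = card])
        have "v \<in> base_layer L (c - int (?r v))" if "v \<in> S" for v
          using S that layer_rank_shift[OF L layer_rank_less[OF L]] unfolding base_layer_def by blast
        then show "S = (\<Union>\<rho>'<L. S \<inter> base_layer L (c - int \<rho>'))"
          using layer_rank_less[OF L, of c] by blast
      qed
      also have "\<dots> = (\<Sum>\<rho>'<L. ?n \<rho>')"
        using fin layer_rank_shift[OF L, of _ c] by (intro card_UN_disjoint) (auto simp: base_layer_def)
      finally have "card S = (\<Sum>\<rho>'<L. ?n \<rho>')" .
      moreover have "(\<Sum>\<rho>'<L. ?n \<rho>) \<le> (\<Sum>\<rho>'<L. ?n \<rho>')"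
        using \<rho>(2) by (intro sum_mono) auto
      ultimately have "L * ?n \<rho> \<le> card S" by simp
      then have "(2/3 :: real) ^ card S \<le> h1 (S \<inter> base_layer L (c - int \<rho>))"
        unfolding h1_def using caseB[OF S ne False \<rho>(1)]
        by (simp add: power_mult[symmetric] power_decreasing)
      then have "(2/3) ^ card S * ?T P S \<le> h1 (S \<inter> base_layer L (c - int \<rho>)) * ?T P S"
        by (rule mult_right_mono[OF _ T0])
      also have "\<dots> \<le> ?\<Sigma>"
        using \<rho>(1) h T0[of S] by (intro member_le_sum) auto
      finally show ?thesis using h[of "S \<inter> base_layer L c"] T0[of S] by (simp add: add_increasing)
    qed
    then have "9 * K\<^sup>2 * ((2/3) ^ card S * ?T P S) \<le> 9 * K\<^sup>2 * (h0 (S \<inter> base_layer L c) * ?T P S + ?\<Sigma>)"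
      by (rule mult_left_mono) simp
    with WT[OF S] show ?thesis by (simp only: mult.assoc)
  qed
  have "(\<Sum>S\<in>Pow ?V. ?T W S) \<le> (\<Sum>S\<in>Pow ?V. 9 * K\<^sup>2 * (h0 (S \<inter> base_layer L c) * ?T P S +
      (\<Sum>\<rho><L. h1 (S \<inter> base_layer L (c - int \<rho>)) * ?T P S)))"
    by (intro sum_mono WS) auto
  also have "\<dots> = 9 * K\<^sup>2 * ((\<Sum>S\<in>Pow ?V. h0 (S \<inter> base_layer L c) * ?T P S) +
      (\<Sum>\<rho><L. \<Sum>S\<in>Pow ?V. h1 (S \<inter> base_layer L (c - int \<rho>)) * ?T P S))"
    unfolding sum_distrib_left[symmetric] sum.distrib by (subst sum.swap) simp
  also have "\<dots> \<le> 9 * K\<^sup>2 * ((\<Sum>B\<in>Pow (base_layer L c). h0 B) + (\<Sum>\<rho><L. \<Sum>B\<in>Pow (base_layer L (c - int \<rho>)). h1 B))"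
    using P0 P1 h by (intro mult_left_mono add_mono sum_mono torus_slice_sum_le[OF L]) auto
  also have "(\<Sum>B\<in>Pow (base_layer L c). h0 B) = (2/3) ^ ?\<Delta>"
  proof -
    have "(\<Sum>B\<in>Pow (base_layer L c). h0 B) = (\<Sum>B\<in>{{}}. h0 B)"
      unfolding h0_def by (intro sum.mono_neutral_right) (auto simp: base_layer_def)
    then show ?thesis by (simp add: h0_def)
  qed
  finally have main: "(\<Sum>S\<in>Pow ?V. ?T W S) \<le>
      9 * K\<^sup>2 * ((2/3) ^ ?\<Delta> + (\<Sum>\<rho><L. \<Sum>B\<in>Pow (base_layer L (c - int \<rho>)). h1 B))" .
  have "(\<Sum>\<rho><L. \<Sum>B\<in>Pow (base_layer L (c - int \<rho>)). h1 B) \<le> (\<Sum>\<rho><L. (1 + (2/3) ^ L) ^ L - 1 :: real)"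
  proof (rule sum_mono)
    fix \<rho>
    let ?K = "base_layer L (c - int \<rho>)"
    have fin: "finite ?K" unfolding base_layer_def by simp
    have "(\<Sum>B\<in>Pow ?K. h1 B) = (\<Sum>B\<in>Pow ?K. ((2/3) ^ L) ^ card B - of_bool (B = {}))"
      unfolding h1_def by (intro sum.cong) auto
    also have "\<dots> = (1 + (2/3) ^ L) ^ card ?K - (\<Sum>B\<in>Pow ?K. of_bool (B = {}))"
      unfolding sum_subtractf sum_Pow_power_card[OF fin] ..
    also have "(\<Sum>B\<in>Pow ?K. of_bool (B = {})) = (1 :: real)"
    proof -
      have "(\<Sum>B\<in>Pow ?K. of_bool (B = {}) :: real) = (\<Sum>B\<in>{{} :: site set}. of_bool (B = {}))"
        using fin by (intro sum.mono_neutral_right) auto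
      then show ?thesis by simp
    qed
    also have "(1 + (2/3 :: real) ^ L) ^ card ?K \<le> (1 + (2/3) ^ L) ^ L"
      by (intro power_increasing card_base_layer) auto
    finally show "(\<Sum>B\<in>Pow ?K. h1 B) \<le> (1 + (2/3) ^ L) ^ L - 1" by simp
  qed
  also have "(\<Sum>\<rho><L. (1 + (2/3) ^ L) ^ L - 1 :: real) \<le> 200 * 0.93 ^ (2 * L)"
    using nonempty_slices_le[of L] by simp
  also have "(0.93 :: real) ^ (2 * L) \<le> 0.93 ^ ?\<Delta>"
    by (intro power_decreasing torus_dist_le_2L iw) auto
  finally have "(\<Sum>\<rho><L. \<Sum>B\<in>Pow (base_layer L (c - int \<rho>)). h1 B) \<le> 200 * 0.93 ^ ?\<Delta>"
    by simp
  moreover have "(2/3 :: real) ^ ?\<Delta> \<le> 0.93 ^ ?\<Delta>"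
    by (intro power_mono) auto
  ultimately have "9 * K\<^sup>2 * ((2/3) ^ ?\<Delta> + (\<Sum>\<rho><L. \<Sum>B\<in>Pow (base_layer L (c - int \<rho>)). h1 B)) \<le>
      9 * K\<^sup>2 * (0.93 ^ ?\<Delta> + 200 * 0.93 ^ ?\<Delta>)"
    by (intro mult_left_mono add_mono) auto
  with main show ?thesis by simp
qed

section \<open>The weights of the spin model\<close>

text \<open>For hermitian \<open>A\<close> this is tr (A^2) under the swap and (tr A)^2 under the
  identity.\<close>

definition obs_contract :: "complex^'d^'d \<Rightarrow> bool \<Rightarrow> complex" where
  "obs_contract A \<rho> = (\<Sum>p\<in>UNIV. obs_weight A p * of_bool (pairing \<rho> p))"

text \<open>\<open>q\<close> stays arbitrary so that the identity serves both an ordinary site,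
  where it is the Weingarten function, and the site of the derivative.\<close>

lemma contract_site:
  fixes A :: "complex^'d::finite^'d"
  assumes z: "norm z = 1"
  shows "(\<Sum>r\<in>UNIV. \<Sum>p\<in>UNIV. state_weight z r * obs_weight A p *
      (\<Sum>\<sigma>\<in>UNIV. \<Sum>\<rho>\<in>UNIV. q \<sigma> \<rho> * of_bool (pairing \<sigma> (join_quad a b r)) * of_bool (pairing \<rho> (join_quad c l p)))) =
    (\<Sum>\<sigma>\<in>UNIV. \<Sum>\<rho>\<in>UNIV. (q \<sigma> \<rho> * obs_contract A \<rho>) *
      (of_bool (pairing \<sigma> a) * of_bool (pairing \<sigma> b)) * (of_bool (pairing \<rho> c) * of_bool (pairing \<rho> l)))"
    (is "?lhs = ?rhs")
proof -
  have "?lhs = (\<Sum>r\<in>UNIV. \<Sum>p\<in>UNIV. \<Sum>\<sigma>\<in>UNIV. \<Sum>\<rho>\<in>UNIV. (q \<sigma> \<rho> * (of_bool (pairing \<sigma> a) * of_bool (pairing \<sigma> b)) *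
      (of_bool (pairing \<rho> c) * of_bool (pairing \<rho> l))) *
      ((state_weight z r * of_bool (pairing \<sigma> r)) * (obs_weight A p * of_bool (pairing \<rho> p))))"
    unfolding sum_distrib_left pairing_join_quad of_bool_conj by (simp only: mult_ac)
  also have "\<dots> = (\<Sum>\<sigma>\<in>UNIV. \<Sum>\<rho>\<in>UNIV. \<Sum>r\<in>UNIV. \<Sum>p\<in>UNIV. (q \<sigma> \<rho> * (of_bool (pairing \<sigma> a) * of_bool (pairing \<sigma> b)) *
      (of_bool (pairing \<rho> c) * of_bool (pairing \<rho> l))) *
      ((state_weight z r * of_bool (pairing \<sigma> r)) * (obs_weight A p * of_bool (pairing \<rho> p))))"
    by (rule sum_swap_pairs)
  also have "\<dots> = (\<Sum>\<sigma>\<in>UNIV. \<Sum>\<rho>\<in>UNIV. (q \<sigma> \<rho> * (of_bool (pairing \<sigma> a) * of_bool (pairing \<sigma> b)) *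
      (of_bool (pairing \<rho> c) * of_bool (pairing \<rho> l))) *
      ((\<Sum>r\<in>UNIV. state_weight z r * of_bool (pairing \<sigma> r)) * obs_contract A \<rho>))"
    unfolding obs_contract_def sum_product unfolding sum_distrib_left ..
  also have "\<dots> = ?rhs"
    unfolding state_weight_pairing[OF z] by (simp only: mult_1_left mult_ac)
  finally show ?thesis .
qed

lemma contract_inner:
  fixes d :: "'x::finite \<Rightarrow> 'y::finite \<Rightarrow> complex"
  shows "(\<Sum>m\<in>UNIV. \<Sum>n\<in>UNIV. d m n * (\<Sum>\<rho>\<in>(UNIV :: bool set). \<alpha> \<rho> * f \<rho> m) * (\<Sum>\<sigma>\<in>(UNIV :: bool set). \<beta> \<sigma> * g \<sigma> n)) =
    (\<Sum>\<rho>\<in>UNIV. \<Sum>\<sigma>\<in>UNIV. \<alpha> \<rho> * \<beta> \<sigma> * (\<Sum>m\<in>UNIV. \<Sum>n\<in>UNIV. d m n * f \<rho> m * g \<sigma> n))"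
proof -
  have "(\<Sum>m\<in>UNIV. \<Sum>n\<in>UNIV. d m n * (\<Sum>\<rho>\<in>(UNIV :: bool set). \<alpha> \<rho> * f \<rho> m) * (\<Sum>\<sigma>\<in>(UNIV :: bool set). \<beta> \<sigma> * g \<sigma> n)) =
    (\<Sum>m\<in>UNIV. \<Sum>n\<in>UNIV. \<Sum>\<rho>\<in>UNIV. \<Sum>\<sigma>\<in>UNIV. \<alpha> \<rho> * \<beta> \<sigma> * (d m n * f \<rho> m * g \<sigma> n))"
    unfolding mult.assoc[of "d _ _"] sum_product unfolding sum_distrib_left by (simp only: mult_ac)
  also have "\<dots> = (\<Sum>\<rho>\<in>UNIV. \<Sum>\<sigma>\<in>UNIV. \<Sum>m\<in>UNIV. \<Sum>n\<in>UNIV. \<alpha> \<rho> * \<beta> \<sigma> * (d m n * f \<rho> m * g \<sigma> n))"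
    by (rule sum_swap_pairs)
  finally show ?thesis unfolding sum_distrib_left .
qed

text \<open>The inner spins of both designs are forced to be swaps, so each Weingarten factor
  compares an outer spin with \<open>True\<close>: \<open>wg \<sigma>\<close> on the right stands
  for \<open>wg (\<sigma> = True)\<close>.\<close>

lemma deriv_weight_design_contract:
  fixes G :: "complex^'n^'n" and wg :: "bool \<Rightarrow> complex"
  assumes G: "hermitian_matrix G"
  defines "E \<equiv> \<lambda>x y. \<Sum>\<sigma>\<in>UNIV. \<Sum>\<rho>\<in>UNIV. wg (\<sigma> = \<rho>) * of_bool (pairing \<sigma> x) * of_bool (pairing \<rho> y) :: complex"
  shows "(\<Sum>m\<in>UNIV. \<Sum>n\<in>UNIV. deriv_weight (map_matrix ((*) \<i>) G) m n * E x m * E n y) =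
    (\<Sum>\<sigma>\<in>UNIV. \<Sum>\<rho>\<in>UNIV. (wg \<sigma> * wg \<rho> * commutator_weight G) * of_bool (pairing \<sigma> x) * of_bool (pairing \<rho> y))"
proof -
  define \<alpha> where "\<alpha> x \<rho> = (\<Sum>\<sigma>\<in>UNIV. wg (\<sigma> = \<rho>) * of_bool (pairing \<sigma> x))" for x :: "'n quad" and \<rho>
  have E1: "E x m = (\<Sum>\<rho>\<in>UNIV. \<alpha> x \<rho> * of_bool (pairing \<rho> m))" for m
    unfolding E_def \<alpha>_def sum_distrib_right by (rule sum.swap)
  have E2: "E n y = (\<Sum>\<sigma>\<in>UNIV. \<alpha> y \<sigma> * of_bool (pairing \<sigma> n))" for n
    unfolding E_def \<alpha>_def sum_distrib_right by (simp only: mult_ac eq_commute)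
  have "(\<Sum>m\<in>UNIV. \<Sum>n\<in>UNIV. deriv_weight (map_matrix ((*) \<i>) G) m n * E x m * E n y) =
      (\<Sum>\<rho>\<in>UNIV. \<Sum>\<sigma>\<in>UNIV. \<alpha> x \<rho> * \<alpha> y \<sigma> * (of_bool (\<rho> \<and> \<sigma>) * commutator_weight G))"
    unfolding E1 E2 contract_inner deriv_weight_contract[OF G] ..
  also have "\<dots> = \<alpha> x True * \<alpha> y True * commutator_weight G"
    unfolding UNIV_bool by simp
  also have "\<dots> = (\<Sum>\<sigma>\<in>UNIV. \<Sum>\<rho>\<in>UNIV. (wg \<sigma> * wg \<rho> * commutator_weight G) * of_bool (pairing \<sigma> x) * of_bool (pairing \<rho> y))"
    unfolding \<alpha>_def sum_product unfolding sum_distrib_right by (simp only: eq_True mult_ac)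
  finally show ?thesis .
qed

definition gram :: "real \<Rightarrow> bool \<Rightarrow> bool \<Rightarrow> real" where
  "gram D \<sigma> \<rho> = (if \<sigma> = \<rho> then D * D else D)"

text \<open>\<open>D * (D * d)\<close> is the dimension N of a site unitary; \<open>d\<close> or
  \<open>d * d\<close> is the closed physical leg under swap or identity.\<close>

definition bulk_weight :: "real \<Rightarrow> real \<Rightarrow> bool \<Rightarrow> bool \<Rightarrow> bool \<Rightarrow> real" where
  "bulk_weight D d \<sigma> t u = (\<Sum>\<rho>\<in>UNIV. weingarten (D * (D * d)) (\<sigma> = \<rho>) * (if \<rho> then d else d * d) * gram D \<rho> t * gram D \<rho> u)"

lemma bulk_weight_alt:
  "bulk_weight D d \<sigma> t u = ((if \<sigma> then - 1 else D * (D * d)) * (d * d) * gram D False t * gram D False u +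
     (if \<sigma> then D * (D * d) else - 1) * d * gram D True t * gram D True u) / (D * (D * d) * ((D * (D * d))\<^sup>2 - 1))"
  unfolding bulk_weight_def weingarten_def UNIV_bool by (simp add: add_divide_distrib)

text \<open>The first two equations are unitarity: with the identity on all column legs, U meets its
  adjoint and leaves the identity on the row legs. The bound 2/3 is attained at D = d = 2.\<close>

lemma bulk_weight_bounds:
  assumes D: "D \<ge> 2" and d: "d \<ge> 2"
  shows "bulk_weight D d True False False = 0" "bulk_weight D d False False False = 1"
    "bulk_weight D d \<sigma> t u \<ge> 0"
    "t \<or> u \<Longrightarrow> bulk_weight D d True t u + bulk_weight D d False t u \<le> 2 / 3"
proof -
  define N where "N = D * (D * d)"
  have Dd: "D * d \<ge> 4" "D * D \<ge> 4" using D d mult_mono[of 2 D 2 d] mult_mono[of 2 D 2 D] by auto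
  have N: "N \<ge> 8" unfolding N_def using D Dd mult_mono[of 2 D 4 "D * d"] by auto
  have Nd: "N \<ge> d"
    unfolding N_def using d Dd mult_right_mono[of 1 "D * D" d] by (simp add: mult.assoc)
  have "N\<^sup>2 > 1" using N by (simp add: power2_eq_square less_1_mult)
  then have Q: "N * (N\<^sup>2 - 1) > 0" using N by simp
  note w = bulk_weight_alt[of D d, folded N_def]
  show "bulk_weight D d True False False = 0"
    unfolding w gram_def N_def by simp
  have "N * (d * d) * (D * D) * (D * D) - d * D * D = N * (N\<^sup>2 - 1)"
    unfolding N_def by (simp add: power2_eq_square algebra_simps)
  then show "bulk_weight D d False False False = 1"
    unfolding w gram_def using less_imp_neq[OF Q, symmetric] by (simp add: mult_ac)
  have g0: "gram D x y \<ge> 0" for x y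
    unfolding gram_def using D by auto
  \<comment> \<open>Changing the spin costs at most a factor D per bond. Two bonds and the physical
    leg cost D^2 d = N, so the Weingarten entry N outweighs the negative entry -1.\<close>
  have gle: "gram D x y \<le> D * gram D x' y" for x x' y
    unfolding gram_def using D mult_left_mono[of 1 D D] mult_left_mono[of D "D * D" D] mult_left_mono[of 1 "D * D" D] Dd by auto
  have gg: "d * (gram D x t * gram D x u) \<le> N * (gram D x' t * gram D x' u)" for x x'
  proof -
    have "gram D x t * gram D x u \<le> (D * gram D x' t) * (D * gram D x' u)"
      using D by (intro mult_mono gle g0 mult_nonneg_nonneg) auto
    then have "d * (gram D x t * gram D x u) \<le> d * ((D * gram D x' t) * (D * gram D x' u))"
      using d by (intro mult_left_mono) auto
    then show ?thesis unfolding N_def by (simp add: mult_ac)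
  qed
  show "bulk_weight D d \<sigma> t u \<ge> 0"
    unfolding w
  proof (rule divide_nonneg_pos[OF _ Q])
    have "d * (d * (gram D False t * gram D False u)) \<le> d * (N * (gram D True t * gram D True u))"
      using d by (intro mult_left_mono gg) auto
    moreover have "d * (gram D True t * gram D True u) \<le> d * d * (N * (gram D False t * gram D False u))"
    proof -
      have "d * (gram D True t * gram D True u) \<le> 1 * (N * (gram D False t * gram D False u))"
        using gg by simp
      also have "\<dots> \<le> d * d * (N * (gram D False t * gram D False u))"
        using d N mult_mono[of 1 d 1 d] by (intro mult_right_mono mult_nonneg_nonneg g0) auto
      finally show ?thesis .
    qed
    ultimately show "0 \<le> (if \<sigma> then - 1 else N) * (d * d) * gram D False t * gram D False u + (if \<sigma> then N else - 1) * d * gram D True t * gram D True u"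
      by (simp add: mult_ac)
  qed
  show "bulk_weight D d True t u + bulk_weight D d False t u \<le> 2 / 3" if tu: "t \<or> u"
  proof -
    \<comment> \<open>Summed over the row spin, the Weingarten function is 1 / (N (N + 1)) for
      either column spin; this is the cancellation of N - 1.\<close>
    have "bulk_weight D d True t u + bulk_weight D d False t u =
        (N - 1) * (d * d * (gram D False t * gram D False u) + d * (gram D True t * gram D True u)) / (N * (N\<^sup>2 - 1))"
      unfolding w by (simp add: add_divide_distrib[symmetric] algebra_simps)
    also have "N * (N\<^sup>2 - 1) = (N - 1) * (N * (N + 1))"
      by (simp add: power2_eq_square algebra_simps)
    also have "(N - 1) * (d * d * (gram D False t * gram D False u) + d * (gram D True t * gram D True u)) / ((N - 1) * (N * (N + 1))) =
        (d * d * (gram D False t * gram D False u) + d * (gram D True t * gram D True u)) / (N * (N + 1))"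
      using N by simp
    also have "\<dots> \<le> 2 / 3"
    proof -
      have "3 * (d * d * (gram D False t * gram D False u) + d * (gram D True t * gram D True u)) \<le> 2 * (N * (N + 1))"
      proof (cases "t \<and> u")
        case True
        \<comment> \<open>This is 2 (N + 1) - 3 (d + D^2), arranged into terms that are nonnegative
          for D, d \<ge> 2 and vanish at D = d = 2. The other case treats 2 (N + 1) - 3 D (d + 1) in
          the same way.\<close>
        have "0 \<le> (d - 2) * (2 * (D * D) - 3) + (D * D - 4)"
          using d Dd by (intro add_nonneg_nonneg mult_nonneg_nonneg) auto
        then have "3 * (d + D * D) \<le> 2 * (N + 1)"
          unfolding N_def by (simp add: algebra_simps)
        then have "N * (3 * (d + D * D)) \<le> N * (2 * (N + 1))"
          using N by (intro mult_left_mono) auto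
        then show ?thesis
          using True unfolding gram_def N_def by (simp add: algebra_simps)
      next
        case False
        have "0 \<le> D * (d - 2) * (2 * D - 3) + (4 * D - 1) * (D - 2)"
          using d D by (intro add_nonneg_nonneg mult_nonneg_nonneg) auto
        then have "3 * (D * (d + 1)) \<le> 2 * (N + 1)"
          unfolding N_def by (simp add: algebra_simps)
        then have "N * (3 * (D * (d + 1))) \<le> N * (2 * (N + 1))"
          using N by (intro mult_left_mono) auto
        then show ?thesis
          using False tu unfolding gram_def N_def by (auto simp: algebra_simps)
      qed
      then show ?thesis using N by (simp add: divide_simps mult.commute)
    qed
    finally show ?thesis .
  qed
qed

section \<open>Bounds on the observable and the exact second moment\<close>

lemma obs_contract_mat_1:
  "obs_contract (mat 1 :: complex^'d^'d) \<rho> = of_real (if \<rho> then real CARD('d) else real CARD('d) * real CARD('d))"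
proof -
  have mat: "mat 1 $ a $ b = (of_bool (a = b) :: complex)" for a b :: 'd
    by (simp add: mat_def)
  have "obs_contract (mat 1 :: complex^'d^'d) True = of_nat CARD('d)"
  proof -
    have "of_bool (b = a) * cnj (of_bool (b = a)) = (if b = a then 1 else 0 :: complex)" for a b :: 'd by simp
    then show ?thesis unfolding obs_contract_def sum_pairing obs_weight_def mat by simp
  qed
  moreover have "obs_contract (mat 1 :: complex^'d^'d) False = of_nat CARD('d) * of_nat CARD('d)"
    unfolding obs_contract_def sum_pairing obs_weight_def mat by simp
  ultimately show ?thesis by (cases \<rho>) simp_all
qed

text \<open>For hermitian \<open>A\<close>, tr (A^2) is the sum of the squared moduli of all
  entries, so \<open>\<tau>\<close> controls each of them. The absolute value makes the bound
  nonnegative for any \<open>\<tau>\<close>, which the theorem fixes before an observable is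
  given.\<close>

lemma norm_obs_contract_le:
  fixes A :: "complex^'d^'d"
  assumes A: "hermitian_matrix A" and \<tau>: "trace (A ** A) = of_real \<tau>"
  shows "norm (obs_contract A \<rho>) \<le> (real CARD('d))\<^sup>2 * \<bar>\<tau>\<bar>"
proof -
  have herm: "A $ b $ a = cnj (A $ a $ b)" for a b
    using A unfolding hermitian_matrix_def adjoint_matrix_def vec_eq_iff by (metis vec_lambda_beta)
  have "complex_of_real \<tau> = (\<Sum>a\<in>UNIV. \<Sum>b\<in>UNIV. A $ a $ b * A $ b $ a)"
    unfolding \<tau>[symmetric] trace_def matrix_mult_entry ..
  also have "\<dots> = (\<Sum>a\<in>UNIV. \<Sum>b\<in>UNIV. of_real ((norm (A $ a $ b))\<^sup>2))"
  proof (intro sum.cong refl)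
    fix a b
    show "A $ a $ b * A $ b $ a = of_real ((norm (A $ a $ b))\<^sup>2)"
      unfolding complex_norm_square by (subst herm[of b a]) (rule refl)
  qed
  finally have tau: "\<tau> = (\<Sum>a\<in>UNIV. \<Sum>b\<in>UNIV. (norm (A $ a $ b))\<^sup>2)"
    by (metis (no_types, lifting) of_real_eq_iff of_real_sum sum.cong)
  have entry: "(norm (A $ a $ b))\<^sup>2 \<le> \<tau>" for a b
  proof -
    have "(norm (A $ a $ b))\<^sup>2 \<le> (\<Sum>b\<in>UNIV. (norm (A $ a $ b))\<^sup>2)"
      by (rule member_le_sum) auto
    also have "\<dots> \<le> (\<Sum>a\<in>UNIV. \<Sum>b\<in>UNIV. (norm (A $ a $ b))\<^sup>2)"
      by (rule member_le_sum) (auto intro!: sum_nonneg)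
    finally show ?thesis unfolding tau .
  qed
  have prod: "norm (A $ a $ b * cnj (A $ c $ e)) \<le> \<bar>\<tau>\<bar>" for a b c e
  proof -
    have "0 \<le> (norm (A $ a $ b) - norm (A $ c $ e))\<^sup>2" by simp
    then have "2 * (norm (A $ a $ b) * norm (A $ c $ e)) \<le> (norm (A $ a $ b))\<^sup>2 + (norm (A $ c $ e))\<^sup>2"
      by (simp add: power2_diff)
    then show ?thesis using entry[of a b] entry[of c e] by (simp add: norm_mult)
  qed
  have sum2: "norm (\<Sum>a\<in>(UNIV :: 'd set). \<Sum>b\<in>(UNIV :: 'd set). f a b) \<le> (real CARD('d))\<^sup>2 * \<bar>\<tau>\<bar>"
    if "\<And>a b. norm (f a b) \<le> \<bar>\<tau>\<bar>" for f :: "'d \<Rightarrow> 'd \<Rightarrow> complex"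
  proof -
    have "norm (\<Sum>a\<in>(UNIV :: 'd set). \<Sum>b\<in>(UNIV :: 'd set). f a b) \<le> (\<Sum>a\<in>(UNIV :: 'd set). \<Sum>b\<in>(UNIV :: 'd set). \<bar>\<tau>\<bar>)"
      by (intro sum_norm_le that)
    then show ?thesis by (simp add: power2_eq_square)
  qed
  have "norm (obs_contract A True) \<le> (real CARD('d))\<^sup>2 * \<bar>\<tau>\<bar>" "norm (obs_contract A False) \<le> (real CARD('d))\<^sup>2 * \<bar>\<tau>\<bar>"
    unfolding obs_contract_def sum_pairing obs_weight_def by (intro sum2, simp add: prod del: norm_mult complex_mod_cnj)+
  then show ?thesis by (cases \<rho>) simp_all
qed

lemma site_quad_expectation:
  fixes X :: "'a \<Rightarrow> ('b::finite, 'd::finite) site_matrix"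
  assumes M: "prob_space M" and X: "unitary_two_design M X" and N: "CARD('b \<times> 'b \<times> 'd) \<ge> 2" and z: "norm z = 1"
  shows "integrable M (\<lambda>\<omega>. site_quad z A (X \<omega>) a b c l)"
    and "(\<integral>\<omega>. site_quad z A (X \<omega>) a b c l \<partial>M) = (\<Sum>\<sigma>\<in>UNIV. \<Sum>\<rho>\<in>UNIV.
      (of_real (weingarten (real CARD('b \<times> 'b \<times> 'd)) (\<sigma> = \<rho>)) * obs_contract A \<rho>) *
      (of_bool (pairing \<sigma> a) * of_bool (pairing \<sigma> b)) * (of_bool (pairing \<rho> c) * of_bool (pairing \<rho> l)))"
proof -
  note int = quad_entry_integrable[OF M X]
  show "integrable M (\<lambda>\<omega>. site_quad z A (X \<omega>) a b c l)"
    unfolding site_quad_def by (intro Bochner_Integration.integrable_sum integrable_mult_right int)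
  have "(\<integral>\<omega>. site_quad z A (X \<omega>) a b c l \<partial>M) = (\<Sum>r\<in>UNIV. \<Sum>p\<in>UNIV. state_weight z r * obs_weight A p *
      (\<integral>\<omega>. quad_entry (X \<omega>) (join_quad a b r) (join_quad c l p) \<partial>M))"
    unfolding site_quad_def
    by (subst Bochner_Integration.integral_sum Bochner_Integration.integral_mult_right_zero
      | intro Bochner_Integration.integrable_sum integrable_mult_right int sum.cong refl)+
  then show "(\<integral>\<omega>. site_quad z A (X \<omega>) a b c l \<partial>M) = (\<Sum>\<sigma>\<in>UNIV. \<Sum>\<rho>\<in>UNIV.
      (of_real (weingarten (real CARD('b \<times> 'b \<times> 'd)) (\<sigma> = \<rho>)) * obs_contract A \<rho>) *
      (of_bool (pairing \<sigma> a) * of_bool (pairing \<sigma> b)) * (of_bool (pairing \<rho> c) * of_bool (pairing \<rho> l)))"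
    unfolding two_design_moment[OF X N] contract_site[OF z] .
qed

lemma deriv_quad_expectation:
  fixes X Y :: "'a \<Rightarrow> ('b::finite, 'd::finite) site_matrix"
  assumes X: "unitary_two_design M X" and Y: "unitary_two_design M Y"
    and N: "CARD('b \<times> 'b \<times> 'd) \<ge> 2" and z: "norm z = 1" and G: "hermitian_matrix G"
  defines "wg \<equiv> \<lambda>b. complex_of_real (weingarten (real CARD('b \<times> 'b \<times> 'd)) b)"
  shows "(\<Sum>r\<in>UNIV. \<Sum>p\<in>UNIV. \<Sum>m\<in>UNIV. \<Sum>n\<in>UNIV. (state_weight z r * obs_weight (mat 1 :: complex^'d^'d) p *
        deriv_weight (map_matrix ((*) \<i>) G) m n * (\<integral>\<omega>. quad_entry (X \<omega>) (join_quad a b r) m \<partial>M)) *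
        (\<integral>\<omega>. quad_entry (Y \<omega>) n (join_quad c l p) \<partial>M)) =
    (\<Sum>\<sigma>\<in>UNIV. \<Sum>\<rho>\<in>UNIV. (wg \<sigma> * wg \<rho> * commutator_weight G * obs_contract (mat 1 :: complex^'d^'d) \<rho>) *
      (of_bool (pairing \<sigma> a) * of_bool (pairing \<sigma> b)) * (of_bool (pairing \<rho> c) * of_bool (pairing \<rho> l)))"
    (is "?lhs = ?rhs")
proof -
  define E where "E x y = (\<Sum>\<sigma>\<in>UNIV. \<Sum>\<rho>\<in>UNIV. wg (\<sigma> = \<rho>) * of_bool (pairing \<sigma> x) * of_bool (pairing \<rho> y))"
    for x y :: "('b \<times> 'b \<times> 'd) quad"
  have "(\<integral>\<omega>. quad_entry (X \<omega>) x y \<partial>M) = E x y" "(\<integral>\<omega>. quad_entry (Y \<omega>) x y \<partial>M) = E x y" for x y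
    unfolding E_def wg_def two_design_moment[OF X N] two_design_moment[OF Y N] by simp_all
  then have "?lhs = (\<Sum>r\<in>UNIV. \<Sum>p\<in>UNIV. state_weight z r * obs_weight (mat 1 :: complex^'d^'d) p *
      (\<Sum>m\<in>UNIV. \<Sum>n\<in>UNIV. deriv_weight (map_matrix ((*) \<i>) G) m n * E (join_quad a b r) m * E n (join_quad c l p)))"
    by (simp only: sum_distrib_left mult.assoc)
  also have "\<dots> = (\<Sum>r\<in>UNIV. \<Sum>p\<in>UNIV. state_weight z r * obs_weight (mat 1 :: complex^'d^'d) p *
      (\<Sum>\<sigma>\<in>UNIV. \<Sum>\<rho>\<in>UNIV. (wg \<sigma> * wg \<rho> * commutator_weight G) * of_bool (pairing \<sigma> (join_quad a b r)) *
        of_bool (pairing \<rho> (join_quad c l p))))"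
    unfolding E_def deriv_weight_design_contract[OF G] ..
  also have "\<dots> = ?rhs"
    by (rule contract_site[OF z])
  finally show ?thesis .
qed

lemma sum_UNIV_quadruple:
  "(\<Sum>k\<in>(UNIV :: ('w::finite \<times> 'x::finite \<times> 'y::finite \<times> 'z::finite) set). f k) =
    (\<Sum>a\<in>UNIV. \<Sum>b\<in>UNIV. \<Sum>c\<in>UNIV. \<Sum>e\<in>UNIV. f (a, b, c, e))"
proof -
  have "(\<Sum>k\<in>UNIV. f k) = (\<Sum>a\<in>UNIV. \<Sum>k\<in>UNIV. f (a, k))"
    by (rule sum_UNIV_pair)
  also have "\<dots> = (\<Sum>a\<in>UNIV. \<Sum>b\<in>UNIV. \<Sum>k\<in>UNIV. f (a, b, k))"
    by (rule sum.cong[OF refl], rule sum_UNIV_pair)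
  also have "\<dots> = (\<Sum>a\<in>UNIV. \<Sum>b\<in>UNIV. \<Sum>c\<in>UNIV. \<Sum>e\<in>UNIV. f (a, b, c, e))"
    by (rule sum.cong[OF refl], rule sum.cong[OF refl], rule sum_UNIV_pair)
  finally show ?thesis .
qed

definition spin_coeff :: "complex^'n^'n \<Rightarrow> complex^'d^'d \<Rightarrow> site \<Rightarrow> site \<Rightarrow> site \<Rightarrow> bool \<Rightarrow> bool \<Rightarrow> complex" where
  "spin_coeff G A i w v \<sigma> \<rho> = (let wg = (\<lambda>b. complex_of_real (weingarten (real CARD('n)) b)) in
     if v = i then wg \<sigma> * wg \<rho> * commutator_weight G * obs_contract (mat 1 :: complex^'d^'d) \<rho>
     else wg (\<sigma> = \<rho>) * obs_contract (if v = w then A else mat 1) \<rho>)"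

definition spin_weight :: "complex^'n^'n \<Rightarrow> complex^'d^'d \<Rightarrow> real \<Rightarrow> site \<Rightarrow> site \<Rightarrow> site \<Rightarrow> bool \<Rightarrow> bool \<Rightarrow> bool \<Rightarrow> complex" where
  "spin_weight G A D i w v \<sigma> t u =
     (\<Sum>\<rho>\<in>UNIV. spin_coeff G A i w v \<sigma> \<rho> * of_real (gram D \<rho> t) * of_real (gram D \<rho> u))"

lemma param_deriv_second_moment:
  fixes Gs :: "nat \<Rightarrow> ('b::finite, 'd::finite) site_matrix" and A :: "complex^'d^'d"
  assumes iw: "i \<in> sites L" "w \<in> sites L" "i \<noteq> w" and k: "k < p"
    and N: "CARD('b \<times> 'b \<times> 'd) \<ge> 2" and z: "norm z = 1" and G: "hermitian_matrix (Gs k)"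
    and R: "random_tn_params L p Gs i k M"
  defines "F \<equiv> param_deriv (local_loss L p Gs z A w) (i, k)"
  shows "has_bochner_integral M (\<lambda>\<theta>. F \<theta> * cnj (F \<theta>))
    (\<Sum>S\<in>Pow (sites L). \<Prod>v\<in>sites L. spin_weight (Gs k) A (real CARD('b)) i w v (v \<in> S) (next_y L v \<in> S) (next_x L v \<in> S))"
proof -
  interpret prob_space M using R unfolding random_tn_params_def by blast
  obtain s where s: "s \<in> {k, Suc k}"
    and Um: "unitary_two_design M (partial_unitary Gs 0 s i)"
    and Up: "unitary_two_design M (partial_unitary Gs s p i)"
    and ind: "indep_vars (\<lambda>_. borel)
          (case_sum (site_unitary Gs p)
             (\<lambda>left. if left then partial_unitary Gs 0 s i else partial_unitary Gs s p i))
          ((sites L - {i}) <+> (UNIV :: bool set))"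
    using R unfolding random_tn_params_def by blast
  have U: "unitary_two_design M (site_unitary Gs p v)" if "v \<in> sites L" for v
    using R that unfolding random_tn_params_def by blast
  let ?N = "case_sum (site_unitary Gs p)
             (\<lambda>left. if left then partial_unitary Gs 0 s i else partial_unitary Gs s p i)"
  let ?H = "map_matrix ((*) \<i>) (Gs k)"
  let ?O = "\<lambda>v. if v = w then A else mat 1"
  define h where "h v a b c l = (\<lambda>V. site_quad z (?O v) V a b c l)" for v and a b c l :: "'b quad"
  \<comment> \<open>The common index collects the physical indices r, q and the indices m, n between
    U_- and U_+. \<open>f\<close> takes all scalar weights and the entry of U_-, \<open>g\<close>
    only the entry of U_+.\<close>
  define f where "f = (\<lambda>(r, q, m, n) (a :: 'b quad) (b :: 'b quad) (c :: 'b quad) (l :: 'b quad) V. state_weight z r * obs_weight (mat 1 :: complex^'d^'d) q * deriv_weight ?H m n *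
      quad_entry (V :: ('b, 'd) site_matrix) (join_quad a b r) m)"
  define g where "g = (\<lambda>(r :: 'd quad, q :: 'd quad, m :: ('b \<times> 'b \<times> 'd) quad, n) (a :: 'b quad) (b :: 'b quad) c l V.
      quad_entry (V :: ('b, 'd) site_matrix) n (join_quad c l q))"
  have split: "site_unitary Gs p i \<theta> = partial_unitary Gs 0 s i \<theta> ** partial_unitary Gs s p i \<theta>" for \<theta>
    using s k by (intro partial_unitary_split) auto
  have F: "F \<theta> * cnj (F \<theta>) = tn_net L (\<lambda>v a b c l. if v = i
      then \<Sum>k\<in>UNIV. f k a b c l (?N (Inr True) \<theta>) * g k a b c l (?N (Inr False) \<theta>)
      else h v a b c l (?N (Inl v) \<theta>))" for \<theta>
    unfolding F_def param_deriv_local_loss[OF iw k s] split cnj_tn_net tn_net_mult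
  proof (rule tn_net_cong)
    fix v and a b c l :: "'b quad"
    let ?Um = "partial_unitary Gs 0 s i \<theta>" and ?Up = "partial_unitary Gs s p i \<theta>"
    show "(if v = i then loss_tensor z (mat 1) (?Um ** ?H ** ?Up) (?Um ** ?Up) (fst a) (fst b) (fst c) (fst l) +
          loss_tensor z (mat 1) (?Um ** ?Up) (?Um ** ?H ** ?Up) (fst a) (fst b) (fst c) (fst l)
        else loss_tensor z (?O v) (site_unitary Gs p v \<theta>) (site_unitary Gs p v \<theta>) (fst a) (fst b) (fst c) (fst l)) *
      cnj (if v = i then loss_tensor z (mat 1) (?Um ** ?H ** ?Up) (?Um ** ?Up) (snd a) (snd b) (snd c) (snd l) +
          loss_tensor z (mat 1) (?Um ** ?Up) (?Um ** ?H ** ?Up) (snd a) (snd b) (snd c) (snd l)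
        else loss_tensor z (?O v) (site_unitary Gs p v \<theta>) (site_unitary Gs p v \<theta>) (snd a) (snd b) (snd c) (snd l)) =
      (if v = i then \<Sum>k\<in>UNIV. f k a b c l (?N (Inr True) \<theta>) * g k a b c l (?N (Inr False) \<theta>)
       else h v a b c l (?N (Inl v) \<theta>))"
    proof (cases "v = i")
      case True
      show ?thesis
        unfolding if_P[OF True] deriv_tensor_quad deriv_quad_def sum_UNIV_quadruple f_def g_def by simp
    next
      case False
      show ?thesis
        unfolding if_not_P[OF False] loss_tensor_quad h_def by simp
    qed
  qed
  have "has_bochner_integral M (\<lambda>\<theta>. F \<theta> * cnj (F \<theta>))
    (tn_net L (\<lambda>v a b c l. if v = i then \<Sum>k\<in>UNIV. (\<integral>\<theta>. f k a b c l (?N (Inr True) \<theta>) \<partial>M) * (\<integral>\<theta>. g k a b c l (?N (Inr False) \<theta>) \<partial>M)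
       else (\<integral>\<theta>. h v a b c l (?N (Inl v) \<theta>) \<partial>M)))"
    unfolding F
  proof (rule tn_net_expectation[OF ind iw(1)])
    fix v and a b c l :: "'b quad" assume v: "v \<in> sites L - {i}"
    show "h v a b c l \<in> borel_measurable borel"
      unfolding h_def site_quad_def by measurable
    show "integrable M (\<lambda>\<theta>. h v a b c l (?N (Inl v) \<theta>))"
      unfolding h_def using site_quad_expectation(1)[OF prob_space_axioms U N z] v by simp
  next
    fix \<kappa> :: "'d quad \<times> 'd quad \<times> ('b \<times> 'b \<times> 'd) quad \<times> ('b \<times> 'b \<times> 'd) quad" and a b c l :: "'b quad"
    obtain r q m n where \<kappa>: "\<kappa> = (r, q, m, n)" by (metis prod.exhaust)
    show "f \<kappa> a b c l \<in> borel_measurable borel" "g \<kappa> a b c l \<in> borel_measurable borel"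
      unfolding f_def g_def \<kappa> prod.case by measurable
    show "integrable M (\<lambda>\<theta>. f \<kappa> a b c l (?N (Inr True) \<theta>))" "integrable M (\<lambda>\<theta>. g \<kappa> a b c l (?N (Inr False) \<theta>))"
      unfolding f_def g_def \<kappa> prod.case using quad_entry_integrable[OF prob_space_axioms Um] quad_entry_integrable[OF prob_space_axioms Up]
      by (auto intro!: integrable_mult_right)
  qed
  also have "tn_net L (\<lambda>v a b c l. if v = i then \<Sum>k\<in>UNIV. (\<integral>\<theta>. f k a b c l (?N (Inr True) \<theta>) \<partial>M) * (\<integral>\<theta>. g k a b c l (?N (Inr False) \<theta>) \<partial>M)
       else (\<integral>\<theta>. h v a b c l (?N (Inl v) \<theta>) \<partial>M)) =
    tn_net L (\<lambda>v (a :: 'b quad) b c l. \<Sum>\<sigma>\<in>UNIV. \<Sum>\<rho>\<in>UNIV. spin_coeff (Gs k) A i w v \<sigma> \<rho> *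
      (of_bool (pairing \<sigma> a) * of_bool (pairing \<sigma> b)) * (of_bool (pairing \<rho> c) * of_bool (pairing \<rho> l)))"
  proof (rule tn_net_cong)
    fix v and a b c l :: "'b quad" assume v: "v \<in> sites L"
    show "(if v = i then \<Sum>k\<in>UNIV. (\<integral>\<theta>. f k a b c l (?N (Inr True) \<theta>) \<partial>M) * (\<integral>\<theta>. g k a b c l (?N (Inr False) \<theta>) \<partial>M)
       else (\<integral>\<theta>. h v a b c l (?N (Inl v) \<theta>) \<partial>M)) =
      (\<Sum>\<sigma>\<in>UNIV. \<Sum>\<rho>\<in>UNIV. spin_coeff (Gs k) A i w v \<sigma> \<rho> *
      (of_bool (pairing \<sigma> a) * of_bool (pairing \<sigma> b)) * (of_bool (pairing \<rho> c) * of_bool (pairing \<rho> l)))"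
    proof (cases "v = i")
      case True
      have "(\<Sum>k\<in>UNIV. (\<integral>\<theta>. f k a b c l (?N (Inr True) \<theta>) \<partial>M) * (\<integral>\<theta>. g k a b c l (?N (Inr False) \<theta>) \<partial>M)) =
        (\<Sum>r\<in>UNIV. \<Sum>p'\<in>UNIV. \<Sum>m\<in>UNIV. \<Sum>n\<in>UNIV. (state_weight z r * obs_weight (mat 1 :: complex^'d^'d) p' *
          deriv_weight ?H m n * (\<integral>\<omega>. quad_entry (partial_unitary Gs 0 s i \<omega>) (join_quad a b r) m \<partial>M)) *
        (\<integral>\<omega>. quad_entry (partial_unitary Gs s p i \<omega>) n (join_quad c l p') \<partial>M))"
        unfolding sum_UNIV_quadruple f_def g_def by simp
      then show ?thesis
        unfolding if_P[OF True] deriv_quad_expectation[OF Um Up N z G] spin_coeff_def Let_def .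
    next
      case False
      show ?thesis
        unfolding if_not_P[OF False] spin_coeff_def Let_def h_def
        using site_quad_expectation(2)[OF prob_space_axioms U[OF v] N z, of "?O v" a b c l] by simp
    qed
  qed
  also have "\<dots> = (\<Sum>S\<in>Pow (sites L). \<Prod>v\<in>sites L. spin_weight (Gs k) A (real CARD('b)) i w v (v \<in> S) (next_y L v \<in> S) (next_x L v \<in> S))"
    unfolding tn_net_spin_sum spin_weight_def gram_def by (intro sum.cong prod.cong refl) auto
  finally show ?thesis .
qed

lemma norm_weingarten_le_1:
  assumes "N \<ge> 2"
  shows "\<bar>weingarten N b\<bar> \<le> 1"
proof -
  have "N\<^sup>2 \<ge> 4" using assms power_mono[of 2 N 2] by simp
  then have Q: "N * 1 \<le> N * (N\<^sup>2 - 1)"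
    using assms by (intro mult_left_mono) auto
  have "\<bar>if b then N else - 1\<bar> \<le> N" using assms by auto
  with Q have "\<bar>if b then N else - 1\<bar> \<le> N * (N\<^sup>2 - 1)" by linarith
  moreover have "N * (N\<^sup>2 - 1) > 0" using Q assms by linarith
  ultimately show ?thesis unfolding weingarten_def by (simp add: abs_divide)
qed

text \<open>At \<open>i\<close> the weight factors through \<open>bulk_weight\<close> with a swapped
  row spin, hence vanishes without a swapped successor. At \<open>w\<close> only a crude bound is
  available: two column spins, two Gram entries of at most D^2 and the contracted observable.
  \<open>K\<close> is the sum of 1 and the two bounds.\<close>

lemma spin_weight_bounds:
  fixes G :: "('b::finite, 'd::finite) site_matrix" and A :: "complex^'d^'d"
  assumes iw: "i \<noteq> w" and b: "CARD('b) \<ge> 2" and d: "CARD('d) \<ge> 2"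
    and A: "hermitian_matrix A" and \<tau>: "trace (A ** A) = of_real \<tau>"
  defines "W \<equiv> spin_weight G A (real CARD('b)) i w"
    and "K \<equiv> 1 + norm (commutator_weight G) + 2 * (real CARD('b)) ^ 4 * ((real CARD('d))\<^sup>2 * \<bar>\<tau>\<bar>)"
  shows "v \<noteq> i \<Longrightarrow> v \<noteq> w \<Longrightarrow> W v True False False = 0"
    "v \<noteq> i \<Longrightarrow> v \<noteq> w \<Longrightarrow> norm (W v False False False) \<le> 1"
    "v \<noteq> i \<Longrightarrow> v \<noteq> w \<Longrightarrow> t \<or> u \<Longrightarrow> norm (W v True t u) + norm (W v False t u) \<le> 2 / 3"
    "W i \<sigma> False False = 0"
    "v \<in> {i, w} \<Longrightarrow> norm (W v \<sigma> t u) \<le> K"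
proof -
  define D where "D = real CARD('b)"
  define e where "e = real CARD('d)"
  have D: "D \<ge> 2" and e: "e \<ge> 2" unfolding D_def e_def using b d by linarith+
  have N: "real CARD('b \<times> 'b \<times> 'd) = D * (D * e)"
    unfolding D_def e_def by (simp add: card_cartesian_product flip: UNIV_Times_UNIV)
  note bw = bulk_weight_bounds[OF D e]
  have N2: "D * (D * e) \<ge> 2"
    using D e mult_mono[of 2 D 2 "D * e"] mult_mono[of 2 D 2 e] by linarith
  have obs: "obs_contract (mat 1 :: complex^'d^'d) \<rho> = of_real (if \<rho> then e else e * e)" for \<rho>
    unfolding obs_contract_mat_1 e_def ..
  have bulk: "W v \<sigma> t u = of_real (bulk_weight D e \<sigma> t u)" if "v \<noteq> i" "v \<noteq> w" for v \<sigma> t u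
    unfolding W_def spin_weight_def spin_coeff_def Let_def if_not_P[OF that(1)] if_not_P[OF that(2)] obs N bulk_weight_def D_def[symmetric]
    by simp
  have Wi: "W i \<sigma> t u = of_real (weingarten (D * (D * e)) \<sigma>) * commutator_weight G * of_real (bulk_weight D e True t u)" for \<sigma> t u
    unfolding W_def spin_weight_def spin_coeff_def Let_def if_P[OF refl] obs N bulk_weight_def D_def[symmetric]
    by (simp add: sum_distrib_left mult_ac)
  show "W v True False False = 0" if "v \<noteq> i" "v \<noteq> w"
    unfolding bulk[OF that] bw by simp
  show "norm (W v False False False) \<le> 1" if "v \<noteq> i" "v \<noteq> w"
    unfolding bulk[OF that] bw by simp
  show "norm (W v True t u) + norm (W v False t u) \<le> 2 / 3" if "v \<noteq> i" "v \<noteq> w" "t \<or> u"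
    unfolding bulk[OF that(1,2)] norm_of_real using bw(3)[of True t u] bw(3)[of False t u] bw(4)[OF that(3)] by simp
  show "W i \<sigma> False False = 0"
    unfolding Wi bw by simp
  show "norm (W v \<sigma> t u) \<le> K" if "v \<in> {i, w}"
  proof (cases "v = i")
    case True
    have "bulk_weight D e True t u \<le> 1"
    proof (cases "t \<or> u")
      case True
      then show ?thesis using bw(3)[of False t u] bw(4)[of t u] by simp
    qed (use bw(1) in simp)
    then have "norm (W v \<sigma> t u) \<le> 1 * norm (commutator_weight G) * 1"
      unfolding True Wi norm_mult norm_of_real using bw(3)[of True t u] norm_weingarten_le_1[OF N2]
      by (intro mult_mono) auto
    also have "\<dots> \<le> K" unfolding K_def by simp
    finally show ?thesis .
  next
    case False
    then have v: "v = w" using that by simp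
    let ?B = "(real CARD('d))\<^sup>2 * \<bar>\<tau>\<bar>"
    have g: "\<bar>gram D x y\<bar> \<le> D * D" for x y
      unfolding gram_def using D mult_mono[of 1 D D D] by auto
    have "norm (W v \<sigma> t u) \<le> (\<Sum>\<rho>\<in>(UNIV :: bool set). 1 * ?B * (D * D) * (D * D))"
      unfolding W_def spin_weight_def
    proof (rule sum_norm_le)
      fix \<rho> :: bool
      have sc: "spin_coeff G A i w v \<sigma> \<rho> = of_real (weingarten (D * (D * e)) (\<sigma> = \<rho>)) * obs_contract A \<rho>"
        unfolding spin_coeff_def Let_def using False v N by simp
      show "norm (spin_coeff G A i w v \<sigma> \<rho> * of_real (gram (real CARD('b)) \<rho> t) * of_real (gram (real CARD('b)) \<rho> u)) \<le> 1 * ?B * (D * D) * (D * D)"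
        unfolding sc norm_mult norm_of_real D_def[symmetric]
        using norm_weingarten_le_1[OF N2] norm_obs_contract_le[OF A \<tau>] g D
        by (intro mult_mono mult_nonneg_nonneg) auto
    qed
    also have "\<dots> = 2 * D ^ 4 * ?B" by (simp add: power4_eq_xxxx mult_ac)
    also have "\<dots> \<le> K" unfolding K_def D_def by simp
    finally show ?thesis .
  qed
qed

text \<open>\<open>G\<close> and \<open>\<tau>\<close> are fixed outside the existential quantifier
  because the implied constant may depend on the generator and on the trace of the squared
  observable.\<close>

theorem theorem6:
  fixes G :: "complex^('b::finite \<times> 'b \<times> 'd::finite)^('b \<times> 'b \<times> 'd)"
    and \<tau> :: real
  assumes "CARD('b) \<ge> 2" and "CARD('d) \<ge> 2"
  shows "\<exists>C::real. \<forall>(L::nat) (p::nat) (Gs :: nat \<Rightarrow> ('b, 'd) site_matrix) (k::nat)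
           (i::site) (w::site) (z :: complex^'d) (A :: complex^'d^'d) (M :: params measure) (\<epsilon>::real).
         (\<forall>\<xi><p. hermitian_matrix (Gs \<xi>)) \<and> k < p \<and> Gs k = G \<and>
         i \<in> sites L \<and> w \<in> sites L \<and> i \<noteq> w \<and>
         norm z = 1 \<and> hermitian_matrix A \<and> trace (A ** A) = of_real \<tau> \<and>
         random_tn_params L p Gs i k M \<and> \<epsilon> > 0 \<longrightarrow>
         measure M {\<theta> \<in> space M. norm (param_deriv (local_loss L p Gs z A w) (i, k) \<theta>) > \<epsilon>}
           \<le> C * (0.93 ^ torus_dist L w i / \<epsilon>\<^sup>2)"
proof -
  define K where "K = 1 + norm (commutator_weight G) + 2 * (real CARD('b)) ^ 4 * ((real CARD('d))\<^sup>2 * \<bar>\<tau>\<bar>)"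
  have K1: "K \<ge> 1" unfolding K_def by simp
  have N: "CARD('b \<times> 'b \<times> 'd) \<ge> 2"
  proof -
    have "CARD('b \<times> 'b \<times> 'd) = CARD('b) * (CARD('b) * CARD('d))"
      by (simp add: card_cartesian_product flip: UNIV_Times_UNIV)
    then show ?thesis using assms mult_le_mono[of 2 "CARD('b)" 1 "CARD('b) * CARD('d)"] by (simp add: Suc_le_eq)
  qed
  show ?thesis
  proof (intro exI[of _ "1809 * K\<^sup>2"] allI impI)
    fix L p k and Gs :: "nat \<Rightarrow> ('b, 'd) site_matrix" and i w :: site and z :: "complex^'d" and A :: "complex^'d^'d"
      and M :: "params measure" and \<epsilon> :: real
    assume H: "(\<forall>\<xi><p. hermitian_matrix (Gs \<xi>)) \<and> k < p \<and> Gs k = G \<and>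
         i \<in> sites L \<and> w \<in> sites L \<and> i \<noteq> w \<and>
         norm z = 1 \<and> hermitian_matrix A \<and> trace (A ** A) = of_real \<tau> \<and>
         random_tn_params L p Gs i k M \<and> \<epsilon> > 0"
    then have k: "k < p" and iw: "i \<in> sites L" "w \<in> sites L" "i \<noteq> w" and z: "norm z = 1" and Gk: "Gs k = G"
      and A: "hermitian_matrix A" "trace (A ** A) = of_real \<tau>" and R: "random_tn_params L p Gs i k M" and \<epsilon>: "\<epsilon> > 0"
      and G: "hermitian_matrix (Gs k)"
      by auto
    interpret prob_space M using R unfolding random_tn_params_def by blast
    let ?F = "param_deriv (local_loss L p Gs z A w) (i, k)"
    let ?W = "spin_weight G A (real CARD('b)) i w"
    note hb = param_deriv_second_moment[where A = A, OF iw k N z G R, unfolded Gk]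
    have sq: "(norm (?F \<theta>))\<^sup>2 = Re (?F \<theta> * cnj (?F \<theta>))" for \<theta>
      by (simp only: complex_norm_square[symmetric] Re_complex_of_real)
    have hr: "has_bochner_integral M (\<lambda>\<theta>. (norm (?F \<theta>))\<^sup>2)
      (Re (\<Sum>S\<in>Pow (sites L). \<Prod>v\<in>sites L. ?W v (v \<in> S) (next_y L v \<in> S) (next_x L v \<in> S)))"
      unfolding sq by (rule has_bochner_integral_bounded_linear[OF bounded_linear_Re hb])
    then have int: "integrable M (\<lambda>\<theta>. (norm (?F \<theta>))\<^sup>2)"
      and val: "(\<integral>\<theta>. (norm (?F \<theta>))\<^sup>2 \<partial>M) =
        Re (\<Sum>S\<in>Pow (sites L). \<Prod>v\<in>sites L. ?W v (v \<in> S) (next_y L v \<in> S) (next_x L v \<in> S))"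
      unfolding has_bochner_integral_iff by auto
    have "(\<integral>\<theta>. (norm (?F \<theta>))\<^sup>2 \<partial>M) \<le>
        norm (\<Sum>S\<in>Pow (sites L). \<Prod>v\<in>sites L. ?W v (v \<in> S) (next_y L v \<in> S) (next_x L v \<in> S))"
      unfolding val by (rule complex_Re_le_cmod)
    \<comment> \<open>The bulk weights are nonnegative reals, so passing to norms gives up only the
      signs and phases at \<open>i\<close> and \<open>w\<close>.\<close>
    also have "\<dots> \<le> (\<Sum>S\<in>Pow (sites L). \<Prod>v\<in>sites L. norm (?W v (v \<in> S) (next_y L v \<in> S) (next_x L v \<in> S)))"
      unfolding prod_norm by (rule norm_sum)
    also have "\<dots> \<le> 1809 * K\<^sup>2 * 0.93 ^ torus_dist L w i"
      by (rule torus_spin_sum_le[where W = "\<lambda>v s t u. norm (?W v s t u)", OF iw])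
        (use K1 spin_weight_bounds[OF iw(3) assms A] in \<open>simp_all add: K_def\<close>)
    finally have mom: "(\<integral>\<theta>. (norm (?F \<theta>))\<^sup>2 \<partial>M) \<le> 1809 * K\<^sup>2 * 0.93 ^ torus_dist L w i" .
    have [measurable]: "(\<lambda>\<theta>. (norm (?F \<theta>))\<^sup>2) \<in> borel_measurable M" using int by auto
    \<comment> \<open>Measurability of this larger event comes from integrability of the squared
      norm, and it is the event to which monotonicity and Markov's inequality are applied.\<close>
    have S: "{\<theta> \<in> space M. (norm (?F \<theta>))\<^sup>2 \<ge> \<epsilon>\<^sup>2} \<in> sets M" by measurable
    have "measure M {\<theta> \<in> space M. norm (?F \<theta>) > \<epsilon>} \<le> measure M {\<theta> \<in> space M. (norm (?F \<theta>))\<^sup>2 \<ge> \<epsilon>\<^sup>2}"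
      using \<epsilon> by (intro finite_measure_mono[OF _ S]) (auto intro!: power_mono)
    also have "\<dots> \<le> (\<integral>\<theta>. (norm (?F \<theta>))\<^sup>2 \<partial>M) / \<epsilon>\<^sup>2"
      using \<epsilon> by (intro integral_Markov_inequality_measure[OF int, of "{}"]) auto
    also have "\<dots> \<le> 1809 * K\<^sup>2 * 0.93 ^ torus_dist L w i / \<epsilon>\<^sup>2"
      by (intro divide_right_mono mom) simp
    finally show "measure M {\<theta> \<in> space M. norm (?F \<theta>) > \<epsilon>} \<le> 1809 * K\<^sup>2 * (0.93 ^ torus_dist L w i / \<epsilon>\<^sup>2)"
      by simp
  qed
qed

end
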